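(* Let $\langle i_X:\mathcal M X\to\mathcal P X\leftarrow\mathcal M'X:i'_X;\ X\in\mathcal C\rangle$ be a weak temporal doctrine. The functors $\underline{\rm nat}_X$ and $\underline{\rm nat}'_X$ enrich $\mathcal M X$ and $\mathcal M'X$, respectively, in $\mathcal B1$. Moreover, for every $X\in\mathcal C$ and every map $f:X\to Y$ in $\mathcal C$, there are isomorphisms in $\mathcal B1$, natural in all the variables (which range over the categories indicated by the types of the functors): $$\underline{\rm meets}_X(f^*Q,P)\cong\underline{\rm meets}_Y(Q,\Sigma_fP),\qquad \underline{\rm meets}_X(P,f^*Q)\cong\underline{\rm meets}_Y(\Sigma_fP,Q)$$ $$\underline{\rm ten}_X(N,\Diamond_XP)\cong\underline{\rm meets}_X(i'_XN,P),\qquad \underline{\rm ten}_X(\Diamond'_XP,M)\cong\underline{\rm meets}_X(P,i_XM)$$ $$\underline{\rm nat}_X(f\cdot M,L)\cong\underline{\rm nat}_Y(M,\forall_fL),\qquad \underline{\rm nat}'_X(f'\cdot O,N)\cong\underline{\rm nat}'_Y(O,\forall'_fN)$$ $$\underline{\rm nat}_X(L,f\cdot M)\cong\underline{\rm nat}_Y(\exists_fL,M),\qquad \underline{\rm nat}'_X(N,f'\cdot O)\cong\underline{\rm nat}'_Y(\exists'_fN,O)$$ $$\underline{\rm ten}_X(f'\cdot N,L)\cong\underline{\rm ten}_Y(N,\exists_fL),\qquad \underline{\rm ten}_X(N,f\cdot M)\cong\underline{\rm ten}_Y(\exists'_fN,M)$$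
   Context: A weak temporal doctrine $\langle i_X:\mathcal M X\to\mathcal P X\leftarrow\mathcal M'X:i'_X;\ X\in\mathcal C\rangle$ consists of a category $\mathcal C$, three $\mathcal C$-indexed categories $\mathcal M,\mathcal P,\mathcal M'$ (pseudofunctors $\mathcal C^{op}\to\mathbf{Cat}$), and two indexed functors $i:\mathcal M\to\mathcal P$, $i':\mathcal M'\to\mathcal P$. The substitution functors along $f:X\to Y$ are written $f\cdot(-):\mathcal M Y\to\mathcal M X$, $f'\cdot(-):\mathcal M'Y\to\mathcal M'X$, $f^*:\mathcal P Y\to\mathcal P X$; thus $i_X(f\cdot M)\cong f^*i_Y M$ and $i'_X(f'\cdot N)\cong f^*i'_Y N$, coherently. $\mathcal B X:=\mathcal M X\times_{\mathcal P X}\mathcal M'X$ denotes the indexed pullback of $i$ and $i'$ (equalities up to the coherent isomorphisms), with projections $j_X:\mathcal B X\to\mathcal M X$, $j'_X:\mathcal B X\to\mathcal M'X$, and $b_X:=i_Xj_X=i'_Xj'_X:\mathcal B X\to\mathcal P X$. The axioms are: (A1) $\mathcal C$ has a terminal object $1$. (A2) Each $\mathcal P X$ has finite products (terminal object $1_X$, products $P\times_XQ$), and the objects $i_XM$ and $i'_XN$ are exponentiable in it: the exponentials $i_XM\Rightarrow P$ and $i'_XN\Rightarrow P$ exist for all $M\in\mathcal M X$, $N\in\mathcal M'X$, $P\in\mathcal P X$. (A3) Each $f^*$ has a left adjoint $\Sigma_f\dashv f^*$; for each $f:X\to Y$ the functors $f\cdot(-)$ and $f'\cdot(-)$ have right adjoints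 $\forall_f:\mathcal M X\to\mathcal M Y$ and $\forall'_f:\mathcal M'X\to\mathcal M'Y$. (A4) $i_X$ and $i'_X$ have left and right adjoints: $\Diamond_X\dashv i_X\dashv\Box_X$, $\Diamond'_X\dashv i'_X\dashv\Box'_X$. (A5) (comprehension) The canonical functor $c_X:\mathcal C/X\to\mathcal P X$, sending $f:T\to X$ to $\Sigma_f1_T$, has a right adjoint $k_X:\mathcal P X\to\mathcal C/X$. (B1) $i_X$ and $i'_X$ are fully faithful. (B2) (Frobenius law) $\Sigma_fP\times_YQ\cong\Sigma_f(P\times_Xf^*Q)$ canonically, naturally in $P\in\mathcal P X$, $Q\in\mathcal P Y$, for every $f:X\to Y$. (B3) (mixed Frobenius laws) The units of $\Diamond_X\dashv i_X$ and $\Diamond'_X\dashv i'_X$ induce isomorphisms $\Diamond_X(P\times_Xi'_XN)\cong\Diamond_X(i_X\Diamond_XP\times_Xi'_XN)$ and $\Diamond'_X(P\times_Xi_XM)\cong\Diamond'_X(i'_X\Diamond'_XP\times_Xi_XM)$, natural in $P\in\mathcal P X$, $M\in\mathcal M X$, $N\in\mathcal M'X$. (B4) $j_1:\mathcal B1\to\mathcal M1$ and $j'_1:\mathcal B1\to\mathcal M'1$ are isomorphisms. (B5) Each $k_X$ is fully faithful. Derived notation. For $f:X\to Y$, $f\cdot(-)$ has left adjoint $\exists_f:=\Diamond_Y\Sigma_fi_X$ and $f'\cdot(-)$ has left adjoint $\exists'_f:=\Diamond'_Y\Sigma_fi'_X$. An object $X$ used as an index of a quantifier denotes the map $X\to1$.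 The functor $X^*b_1:\mathcal B1\to\mathcal P X$ has left adjoint $\underline{\rm coend}_X\cong j_1^{-1}\exists_X\Diamond_X$ and right adjoint $\underline{\rm end}_X\cong j_1^{-1}\forall_X\Box_X$. For $P,Q\in\mathcal P X$, $L,M\in\mathcal M X$, $N,O\in\mathcal M'X$ put $\underline{\rm meets}_X(P,Q):=\underline{\rm coend}_X(P\times_XQ)$, $\underline{\rm ten}_X(N,M):=\underline{\rm meets}_X(i'_XN,i_XM)$, $\underline{\rm nat}_X(L,M):=\underline{\rm end}_X(i_XL\Rightarrow i_XM)$, $\underline{\rm nat}'_X(N,O):=\underline{\rm end}_X(i'_XN\Rightarrow i'_XO)$, all objects of $\mathcal B1$. That a functor $H:\mathcal A^{op}\times\mathcal A\to\mathcal B1$ enriches $\mathcal A$ in $\mathcal B1$ means that it gives the hom-objects of a $\mathcal B1$-category (with respect to the cartesian structure) whose underlying ordinary category is $\mathcal A$; in particular $\mathcal B1(\mathtt{true},H(A,A'))\cong\mathcal A(A,A')$, with $\mathtt{true}$ the terminal object of $\mathcal B1$. *)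

theory Defs
  imports Main
begin

section \<open>Categories, functors, adjunctions\<close>

text \<open>Every arrow determines its source and its target; \<open>g \<odot> f\<close> is \<open>g\<close> after \<open>f\<close>.\<close>

record ('o, 'a) cat =
  Ob :: "'o set"
  Ar :: "'a set"
  src :: "'a \<Rightarrow> 'o"
  tgt :: "'a \<Rightarrow> 'o"
  idn :: "'o \<Rightarrow> 'a"
  cmp :: "'a \<Rightarrow> 'a \<Rightarrow> 'a"  (infixl "\<odot>\<index>" 70)

definition hom :: "('o, 'a, 'z) cat_scheme \<Rightarrow> 'o \<Rightarrow> 'o \<Rightarrow> 'a set" where
  "hom C A B = {f \<in> Ar C. src C f = A \<and> tgt C f = B}"

locale category =
  fixes C :: "('o, 'a) cat" (structure)
  assumes src_in: "f \<in> Ar C \<Longrightarrow> src C f \<in> Ob C"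
    and tgt_in: "f \<in> Ar C \<Longrightarrow> tgt C f \<in> Ob C"
    and idn_hom: "A \<in> Ob C \<Longrightarrow> idn C A \<in> hom C A A"
    and cmp_hom: "f \<in> hom C A B \<Longrightarrow> g \<in> hom C B E \<Longrightarrow> g \<odot> f \<in> hom C A E"
    and cmp_idn: "f \<in> hom C A B \<Longrightarrow> f \<odot> idn C A = f"
    and idn_cmp: "f \<in> hom C A B \<Longrightarrow> idn C B \<odot> f = f"
    and cmp_assoc: "f \<in> hom C A B \<Longrightarrow> g \<in> hom C B E \<Longrightarrow> h \<in> hom C E G \<Longrightarrow>
      (h \<odot> g) \<odot> f = h \<odot> (g \<odot> f)"

definition is_iso :: "('o, 'a) cat \<Rightarrow> 'a \<Rightarrow> bool" where
  "is_iso C f \<longleftrightarrow> f \<in> Ar C \<and>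
    (\<exists>g \<in> hom C (tgt C f) (src C f).
      g \<odot>\<^bsub>C\<^esub> f = idn C (src C f) \<and> f \<odot>\<^bsub>C\<^esub> g = idn C (tgt C f))"

definition is_terminal :: "('o, 'a) cat \<Rightarrow> 'o \<Rightarrow> bool" where
  "is_terminal C t \<longleftrightarrow> t \<in> Ob C \<and> (\<forall>A \<in> Ob C. \<exists>!f. f \<in> hom C A t)"

definition op_cat :: "('o, 'a) cat \<Rightarrow> ('o, 'a) cat" where
  "op_cat C = \<lparr>Ob = Ob C, Ar = Ar C, src = tgt C, tgt = src C, idn = idn C,
    cmp = (\<lambda>g f. f \<odot>\<^bsub>C\<^esub> g)\<rparr>"

definition prod_cat :: "('o, 'a) cat \<Rightarrow> ('p, 'b) cat \<Rightarrow> ('o \<times> 'p, 'a \<times> 'b) cat"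
    (infixr "\<times>\<^sub>C" 80) where
  "C \<times>\<^sub>C D = \<lparr>Ob = Ob C \<times> Ob D, Ar = Ar C \<times> Ar D,
    src = map_prod (src C) (src D), tgt = map_prod (tgt C) (tgt D),
    idn = map_prod (idn C) (idn D),
    cmp = (\<lambda>(g, g') (f, f'). (g \<odot>\<^bsub>C\<^esub> f, g' \<odot>\<^bsub>D\<^esub> f'))\<rparr>"

record ('o, 'a, 'p, 'b) func =
  fob :: "'o \<Rightarrow> 'p"
  far :: "'a \<Rightarrow> 'b"

locale is_functor = C: category C + D: category D
  for C :: "('o, 'a) cat" and D :: "('p, 'b) cat" +
  fixes F :: "('o, 'a, 'p, 'b) func"
  assumes fob_in: "A \<in> Ob C \<Longrightarrow> fob F A \<in> Ob D"
    and far_hom: "f \<in> hom C A B \<Longrightarrow> far F f \<in> hom D (fob F A) (fob F B)"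
    and far_idn: "A \<in> Ob C \<Longrightarrow> far F (idn C A) = idn D (fob F A)"
    and far_cmp: "f \<in> hom C A B \<Longrightarrow> g \<in> hom C B E \<Longrightarrow>
      far F (g \<odot>\<^bsub>C\<^esub> f) = far F g \<odot>\<^bsub>D\<^esub> far F f"

definition id_func :: "('o, 'a, 'o, 'a) func" where
  "id_func = \<lparr>fob = (\<lambda>A. A), far = (\<lambda>f. f)\<rparr>"

definition comp_func ::
    "('p, 'b, 'q, 'c) func \<Rightarrow> ('o, 'a, 'p, 'b) func \<Rightarrow> ('o, 'a, 'q, 'c) func"
    (infixr "\<bullet>" 70) where
  "G \<bullet> F = \<lparr>fob = fob G \<circ> fob F, far = far G \<circ> far F\<rparr>"

text \<open>A functor \<open>C \<rightarrow> D\<close> is, with the same data, a functor between the opposite categories; so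
  \<open>F \<times>\<^sub>f G\<close> also serves on products of the form \<open>op_cat A \<times>\<^sub>C B\<close>.\<close>

definition prod_func ::
    "('o, 'a, 'p, 'b) func \<Rightarrow> ('q, 'c, 'r, 'd) func
      \<Rightarrow> ('o \<times> 'q, 'a \<times> 'c, 'p \<times> 'r, 'b \<times> 'd) func"
    (infixr "\<times>\<^sub>f" 80) where
  "F \<times>\<^sub>f G = \<lparr>fob = map_prod (fob F) (fob G), far = map_prod (far F) (far G)\<rparr>"

definition fully_faithful ::
    "('o, 'a) cat \<Rightarrow> ('p, 'b) cat \<Rightarrow> ('o, 'a, 'p, 'b) func \<Rightarrow> bool" where
  "fully_faithful C D F \<longleftrightarrow>
    (\<forall>A \<in> Ob C. \<forall>B \<in> Ob C. bij_betw (far F) (hom C A B) (hom D (fob F A) (fob F B)))"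

locale natural_trans = F: is_functor C D F + G: is_functor C D G
  for C :: "('o, 'a) cat" and D :: "('p, 'b) cat" and F G :: "('o, 'a, 'p, 'b) func" +
  fixes \<tau> :: "'o \<Rightarrow> 'b"
  assumes component: "A \<in> Ob C \<Longrightarrow> \<tau> A \<in> hom D (fob F A) (fob G A)"
    and naturality: "f \<in> hom C A B \<Longrightarrow> \<tau> B \<odot>\<^bsub>D\<^esub> far F f = far G f \<odot>\<^bsub>D\<^esub> \<tau> A"

locale natural_iso = natural_trans +
  assumes component_iso: "A \<in> Ob C \<Longrightarrow> is_iso D (\<tau> A)"

definition naturally_isomorphic ::
    "('o, 'a) cat \<Rightarrow> ('p, 'b) cat \<Rightarrow> ('o, 'a, 'p, 'b) func \<Rightarrow> ('o, 'a, 'p, 'b) func \<Rightarrow> bool" where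
  "naturally_isomorphic C D F G \<longleftrightarrow> (\<exists>\<tau>. natural_iso C D F G \<tau>)"

definition is_equivalence ::
    "('o, 'a) cat \<Rightarrow> ('p, 'b) cat \<Rightarrow> ('o, 'a, 'p, 'b) func \<Rightarrow> bool" where
  "is_equivalence C D F \<longleftrightarrow> is_functor C D F \<and>
    (\<exists>G. is_functor D C G \<and>
      naturally_isomorphic C C (G \<bullet> F) id_func \<and> naturally_isomorphic D D (F \<bullet> G) id_func)"

text \<open>\<open>F : C \<rightarrow> D\<close> is left adjoint to \<open>G : D \<rightarrow> C\<close>, with unit \<open>\<eta>\<close> and counit \<open>\<epsilon>\<close>.\<close>

locale adjunction =
  unit: natural_trans C C id_func "G \<bullet> F" \<eta> +
  counit: natural_trans D D "F \<bullet> G" id_func \<epsilon> +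
  left: is_functor C D F + right: is_functor D C G
  for C :: "('o, 'a) cat" and D :: "('p, 'b) cat"
    and F :: "('o, 'a, 'p, 'b) func" and G :: "('p, 'b, 'o, 'a) func"
    and \<eta> :: "'o \<Rightarrow> 'a" and \<epsilon> :: "'p \<Rightarrow> 'b" +
  assumes triangle_left:
      "A \<in> Ob C \<Longrightarrow> \<epsilon> (fob F A) \<odot>\<^bsub>D\<^esub> far F (\<eta> A) = idn D (fob F A)"
    and triangle_right:
      "B \<in> Ob D \<Longrightarrow> far G (\<epsilon> B) \<odot>\<^bsub>C\<^esub> \<eta> (fob G B) = idn C (fob G B)"

definition adjoint_pair ::
    "('o, 'a) cat \<Rightarrow> ('p, 'b) cat \<Rightarrow> ('o, 'a, 'p, 'b) func \<Rightarrow> ('p, 'b, 'o, 'a) func \<Rightarrow> bool" where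
  "adjoint_pair C D F G \<longleftrightarrow> (\<exists>\<eta> \<epsilon>. adjunction C D F G \<eta> \<epsilon>)"


section \<open>Slices and pseudo-pullbacks\<close>

text \<open>An object of the slice \<open>C/X\<close> is an arrow \<open>f\<close> of \<open>C\<close> with target \<open>X\<close>; an arrow
  is \<open>(f, h, g)\<close> with \<open>f = g \<odot> h\<close>, where \<open>f\<close> and \<open>g\<close> serve as its source and target.\<close>

definition slice :: "('o, 'a) cat \<Rightarrow> 'o \<Rightarrow> ('a, 'a \<times> 'a \<times> 'a) cat" where
  "slice C X = \<lparr>
    Ob = {f \<in> Ar C. tgt C f = X},
    Ar = {(f, h, g). f \<in> Ar C \<and> tgt C f = X \<and> g \<in> Ar C \<and> tgt C g = X \<and>
           h \<in> hom C (src C f) (src C g) \<and> g \<odot>\<^bsub>C\<^esub> h = f},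
    src = (\<lambda>(f, h, g). f), tgt = (\<lambda>(f, h, g). g),
    idn = (\<lambda>f. (f, idn C (src C f), f)),
    cmp = (\<lambda>(f', h', g') (f, h, g). (f, h' \<odot>\<^bsub>C\<^esub> h, g'))\<rparr>"

text \<open>The pullback of \<open>F : A \<rightarrow> E\<close> and \<open>G : B \<rightarrow> E\<close> in which the equality of the two images is
  replaced by a specified isomorphism. Arrows again carry their source and target.\<close>

type_synonym ('oa, 'ob, 'ae) pp_ob = "'oa \<times> 'ob \<times> 'ae"
type_synonym ('oa, 'aa, 'ob, 'ab, 'ae) pp_ar =
  "('oa, 'ob, 'ae) pp_ob \<times> ('aa \<times> 'ab) \<times> ('oa, 'ob, 'ae) pp_ob"

definition pseudo_pullback ::
    "('oa, 'aa) cat \<Rightarrow> ('ob, 'ab) cat \<Rightarrow> ('oe, 'ae) cat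
      \<Rightarrow> ('oa, 'aa, 'oe, 'ae) func \<Rightarrow> ('ob, 'ab, 'oe, 'ae) func
      \<Rightarrow> (('oa, 'ob, 'ae) pp_ob, ('oa, 'aa, 'ob, 'ab, 'ae) pp_ar) cat" where
  "pseudo_pullback A B E F G =
    (let obs = {(a, b, t). a \<in> Ob A \<and> b \<in> Ob B \<and>
                  t \<in> hom E (fob F a) (fob G b) \<and> is_iso E t}
     in \<lparr>
      Ob = obs,
      Ar = {((a, b, t), (m, n), (a', b', t')).
             (a, b, t) \<in> obs \<and> (a', b', t') \<in> obs \<and> m \<in> hom A a a' \<and> n \<in> hom B b b' \<and>
             t' \<odot>\<^bsub>E\<^esub> far F m = far G n \<odot>\<^bsub>E\<^esub> t},
      src = (\<lambda>(x, u, y). x), tgt = (\<lambda>(x, u, y). y),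
      idn = (\<lambda>(a, b, t). ((a, b, t), (idn A a, idn B b), (a, b, t))),
      cmp = (\<lambda>(x', (m', n'), y') (x, (m, n), y). (x, (m' \<odot>\<^bsub>A\<^esub> m, n' \<odot>\<^bsub>B\<^esub> n), y'))\<rparr>)"


section \<open>Finite products and exponentials\<close>

record ('o, 'a) fin_prod =
  unt :: 'o
  prd :: "'o \<Rightarrow> 'o \<Rightarrow> 'o"
  pr1 :: "'o \<Rightarrow> 'o \<Rightarrow> 'a"
  pr2 :: "'o \<Rightarrow> 'o \<Rightarrow> 'a"

locale finite_products = category C for C :: "('o, 'a) cat" +
  fixes S :: "('o, 'a) fin_prod"
  assumes top_terminal: "is_terminal C (unt S)"
    and prd_in: "A \<in> Ob C \<Longrightarrow> B \<in> Ob C \<Longrightarrow> prd S A B \<in> Ob C"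
    and pr1_hom: "A \<in> Ob C \<Longrightarrow> B \<in> Ob C \<Longrightarrow> pr1 S A B \<in> hom C (prd S A B) A"
    and pr2_hom: "A \<in> Ob C \<Longrightarrow> B \<in> Ob C \<Longrightarrow> pr2 S A B \<in> hom C (prd S A B) B"
    and prd_universal: "u \<in> hom C Z A \<Longrightarrow> v \<in> hom C Z B \<Longrightarrow>
      \<exists>!h. h \<in> hom C Z (prd S A B) \<and> pr1 S A B \<odot>\<^bsub>C\<^esub> h = u \<and> pr2 S A B \<odot>\<^bsub>C\<^esub> h = v"

definition to_terminal :: "('o, 'a) cat \<Rightarrow> 'o \<Rightarrow> 'o \<Rightarrow> 'a" where
  "to_terminal C t A = (THE f. f \<in> hom C A t)"

definition pairing :: "('o, 'a) cat \<Rightarrow> ('o, 'a) fin_prod \<Rightarrow> 'a \<Rightarrow> 'a \<Rightarrow> 'a" where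
  "pairing C S u v =
    (THE h. h \<in> hom C (src C u) (prd S (tgt C u) (tgt C v)) \<and>
      pr1 S (tgt C u) (tgt C v) \<odot>\<^bsub>C\<^esub> h = u \<and> pr2 S (tgt C u) (tgt C v) \<odot>\<^bsub>C\<^esub> h = v)"

definition par :: "('o, 'a) cat \<Rightarrow> ('o, 'a) fin_prod \<Rightarrow> 'a \<Rightarrow> 'a \<Rightarrow> 'a" where
  "par C S u v = pairing C S (u \<odot>\<^bsub>C\<^esub> pr1 S (src C u) (src C v)) (v \<odot>\<^bsub>C\<^esub> pr2 S (src C u) (src C v))"

definition product_functor ::
    "('o, 'a) cat \<Rightarrow> ('o, 'a) fin_prod \<Rightarrow> ('o \<times> 'o, 'a \<times> 'a, 'o, 'a) func" where
  "product_functor C S = \<lparr>fob = (\<lambda>(A, B). prd S A B), far = (\<lambda>(u, v). par C S u v)\<rparr>"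

text \<open>\<open>E\<close> with evaluation \<open>e : E \<times> A \<rightarrow> B\<close> is an exponential \<open>A \<Rightarrow> B\<close>.\<close>

definition is_exponential ::
    "('o, 'a) cat \<Rightarrow> ('o, 'a) fin_prod \<Rightarrow> 'o \<Rightarrow> 'o \<Rightarrow> 'o \<Rightarrow> 'a \<Rightarrow> bool" where
  "is_exponential C S A B E e \<longleftrightarrow> E \<in> Ob C \<and> e \<in> hom C (prd S E A) B \<and>
    (\<forall>Z \<in> Ob C. \<forall>u \<in> hom C (prd S Z A) B.
      \<exists>!h. h \<in> hom C Z E \<and> e \<odot>\<^bsub>C\<^esub> par C S h (idn C A) = u)"

text \<open>The action of \<open>\<Rightarrow>\<close> on \<open>u : A' \<rightarrow> A\<close> and \<open>v : B \<rightarrow> B'\<close> is the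
  transpose \<open>(A \<Rightarrow> B) \<rightarrow> (A' \<Rightarrow> B')\<close> of \<open>v \<odot> ev \<odot> (id \<times> u)\<close>. It is
  meaningful for exponentiable \<open>A\<close> and \<open>A'\<close> only.\<close>

definition exponential_functor ::
    "('o, 'a) cat \<Rightarrow> ('o, 'a) fin_prod \<Rightarrow> ('o \<Rightarrow> 'o \<Rightarrow> 'o) \<Rightarrow> ('o \<Rightarrow> 'o \<Rightarrow> 'a)
      \<Rightarrow> ('o \<times> 'o, 'a \<times> 'a, 'o, 'a) func" where
  "exponential_functor C S ex ev = \<lparr>
    fob = (\<lambda>(A, B). ex A B),
    far = (\<lambda>(u, v).
      (THE h. h \<in> hom C (ex (tgt C u) (src C v)) (ex (src C u) (tgt C v)) \<and>
        ev (src C u) (tgt C v) \<odot>\<^bsub>C\<^esub> par C S h (idn C (src C u)) =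
        v \<odot>\<^bsub>C\<^esub> (ev (tgt C u) (src C v) \<odot>\<^bsub>C\<^esub> par C S (idn C (ex (tgt C u) (src C v))) u)))\<rparr>"


section \<open>Enrichment in a cartesian category\<close>

text \<open>A \<open>V\<close>-category, for the cartesian structure \<open>S\<close> of \<open>V\<close>, with objects those of \<open>A\<close>,
  hom-objects \<open>H(a,b)\<close>, identities \<open>un a : 1 \<rightarrow> H(a,a)\<close> and composition
  \<open>cm a b c : H(b,c) \<times> H(a,b) \<rightarrow> H(a,c)\<close>. The bijections \<open>ph : A(a,b) \<cong> V(1,H(a,b))\<close> identify
  its underlying category with \<open>A\<close>. Under this identification, the arrow part of the functor
  \<open>H\<close> is pre- and post-composition in the \<open>V\<close>-category (\<open>H_arrows\<close>).\<close>

locale cartesian_enrichment =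
  V: finite_products V S + A: category A + H: is_functor "op_cat A \<times>\<^sub>C A" V H
  for V :: "('v, 'w) cat" and S :: "('v, 'w) fin_prod" and A :: "('o, 'a) cat"
    and H :: "('o \<times> 'o, 'a \<times> 'a, 'v, 'w) func" +
  fixes un :: "'o \<Rightarrow> 'w" and cm :: "'o \<Rightarrow> 'o \<Rightarrow> 'o \<Rightarrow> 'w" and ph :: "'a \<Rightarrow> 'w"
  assumes un_hom: "a \<in> Ob A \<Longrightarrow> un a \<in> hom V (unt S) (fob H (a, a))"
    and cm_hom: "a \<in> Ob A \<Longrightarrow> b \<in> Ob A \<Longrightarrow> c \<in> Ob A \<Longrightarrow>
      cm a b c \<in> hom V (prd S (fob H (b, c)) (fob H (a, b))) (fob H (a, c))"
    and cm_assoc: "a \<in> Ob A \<Longrightarrow> b \<in> Ob A \<Longrightarrow> c \<in> Ob A \<Longrightarrow> d \<in> Ob A \<Longrightarrow>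
      Hab = fob H (a, b) \<Longrightarrow> Hbc = fob H (b, c) \<Longrightarrow> Hcd = fob H (c, d) \<Longrightarrow>
      assc = pairing V S (pr1 S Hcd Hbc \<odot>\<^bsub>V\<^esub> pr1 S (prd S Hcd Hbc) Hab)
        (pairing V S (pr2 S Hcd Hbc \<odot>\<^bsub>V\<^esub> pr1 S (prd S Hcd Hbc) Hab)
          (pr2 S (prd S Hcd Hbc) Hab)) \<Longrightarrow>
      cm a b d \<odot>\<^bsub>V\<^esub> par V S (cm b c d) (idn V Hab) =
      cm a c d \<odot>\<^bsub>V\<^esub> (par V S (idn V Hcd) (cm a b c) \<odot>\<^bsub>V\<^esub> assc)"
    and cm_un_left: "a \<in> Ob A \<Longrightarrow> b \<in> Ob A \<Longrightarrow> Hab = fob H (a, b) \<Longrightarrow>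
      cm a b b \<odot>\<^bsub>V\<^esub> pairing V S (un b \<odot>\<^bsub>V\<^esub> to_terminal V (unt S) Hab) (idn V Hab) = idn V Hab"
    and cm_un_right: "a \<in> Ob A \<Longrightarrow> b \<in> Ob A \<Longrightarrow> Hab = fob H (a, b) \<Longrightarrow>
      cm a a b \<odot>\<^bsub>V\<^esub> pairing V S (idn V Hab) (un a \<odot>\<^bsub>V\<^esub> to_terminal V (unt S) Hab) = idn V Hab"
    and ph_bij: "a \<in> Ob A \<Longrightarrow> b \<in> Ob A \<Longrightarrow>
      bij_betw ph (hom A a b) (hom V (unt S) (fob H (a, b)))"
    and ph_idn: "a \<in> Ob A \<Longrightarrow> ph (idn A a) = un a"
    and ph_cmp: "f \<in> hom A a b \<Longrightarrow> g \<in> hom A b c \<Longrightarrow>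
      ph (g \<odot>\<^bsub>A\<^esub> f) = cm a b c \<odot>\<^bsub>V\<^esub> pairing V S (ph g) (ph f)"
    and H_arrows: "u \<in> hom A a' a \<Longrightarrow> v \<in> hom A b b' \<Longrightarrow> Hab = fob H (a, b) \<Longrightarrow>
      far H (u, v) =
        cm a' a b' \<odot>\<^bsub>V\<^esub> pairing V S
          (cm a b b' \<odot>\<^bsub>V\<^esub> pairing V S (ph v \<odot>\<^bsub>V\<^esub> to_terminal V (unt S) Hab) (idn V Hab))
          (ph u \<odot>\<^bsub>V\<^esub> to_terminal V (unt S) Hab)"

definition enriches ::
    "('v, 'w) cat \<Rightarrow> ('o, 'a) cat \<Rightarrow> ('o \<times> 'o, 'a \<times> 'a, 'v, 'w) func \<Rightarrow> bool" where
  "enriches V A H \<longleftrightarrow> (\<exists>S un cm ph. cartesian_enrichment V S A H un cm ph)"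


section \<open>Indexed categories\<close>

text \<open>A pseudofunctor from the opposite of \<open>C\<close> to categories: \<open>sub f : fib Y \<rightarrow> fib X\<close> for
  \<open>f : X \<rightarrow> Y\<close>, with coherent isomorphisms \<open>sub_idn X P : P \<rightarrow> (idn X)\<^sup>*P\<close> and
  \<open>sub_cmp f g P : f\<^sup>*(g\<^sup>*P) \<rightarrow> (g \<odot> f)\<^sup>*P\<close>.\<close>

record ('co, 'ca, 'o, 'a) icat =
  fib :: "'co \<Rightarrow> ('o, 'a) cat"
  sub :: "'ca \<Rightarrow> ('o, 'a, 'o, 'a) func"
  sub_idn :: "'co \<Rightarrow> 'o \<Rightarrow> 'a"
  sub_cmp :: "'ca \<Rightarrow> 'ca \<Rightarrow> 'o \<Rightarrow> 'a"

locale indexed_category = C: category C for C :: "('co, 'ca) cat" +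
  fixes I :: "('co, 'ca, 'o, 'a) icat"
  assumes fib_category: "X \<in> Ob C \<Longrightarrow> category (fib I X)"
    and sub_functor: "f \<in> hom C X Y \<Longrightarrow> is_functor (fib I Y) (fib I X) (sub I f)"
    and sub_idn_iso: "X \<in> Ob C \<Longrightarrow>
      natural_iso (fib I X) (fib I X) id_func (sub I (idn C X)) (sub_idn I X)"
    and sub_cmp_iso: "f \<in> hom C X Y \<Longrightarrow> g \<in> hom C Y Z \<Longrightarrow>
      natural_iso (fib I Z) (fib I X) (sub I f \<bullet> sub I g) (sub I (g \<odot>\<^bsub>C\<^esub> f)) (sub_cmp I f g)"
    and sub_unit_left: "f \<in> hom C X Y \<Longrightarrow> P \<in> Ob (fib I Y) \<Longrightarrow>
      sub_cmp I (idn C X) f P \<odot>\<^bsub>fib I X\<^esub> sub_idn I X (fob (sub I f) P)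
      = idn (fib I X) (fob (sub I f) P)"
    and sub_unit_right: "f \<in> hom C X Y \<Longrightarrow> P \<in> Ob (fib I Y) \<Longrightarrow>
      sub_cmp I f (idn C Y) P \<odot>\<^bsub>fib I X\<^esub> far (sub I f) (sub_idn I Y P)
      = idn (fib I X) (fob (sub I f) P)"
    and sub_cmp_assoc: "f \<in> hom C X Y \<Longrightarrow> g \<in> hom C Y Z \<Longrightarrow> h \<in> hom C Z W \<Longrightarrow>
      P \<in> Ob (fib I W) \<Longrightarrow>
      sub_cmp I (g \<odot>\<^bsub>C\<^esub> f) h P \<odot>\<^bsub>fib I X\<^esub> sub_cmp I f g (fob (sub I h) P)
      = sub_cmp I f (h \<odot>\<^bsub>C\<^esub> g) P \<odot>\<^bsub>fib I X\<^esub> far (sub I f) (sub_cmp I g h P)"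

text \<open>\<open>comp_at X : fib I X \<rightarrow> fib J X\<close>, and \<open>comp_sub f M : i\<^sub>X(f\<^sup>*M) \<rightarrow> f\<^sup>*(i\<^sub>Y M)\<close>
  for \<open>f : X \<rightarrow> Y\<close>.\<close>

record ('co, 'ca, 'o, 'a, 'p, 'b) ifunc =
  comp_at :: "'co \<Rightarrow> ('o, 'a, 'p, 'b) func"
  comp_sub :: "'ca \<Rightarrow> 'o \<Rightarrow> 'b"

locale indexed_functor = I: indexed_category C I + J: indexed_category C J
  for C :: "('co, 'ca) cat" and I :: "('co, 'ca, 'o, 'a) icat" and J :: "('co, 'ca, 'p, 'b) icat" +
  fixes F :: "('co, 'ca, 'o, 'a, 'p, 'b) ifunc"
  assumes comp_at_functor: "X \<in> Ob C \<Longrightarrow> is_functor (fib I X) (fib J X) (comp_at F X)"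
    and comp_sub_iso: "f \<in> hom C X Y \<Longrightarrow>
      natural_iso (fib I Y) (fib J X)
        (comp_at F X \<bullet> sub I f) (sub J f \<bullet> comp_at F Y) (comp_sub F f)"
    and comp_sub_idn: "X \<in> Ob C \<Longrightarrow> M \<in> Ob (fib I X) \<Longrightarrow>
      comp_sub F (idn C X) M \<odot>\<^bsub>fib J X\<^esub> far (comp_at F X) (sub_idn I X M)
      = sub_idn J X (fob (comp_at F X) M)"
    and comp_sub_cmp: "f \<in> hom C X Y \<Longrightarrow> g \<in> hom C Y Z \<Longrightarrow> M \<in> Ob (fib I Z) \<Longrightarrow>
      comp_sub F (g \<odot>\<^bsub>C\<^esub> f) M \<odot>\<^bsub>fib J X\<^esub> far (comp_at F X) (sub_cmp I f g M)
      = sub_cmp J f g (fob (comp_at F Z) M) \<odot>\<^bsub>fib J X\<^esub>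
          (far (sub J f) (comp_sub F g M) \<odot>\<^bsub>fib J X\<^esub> comp_sub F f (fob (sub I g) M))"


section \<open>Weak temporal doctrines\<close>

text \<open>The structure includes a choice of everything that the axioms require to exist, except
  that an adjunction is recorded by its functors together with those of its unit and counit that
  enter the axioms. The exponentials \<open>expo X A P\<close> are significant only for \<open>A\<close> of the
  form \<open>i\<^sub>X M\<close> or \<open>i'\<^sub>X N\<close>.\<close>

record ('co, 'ca, 'mo, 'ma, 'po, 'pa, 'no, 'na) doctrine =
  base :: "('co, 'ca) cat"
  one :: "'co"
  iM :: "('co, 'ca, 'mo, 'ma) icat"
  iP :: "('co, 'ca, 'po, 'pa) icat"
  iM' :: "('co, 'ca, 'no, 'na) icat"
  inc :: "('co, 'ca, 'mo, 'ma, 'po, 'pa) ifunc"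
  inc' :: "('co, 'ca, 'no, 'na, 'po, 'pa) ifunc"
  fprod :: "'co \<Rightarrow> ('po, 'pa) fin_prod"
  expo :: "'co \<Rightarrow> 'po \<Rightarrow> 'po \<Rightarrow> 'po"
  expo_ev :: "'co \<Rightarrow> 'po \<Rightarrow> 'po \<Rightarrow> 'pa"
  Sig :: "'ca \<Rightarrow> ('po, 'pa, 'po, 'pa) func"
  Sig_unit :: "'ca \<Rightarrow> 'po \<Rightarrow> 'pa"
  Sig_counit :: "'ca \<Rightarrow> 'po \<Rightarrow> 'pa"
  Forall :: "'ca \<Rightarrow> ('mo, 'ma, 'mo, 'ma) func"
  Forall' :: "'ca \<Rightarrow> ('no, 'na, 'no, 'na) func"
  Dia :: "'co \<Rightarrow> ('po, 'pa, 'mo, 'ma) func"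
  Dia_unit :: "'co \<Rightarrow> 'po \<Rightarrow> 'pa"
  Dia' :: "'co \<Rightarrow> ('po, 'pa, 'no, 'na) func"
  Dia'_unit :: "'co \<Rightarrow> 'po \<Rightarrow> 'pa"
  Box :: "'co \<Rightarrow> ('po, 'pa, 'mo, 'ma) func"
  Box' :: "'co \<Rightarrow> ('po, 'pa, 'no, 'na) func"
  compr :: "'co \<Rightarrow> ('po, 'pa, 'ca, 'ca \<times> 'ca \<times> 'ca) func"

abbreviation Mc where "Mc D X \<equiv> fib (iM D) X"
abbreviation Pc where "Pc D X \<equiv> fib (iP D) X"
abbreviation Mc' where "Mc' D X \<equiv> fib (iM' D) X"
abbreviation subM where "subM D f \<equiv> sub (iM D) f"
abbreviation subP where "subP D f \<equiv> sub (iP D) f"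
abbreviation subM' where "subM' D f \<equiv> sub (iM' D) f"
abbreviation inM where "inM D X \<equiv> comp_at (inc D) X"
abbreviation inM' where "inM' D X \<equiv> comp_at (inc' D) X"

text \<open>The canonical functor \<open>c\<^sub>X\<close>. For \<open>f = g \<odot> h\<close> with \<open>h : T \<rightarrow> S\<close>, the arrow
  \<open>\<Sigma>\<^sub>f 1\<^sub>T \<rightarrow> \<Sigma>\<^sub>g 1\<^sub>S\<close> is the transpose of
  \<open>1\<^sub>T \<rightarrow> h\<^sup>*1\<^sub>S \<rightarrow> h\<^sup>*g\<^sup>*\<Sigma>\<^sub>g 1\<^sub>S \<cong> f\<^sup>*\<Sigma>\<^sub>g 1\<^sub>S\<close>, whose first component is the transpose of the
  unique arrow \<open>\<Sigma>\<^sub>h 1\<^sub>T \<rightarrow> 1\<^sub>S\<close>.\<close>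

definition canon :: "('co, 'ca, 'mo, 'ma, 'po, 'pa, 'no, 'na) doctrine \<Rightarrow> 'co
    \<Rightarrow> ('ca, 'ca \<times> 'ca \<times> 'ca, 'po, 'pa) func" where
  "canon D X = \<lparr>
    fob = (\<lambda>f. fob (Sig D f) (unt (fprod D (src (base D) f)))),
    far = (\<lambda>(f, h, g).
      let T = src (base D) f; S = src (base D) g;
          oneT = unt (fprod D T); oneS = unt (fprod D S);
          Q = fob (Sig D g) oneS;
          t = far (subP D h) (to_terminal (Pc D S) oneS (fob (Sig D h) oneT))
                \<odot>\<^bsub>Pc D T\<^esub> Sig_unit D h oneT;
          w = sub_cmp (iP D) h g Q \<odot>\<^bsub>Pc D T\<^esub> (far (subP D h) (Sig_unit D g oneS) \<odot>\<^bsub>Pc D T\<^esub> t)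
      in Sig_counit D f Q \<odot>\<^bsub>Pc D X\<^esub> far (Sig D f) w)\<rparr>"

definition Bc :: "('co, 'ca, 'mo, 'ma, 'po, 'pa, 'no, 'na) doctrine \<Rightarrow> 'co
    \<Rightarrow> (('mo, 'no, 'pa) pp_ob, ('mo, 'ma, 'no, 'na, 'pa) pp_ar) cat" where
  "Bc D X = pseudo_pullback (Mc D X) (Mc' D X) (Pc D X) (inM D X) (inM' D X)"

definition jM :: "('co, 'ca, 'mo, 'ma, 'po, 'pa, 'no, 'na) doctrine \<Rightarrow> 'co
    \<Rightarrow> (('mo, 'no, 'pa) pp_ob, ('mo, 'ma, 'no, 'na, 'pa) pp_ar, 'mo, 'ma) func" where
  "jM D X = \<lparr>fob = (\<lambda>(M, N, t). M), far = (\<lambda>(x, (m, n), y). m)\<rparr>"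

definition jM' :: "('co, 'ca, 'mo, 'ma, 'po, 'pa, 'no, 'na) doctrine \<Rightarrow> 'co
    \<Rightarrow> (('mo, 'no, 'pa) pp_ob, ('mo, 'ma, 'no, 'na, 'pa) pp_ar, 'no, 'na) func" where
  "jM' D X = \<lparr>fob = (\<lambda>(M, N, t). N), far = (\<lambda>(x, (m, n), y). n)\<rparr>"

text \<open>The canonical arrow \<open>\<Sigma>\<^sub>f(P \<times> f\<^sup>*Q) \<rightarrow> \<Sigma>\<^sub>f P \<times> Q\<close> for \<open>f : X \<rightarrow> Y\<close>.\<close>

definition frobenius :: "('co, 'ca, 'mo, 'ma, 'po, 'pa, 'no, 'na) doctrine
    \<Rightarrow> 'ca \<Rightarrow> 'po \<Rightarrow> 'po \<Rightarrow> 'pa" where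
  "frobenius D f P Q =
    (let X = src (base D) f; Y = tgt (base D) f; R = fob (subP D f) Q
     in pairing (Pc D Y) (fprod D Y)
          (far (Sig D f) (pr1 (fprod D X) P R))
          (Sig_counit D f Q \<odot>\<^bsub>Pc D Y\<^esub> far (Sig D f) (pr2 (fprod D X) P R)))"

text \<open>Since \<open>B X\<close> is a pullback up to isomorphism, \<open>j\<^sub>1\<close> and \<open>j'\<^sub>1\<close> are required to be
  isomorphisms in the corresponding sense, that is, equivalences. A bijection on the objects
  \<open>(M, N, t)\<close> would exclude non-trivial automorphisms of \<open>N\<close>, as they act on \<open>t\<close>.\<close>

locale weak_temporal_doctrine =
  incM: indexed_functor "base D" "iM D" "iP D" "inc D" +
  incM': indexed_functor "base D" "iM' D" "iP D" "inc' D"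
  for D :: "('co, 'ca, 'mo, 'ma, 'po, 'pa, 'no, 'na) doctrine" +
  assumes base_terminal: "is_terminal (base D) (one D)"
    and fibre_products: "X \<in> Ob (base D) \<Longrightarrow> finite_products (Pc D X) (fprod D X)"
    and exponentiable: "X \<in> Ob (base D) \<Longrightarrow> M \<in> Ob (Mc D X) \<Longrightarrow> P \<in> Ob (Pc D X) \<Longrightarrow>
      A = fob (inM D X) M \<Longrightarrow>
      is_exponential (Pc D X) (fprod D X) A P (expo D X A P) (expo_ev D X A P)"
    and exponentiable': "X \<in> Ob (base D) \<Longrightarrow> N \<in> Ob (Mc' D X) \<Longrightarrow> P \<in> Ob (Pc D X) \<Longrightarrow>
      A = fob (inM' D X) N \<Longrightarrow>
      is_exponential (Pc D X) (fprod D X) A P (expo D X A P) (expo_ev D X A P)"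
    and Sig_adjoint: "f \<in> hom (base D) X Y \<Longrightarrow>
      adjunction (Pc D X) (Pc D Y) (Sig D f) (subP D f) (Sig_unit D f) (Sig_counit D f)"
    and Forall_adjoint: "f \<in> hom (base D) X Y \<Longrightarrow>
      adjoint_pair (Mc D Y) (Mc D X) (subM D f) (Forall D f)"
    and Forall'_adjoint: "f \<in> hom (base D) X Y \<Longrightarrow>
      adjoint_pair (Mc' D Y) (Mc' D X) (subM' D f) (Forall' D f)"
    and Dia_adjoint: "X \<in> Ob (base D) \<Longrightarrow>
      \<exists>\<epsilon>. adjunction (Pc D X) (Mc D X) (Dia D X) (inM D X) (Dia_unit D X) \<epsilon>"
    and Dia'_adjoint: "X \<in> Ob (base D) \<Longrightarrow>
      \<exists>\<epsilon>. adjunction (Pc D X) (Mc' D X) (Dia' D X) (inM' D X) (Dia'_unit D X) \<epsilon>"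
    and Box_adjoint: "X \<in> Ob (base D) \<Longrightarrow>
      adjoint_pair (Mc D X) (Pc D X) (inM D X) (Box D X)"
    and Box'_adjoint: "X \<in> Ob (base D) \<Longrightarrow>
      adjoint_pair (Mc' D X) (Pc D X) (inM' D X) (Box' D X)"
    and comprehension: "X \<in> Ob (base D) \<Longrightarrow>
      adjoint_pair (slice (base D) X) (Pc D X) (canon D X) (compr D X)"
    and inM_ff: "X \<in> Ob (base D) \<Longrightarrow> fully_faithful (Mc D X) (Pc D X) (inM D X)"
    and inM'_ff: "X \<in> Ob (base D) \<Longrightarrow> fully_faithful (Mc' D X) (Pc D X) (inM' D X)"
    and frobenius_law: "f \<in> hom (base D) X Y \<Longrightarrow> P \<in> Ob (Pc D X) \<Longrightarrow> Q \<in> Ob (Pc D Y) \<Longrightarrow>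
      is_iso (Pc D Y) (frobenius D f P Q)"
    and mixed_frobenius:
      "X \<in> Ob (base D) \<Longrightarrow> P \<in> Ob (Pc D X) \<Longrightarrow> N \<in> Ob (Mc' D X) \<Longrightarrow>
      is_iso (Mc D X) (far (Dia D X)
        (par (Pc D X) (fprod D X) (Dia_unit D X P) (idn (Pc D X) (fob (inM' D X) N))))"
    and mixed_frobenius':
      "X \<in> Ob (base D) \<Longrightarrow> P \<in> Ob (Pc D X) \<Longrightarrow> M \<in> Ob (Mc D X) \<Longrightarrow>
      is_iso (Mc' D X) (far (Dia' D X)
        (par (Pc D X) (fprod D X) (Dia'_unit D X P) (idn (Pc D X) (fob (inM D X) M))))"
    and jM_one: "is_equivalence (Bc D (one D)) (Mc D (one D)) (jM D (one D))"
    and jM'_one: "is_equivalence (Bc D (one D)) (Mc' D (one D)) (jM' D (one D))"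
    and compr_ff: "X \<in> Ob (base D) \<Longrightarrow> fully_faithful (Pc D X) (slice (base D) X) (compr D X)"


section \<open>Derived functors\<close>

abbreviation B1 where "B1 D \<equiv> Bc D (one D)"

definition Exists :: "('co, 'ca, 'mo, 'ma, 'po, 'pa, 'no, 'na) doctrine \<Rightarrow> 'ca
    \<Rightarrow> ('mo, 'ma, 'mo, 'ma) func" where
  "Exists D f = Dia D (tgt (base D) f) \<bullet> Sig D f \<bullet> inM D (src (base D) f)"

definition Exists' :: "('co, 'ca, 'mo, 'ma, 'po, 'pa, 'no, 'na) doctrine \<Rightarrow> 'ca
    \<Rightarrow> ('no, 'na, 'no, 'na) func" where
  "Exists' D f = Dia' D (tgt (base D) f) \<bullet> Sig D f \<bullet> inM' D (src (base D) f)"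

definition const_b :: "('co, 'ca, 'mo, 'ma, 'po, 'pa, 'no, 'na) doctrine \<Rightarrow> 'co
    \<Rightarrow> (('mo, 'no, 'pa) pp_ob, ('mo, 'ma, 'no, 'na, 'pa) pp_ar, 'po, 'pa) func" where
  "const_b D X =
    subP D (to_terminal (base D) (one D) X) \<bullet> inM D (one D) \<bullet> jM D (one D)"

text \<open>The left and right adjoints of \<open>X\<^sup>*b\<^sub>1\<close>, where \<open>b\<^sub>1 = i\<^sub>1 j\<^sub>1\<close>. They are determined up
  to isomorphism; \<open>SOME\<close> fixes a choice.\<close>

definition coend where
  "coend D X = (SOME F. adjoint_pair (Pc D X) (B1 D) F (const_b D X))"

definition endf where
  "endf D X = (SOME G. adjoint_pair (B1 D) (Pc D X) (const_b D X) G)"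

definition meets where
  "meets D X = coend D X \<bullet> product_functor (Pc D X) (fprod D X)"

definition ten where
  "ten D X = meets D X \<bullet> (inM' D X \<times>\<^sub>f inM D X)"

definition nat_obj where
  "nat_obj D X = endf D X \<bullet> exponential_functor (Pc D X) (fprod D X) (expo D X) (expo_ev D X)
    \<bullet> (inM D X \<times>\<^sub>f inM D X)"

definition nat_obj' where
  "nat_obj' D X = endf D X \<bullet> exponential_functor (Pc D X) (fprod D X) (expo D X) (expo_ev D X)
    \<bullet> (inM' D X \<times>\<^sub>f inM' D X)"

end

theory Submission
  imports Defs
begin

text \<open>Write \<open>W\<^sub>X = X\<^sup>*b\<^sub>1\<close>, which has the left adjoint \<open>coend\<^sub>X\<close> and the right adjoint \<open>end\<^sub>X\<close>. Then
  \<open>nat\<^sub>X(L, M)\<close> represents \<open>Z \<mapsto> \<P>X(W\<^sub>X Z \<times> i L, i M)\<close>, and such arrows compose after duplicating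
  \<open>W\<^sub>X Z\<close>: this gives the enrichment. The other ingredients are \<open>W\<^sub>X \<cong> f\<^sup>*W\<^sub>Y\<close> and the fact that
  \<open>W\<^sub>X\<close> factors, up to isomorphism, both through \<open>i\<^sub>X\<close> and through \<open>i'\<^sub>X\<close>. The first, with the
  Frobenius law, yields the laws for \<open>meets\<close>. By the second, a map that is inverted by \<open>\<diamond>\<^sub>X\<close> or by
  \<open>\<diamond>'\<^sub>X\<close> is also inverted by \<open>coend\<^sub>X\<close>, so that the mixed Frobenius laws yield those for \<open>ten\<close>; it
  also makes the mixed laws applicable to \<open>W\<^sub>Y Z \<times> -\<close>, which gives the adjunction laws for \<open>\<exists>\<^sub>f\<close>.
  Those for \<open>\<forall>\<^sub>f\<close> use that \<open>W\<^sub>Y Z \<times> i M\<close> lies, up to isomorphism, in the image of \<open>i\<close>.\<close>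


section \<open>Categories, functors and natural isomorphisms\<close>

text \<open>\<open>coend\<close> and \<open>endf\<close> are arbitrary choices, known only through
  their adjunctions, so the laws are derived from hom-sets and uniqueness of adjoints, not from
  formulas for these functors. Two obstacles shape the proof. Exponentials are available only for
  exponents \<open>i L\<close> and \<open>i' N\<close>, so \<open>exponential_functor\<close> cannot
  be treated as a functor by itself; \<open>nat\<close> is handled through the arrows that it
  represents. And invertibility after applying a left adjoint must be recognised without an inverse
  at hand: \<open>F u\<close> is invertible exactly when every arrow from the source of
  \<open>u\<close> to some \<open>G B\<close> extends uniquely along \<open>u\<close>. This makes it
  possible to pass from the possibility functors to \<open>coend\<close>, as each value of the
  weight is isomorphic to a value of \<open>i\<close> and to one of \<open>i'\<close>. The two
  factorisations come from the pseudo-pullback: an object of B1 carries an isomorphism between its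
  two images, and substitution commutes with both inclusions up to isomorphism. A product of a
  weight with some \<open>i M\<close> stays in the image of \<open>i\<close>, up to isomorphism,
  because a full reflective subcategory is closed under products.\<close>

lemma in_hom_iff [simp]: "f \<in> hom C A B \<longleftrightarrow> f \<in> Ar C \<and> src C f = A \<and> tgt C f = B"
  by (simp add: hom_def)

context category
begin

lemma src_Ob [simp]: "f \<in> Ar C \<Longrightarrow> src C f \<in> Ob C"
  and tgt_Ob [simp]: "f \<in> Ar C \<Longrightarrow> tgt C f \<in> Ob C"
  by (fact src_in tgt_in)+

lemma idn_simps [simp]:
  assumes "A \<in> Ob C"
  shows "idn C A \<in> Ar C" "src C (idn C A) = A" "tgt C (idn C A) = A"
  using idn_hom[OF assms] by auto

text \<open>Restating the category laws with equations between \<open>src\<close> and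
  \<open>tgt\<close> removes the free object variables of \<open>hom\<close>, so that simp can
  discharge composability by itself.\<close>

lemma cmp_simps [simp]:
  assumes "f \<in> Ar C" "g \<in> Ar C" "tgt C f = src C g"
  shows "g \<odot> f \<in> Ar C" "src C (g \<odot> f) = src C f" "tgt C (g \<odot> f) = tgt C g"
  using cmp_hom[of f "src C f" "src C g" g "tgt C g"] assms by auto

lemma cmp_idn_simp [simp]: "f \<in> Ar C \<Longrightarrow> src C f = A \<Longrightarrow> f \<odot> idn C A = f"
  and idn_cmp_simp [simp]: "f \<in> Ar C \<Longrightarrow> tgt C f = A \<Longrightarrow> idn C A \<odot> f = f"
  using cmp_idn[of f] idn_cmp[of f] by auto

lemma cmp_assoc_simp [simp]:
  assumes "f \<in> Ar C" "g \<in> Ar C" "h \<in> Ar C" "tgt C f = src C g" "tgt C g = src C h"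
  shows "(h \<odot> g) \<odot> f = h \<odot> (g \<odot> f)"
  using cmp_assoc[of f "src C f" "src C g" g "src C h" h "tgt C h"] assms by auto

lemma isoI:
  assumes "f \<in> Ar C" "g \<in> Ar C" "src C g = tgt C f" "tgt C g = src C f"
    and "g \<odot> f = idn C (src C f)" "f \<odot> g = idn C (tgt C f)"
  shows "is_iso C f"
  using assms unfolding is_iso_def by auto

lemma isoE:
  assumes "is_iso C f"
  obtains g where "f \<in> Ar C" "g \<in> Ar C" "src C g = tgt C f" "tgt C g = src C f"
    "g \<odot> f = idn C (src C f)" "f \<odot> g = idn C (tgt C f)" "is_iso C g"
proof -
  obtain g where g: "f \<in> Ar C" "g \<in> Ar C" "src C g = tgt C f" "tgt C g = src C f"
    "g \<odot> f = idn C (src C f)" "f \<odot> g = idn C (tgt C f)"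
    using assms unfolding is_iso_def by auto
  then have "is_iso C g"
    by (intro isoI[where g = f]) auto
  with g show thesis by (rule that)
qed

lemma iso_Ar [simp]: "is_iso C f \<Longrightarrow> f \<in> Ar C"
  by (simp add: is_iso_def)

lemma iso_idn [simp]: "A \<in> Ob C \<Longrightarrow> is_iso C (idn C A)"
  by (rule isoI[where g = "idn C A"]) auto

text \<open>Composites are normalised to the right by \<open>cmp_assoc_simp\<close>, so that an
  inverse law no longer matches inside \<open>g \<odot> (f \<odot> h)\<close>. This form
  does.\<close>

lemma cancel_left:
  assumes "g \<odot> f = idn C A" "f \<in> Ar C" "g \<in> Ar C" "tgt C f = src C g" "src C f = A"
    and "h \<in> Ar C" "tgt C h = A"
  shows "g \<odot> (f \<odot> h) = h"
  using cmp_assoc_simp[of h f g] assms by (simp del: cmp_assoc_simp)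

lemma iso_cmp:
  assumes "is_iso C f" "is_iso C g" "tgt C f = src C g"
  shows "is_iso C (g \<odot> f)"
proof -
  obtain f' where f': "f' \<in> Ar C" "src C f' = tgt C f" "tgt C f' = src C f"
    "f' \<odot> f = idn C (src C f)" "f \<odot> f' = idn C (tgt C f)"
    using isoE[OF assms(1)] by metis
  obtain g' where g': "g' \<in> Ar C" "src C g' = tgt C g" "tgt C g' = src C g"
    "g' \<odot> g = idn C (src C g)" "g \<odot> g' = idn C (tgt C g)"
    using isoE[OF assms(2)] by metis
  note [simp] = cancel_left[OF g'(4)] cancel_left[OF f'(5)]
  show ?thesis
    using assms f' g' by (intro isoI[where g = "f' \<odot> g'"]) auto
qed

end

context is_functor
begin

lemma fob_Ob [simp]: "A \<in> Ob C \<Longrightarrow> fob F A \<in> Ob D"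
  by (fact fob_in)

lemma far_simps [simp]:
  assumes "f \<in> Ar C"
  shows "far F f \<in> Ar D" "src D (far F f) = fob F (src C f)" "tgt D (far F f) = fob F (tgt C f)"
  using far_hom[of f "src C f" "tgt C f"] assms by auto

lemma far_idn_simp [simp]: "A \<in> Ob C \<Longrightarrow> far F (idn C A) = idn D (fob F A)"
  by (fact far_idn)

lemma far_cmp_simp [simp]:
  "f \<in> Ar C \<Longrightarrow> g \<in> Ar C \<Longrightarrow> tgt C f = src C g \<Longrightarrow>
    far F (g \<odot>\<^bsub>C\<^esub> f) = far F g \<odot>\<^bsub>D\<^esub> far F f"
  using far_cmp[of f "src C f" "src C g" g "tgt C g"] by auto

lemma far_iso:
  assumes "is_iso C f"
  shows "is_iso D (far F f)"
proof -
  obtain g where g: "f \<in> Ar C" "g \<in> Ar C" "src C g = tgt C f" "tgt C g = src C f"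
    "g \<odot>\<^bsub>C\<^esub> f = idn C (src C f)" "f \<odot>\<^bsub>C\<^esub> g = idn C (tgt C f)"
    by (rule C.isoE[OF assms])
  show ?thesis
    using g far_cmp_simp[of f g] far_cmp_simp[of g f]
    by (intro D.isoI[where g = "far F g"]) (auto simp del: far_cmp_simp)
qed

end

lemma is_functorI:
  assumes "category C" "category D"
    and "\<And>A. A \<in> Ob C \<Longrightarrow> fob F A \<in> Ob D"
    and "\<And>f. f \<in> Ar C \<Longrightarrow>
      far F f \<in> Ar D \<and> src D (far F f) = fob F (src C f) \<and> tgt D (far F f) = fob F (tgt C f)"
    and "\<And>A. A \<in> Ob C \<Longrightarrow> far F (idn C A) = idn D (fob F A)"
    and "\<And>f g. f \<in> Ar C \<Longrightarrow> g \<in> Ar C \<Longrightarrow> tgt C f = src C g \<Longrightarrow>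
      far F (g \<odot>\<^bsub>C\<^esub> f) = far F g \<odot>\<^bsub>D\<^esub> far F f"
  shows "is_functor C D F"
  using assms by (auto simp: is_functor_def is_functor_axioms_def)

lemma fully_faithfulD:
  assumes "fully_faithful C D F" "A \<in> Ob C" "B \<in> Ob C"
  shows "bij_betw (far F) (hom C A B) (hom D (fob F A) (fob F B))"
  using assms by (simp add: fully_faithful_def)

lemma comp_func_simps [simp]:
  "fob (G \<bullet> F) A = fob G (fob F A)" "far (G \<bullet> F) f = far G (far F f)"
  by (simp_all add: comp_func_def)

lemma id_func_simps [simp]: "fob id_func A = A" "far id_func f = f"
  by (simp_all add: id_func_def)

lemma prod_func_simps [simp]:
  "fob (F \<times>\<^sub>f G) (A, B) = (fob F A, fob G B)" "far (F \<times>\<^sub>f G) (f, g) = (far F f, far G g)"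
  by (simp_all add: prod_func_def)

lemma func_eqI: "(\<And>A. fob F A = fob G A) \<Longrightarrow> (\<And>f. far F f = far G f) \<Longrightarrow> F = G"
  for F G :: "('o, 'a, 'p, 'b) func"
  by (cases F; cases G) auto

lemma comp_func_assoc: "(H \<bullet> G) \<bullet> F = H \<bullet> G \<bullet> F"
  by (intro func_eqI) simp_all

lemma id_comp_func [simp]: "id_func \<bullet> F = F" "F \<bullet> id_func = F"
  by (intro func_eqI; simp)+

lemma prod_comp_func: "(F \<times>\<^sub>f G) \<bullet> (F' \<times>\<^sub>f G') = (F \<bullet> F') \<times>\<^sub>f (G \<bullet> G')"
  by (intro func_eqI) (auto simp: prod_func_def)

lemma is_functor_id: "category C \<Longrightarrow> is_functor C C id_func"
  by (intro is_functorI) auto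

lemma is_functor_comp:
  assumes "is_functor C D F" "is_functor D E G"
  shows "is_functor C E (G \<bullet> F)"
proof -
  interpret F: is_functor C D F by fact
  interpret G: is_functor D E G by fact
  show ?thesis
    by (intro is_functorI) (auto intro: F.C.category_axioms G.D.category_axioms)
qed

lemma prod_cat_simps [simp]:
  "(A, B) \<in> Ob (C \<times>\<^sub>C D) \<longleftrightarrow> A \<in> Ob C \<and> B \<in> Ob D"
  "(f, g) \<in> Ar (C \<times>\<^sub>C D) \<longleftrightarrow> f \<in> Ar C \<and> g \<in> Ar D"
  "src (C \<times>\<^sub>C D) (f, g) = (src C f, src D g)"
  "tgt (C \<times>\<^sub>C D) (f, g) = (tgt C f, tgt D g)"
  "idn (C \<times>\<^sub>C D) (A, B) = (idn C A, idn D B)"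
  "(f', g') \<odot>\<^bsub>C \<times>\<^sub>C D\<^esub> (f, g) = (f' \<odot>\<^bsub>C\<^esub> f, g' \<odot>\<^bsub>D\<^esub> g)"
  by (simp_all add: prod_cat_def)

lemma op_cat_simps [simp]:
  "Ob (op_cat C) = Ob C" "Ar (op_cat C) = Ar C" "src (op_cat C) = tgt C" "tgt (op_cat C) = src C"
  "idn (op_cat C) = idn C" "g \<odot>\<^bsub>op_cat C\<^esub> f = f \<odot>\<^bsub>C\<^esub> g"
  by (simp_all add: op_cat_def)

lemma op_op_cat [simp]: "op_cat (op_cat C) = C"
  by (cases C) (simp add: op_cat_def)

lemma categoryI:
  assumes "\<And>f. f \<in> Ar C \<Longrightarrow> src C f \<in> Ob C \<and> tgt C f \<in> Ob C"
    and "\<And>A. A \<in> Ob C \<Longrightarrow> idn C A \<in> Ar C \<and> src C (idn C A) = A \<and> tgt C (idn C A) = A"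
    and "\<And>f g. f \<in> Ar C \<Longrightarrow> g \<in> Ar C \<Longrightarrow> tgt C f = src C g \<Longrightarrow>
      g \<odot>\<^bsub>C\<^esub> f \<in> Ar C \<and> src C (g \<odot>\<^bsub>C\<^esub> f) = src C f \<and> tgt C (g \<odot>\<^bsub>C\<^esub> f) = tgt C g"
    and "\<And>f. f \<in> Ar C \<Longrightarrow> f \<odot>\<^bsub>C\<^esub> idn C (src C f) = f \<and> idn C (tgt C f) \<odot>\<^bsub>C\<^esub> f = f"
    and "\<And>f g h. f \<in> Ar C \<Longrightarrow> g \<in> Ar C \<Longrightarrow> h \<in> Ar C \<Longrightarrow> tgt C f = src C g \<Longrightarrow> tgt C g = src C h
      \<Longrightarrow> (h \<odot>\<^bsub>C\<^esub> g) \<odot>\<^bsub>C\<^esub> f = h \<odot>\<^bsub>C\<^esub> (g \<odot>\<^bsub>C\<^esub> f)"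
  shows "category C"
  using assms by unfold_locales auto

lemma category_prod:
  assumes "category C" "category D"
  shows "category (C \<times>\<^sub>C D)"
proof -
  interpret C: category C by fact
  interpret D: category D by fact
  show ?thesis
    by (rule categoryI) (auto split: prod.splits)
qed

lemma category_op:
  assumes "category C"
  shows "category (op_cat C)"
proof -
  interpret C: category C by fact
  show ?thesis by (rule categoryI) auto
qed

lemma is_functor_prod:
  assumes "is_functor C D F" "is_functor C' D' F'"
  shows "is_functor (C \<times>\<^sub>C C') (D \<times>\<^sub>C D') (F \<times>\<^sub>f F')"
proof -
  interpret F: is_functor C D F by fact
  interpret F': is_functor C' D' F' by fact
  show ?thesis
    by (intro is_functorI category_prod)
      (auto intro: F.C.category_axioms F.D.category_axioms F'.C.category_axioms F'.D.category_axioms)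
qed

lemma is_functor_op:
  assumes "is_functor C D F"
  shows "is_functor (op_cat C) (op_cat D) F"
proof -
  interpret F: is_functor C D F by fact
  show ?thesis
    by (intro is_functorI category_op) (auto intro: F.C.category_axioms F.D.category_axioms)
qed

lemma is_iso_op [simp]: "is_iso (op_cat C) f \<longleftrightarrow> is_iso C f"
  unfolding is_iso_def by auto

lemma naturally_isomorphicI:
  assumes "is_functor C D F" "is_functor C D G"
    and "\<And>A. A \<in> Ob C \<Longrightarrow> is_iso D (\<tau> A) \<and> src D (\<tau> A) = fob F A \<and> tgt D (\<tau> A) = fob G A"
    and "\<And>f. f \<in> Ar C \<Longrightarrow> \<tau> (tgt C f) \<odot>\<^bsub>D\<^esub> far F f = far G f \<odot>\<^bsub>D\<^esub> \<tau> (src C f)"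
  shows "naturally_isomorphic C D F G"
proof -
  have "natural_iso C D F G \<tau>"
    using assms category.iso_Ar[OF is_functor.axioms(2)[OF assms(1)]]
    by (auto simp: natural_iso_def natural_iso_axioms_def natural_trans_def natural_trans_axioms_def)
  then show ?thesis unfolding naturally_isomorphic_def by blast
qed

lemma naturally_isomorphicE:
  assumes "naturally_isomorphic C D F G"
  obtains \<tau> where "is_functor C D F" "is_functor C D G"
    "\<And>A. A \<in> Ob C \<Longrightarrow> is_iso D (\<tau> A)" "\<And>A. A \<in> Ob C \<Longrightarrow> src D (\<tau> A) = fob F A"
    "\<And>A. A \<in> Ob C \<Longrightarrow> tgt D (\<tau> A) = fob G A"
    "\<And>f. f \<in> Ar C \<Longrightarrow> \<tau> (tgt C f) \<odot>\<^bsub>D\<^esub> far F f = far G f \<odot>\<^bsub>D\<^esub> \<tau> (src C f)"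
proof -
  obtain \<tau> where "natural_iso C D F G \<tau>"
    using assms unfolding naturally_isomorphic_def by blast
  then interpret natural_iso C D F G \<tau> .
  show thesis
  proof (rule that)
    show "is_functor C D F" "is_functor C D G"
      by (fact F.is_functor_axioms G.is_functor_axioms)+
  qed (use component component_iso naturality in auto)
qed

lemma naturally_isomorphic_refl:
  assumes "is_functor C D F"
  shows "naturally_isomorphic C D F F"
proof -
  interpret is_functor C D F by fact
  show ?thesis
    by (rule naturally_isomorphicI[OF assms assms, where \<tau> = "\<lambda>A. idn D (fob F A)"]) auto
qed

lemma naturally_isomorphic_sym:
  assumes "naturally_isomorphic C D F G"
  shows "naturally_isomorphic C D G F"
proof -
  obtain \<tau> where F: "is_functor C D F" and G: "is_functor C D G"
    and \<tau>: "\<And>A. A \<in> Ob C \<Longrightarrow> is_iso D (\<tau> A)" "\<And>A. A \<in> Ob C \<Longrightarrow> src D (\<tau> A) = fob F A"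
    "\<And>A. A \<in> Ob C \<Longrightarrow> tgt D (\<tau> A) = fob G A"
    "\<And>f. f \<in> Ar C \<Longrightarrow> \<tau> (tgt C f) \<odot>\<^bsub>D\<^esub> far F f = far G f \<odot>\<^bsub>D\<^esub> \<tau> (src C f)"
    by (rule naturally_isomorphicE[OF assms]) blast
  interpret F: is_functor C D F by fact
  interpret G: is_functor C D G by fact
  have "\<forall>A. \<exists>s. A \<in> Ob C \<longrightarrow> is_iso D s \<and> src D s = fob G A \<and> tgt D s = fob F A \<and>
      s \<odot>\<^bsub>D\<^esub> \<tau> A = idn D (fob F A) \<and> \<tau> A \<odot>\<^bsub>D\<^esub> s = idn D (fob G A)"
    using \<tau> by (metis F.D.isoE)
  then obtain s where s: "\<And>A. A \<in> Ob C \<Longrightarrow> is_iso D (s A) \<and> src D (s A) = fob G A \<and>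
      tgt D (s A) = fob F A \<and> s A \<odot>\<^bsub>D\<^esub> \<tau> A = idn D (fob F A) \<and> \<tau> A \<odot>\<^bsub>D\<^esub> s A = idn D (fob G A)"
    by metis
  show ?thesis
  proof (rule naturally_isomorphicI[OF G F, where \<tau> = s])
    show "s (tgt C f) \<odot>\<^bsub>D\<^esub> far G f = far F f \<odot>\<^bsub>D\<^esub> s (src C f)" if f: "f \<in> Ar C" for f
    proof -
      \<comment> \<open>Insert \<open>\<tau>\<close> followed by its inverse on the right, move
        \<open>\<tau>\<close> across \<open>f\<close> by naturality, and cancel on the left.\<close>
      have "s (tgt C f) \<odot>\<^bsub>D\<^esub> far G f =
          s (tgt C f) \<odot>\<^bsub>D\<^esub> ((far G f \<odot>\<^bsub>D\<^esub> \<tau> (src C f)) \<odot>\<^bsub>D\<^esub> s (src C f))"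
        using f s \<tau> by auto
      also have "\<dots> = s (tgt C f) \<odot>\<^bsub>D\<^esub> (\<tau> (tgt C f) \<odot>\<^bsub>D\<^esub> (far F f \<odot>\<^bsub>D\<^esub> s (src C f)))"
        using f s \<tau>(1,2,3) unfolding \<tau>(4)[OF f, symmetric] by simp
      also have "\<dots> = far F f \<odot>\<^bsub>D\<^esub> s (src C f)"
        using f s \<tau>(1,2,3) by (intro F.D.cancel_left[where A = "fob F (tgt C f)"]) auto
      finally show ?thesis .
    qed
  qed (use s in auto)
qed

lemma naturally_isomorphic_trans [trans]:
  assumes "naturally_isomorphic C D F G" "naturally_isomorphic C D G H"
  shows "naturally_isomorphic C D F H"
proof -
  obtain \<tau> where F: "is_functor C D F" and G: "is_functor C D G"
    and \<tau>: "\<And>A. A \<in> Ob C \<Longrightarrow> is_iso D (\<tau> A)" "\<And>A. A \<in> Ob C \<Longrightarrow> src D (\<tau> A) = fob F A"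
    "\<And>A. A \<in> Ob C \<Longrightarrow> tgt D (\<tau> A) = fob G A"
    "\<And>f. f \<in> Ar C \<Longrightarrow> \<tau> (tgt C f) \<odot>\<^bsub>D\<^esub> far F f = far G f \<odot>\<^bsub>D\<^esub> \<tau> (src C f)"
    by (rule naturally_isomorphicE[OF assms(1)]) blast
  obtain \<sigma> where H: "is_functor C D H"
    and \<sigma>: "\<And>A. A \<in> Ob C \<Longrightarrow> is_iso D (\<sigma> A)" "\<And>A. A \<in> Ob C \<Longrightarrow> src D (\<sigma> A) = fob G A"
    "\<And>A. A \<in> Ob C \<Longrightarrow> tgt D (\<sigma> A) = fob H A"
    "\<And>f. f \<in> Ar C \<Longrightarrow> \<sigma> (tgt C f) \<odot>\<^bsub>D\<^esub> far G f = far H f \<odot>\<^bsub>D\<^esub> \<sigma> (src C f)"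
    by (rule naturally_isomorphicE[OF assms(2)]) blast
  interpret F: is_functor C D F by fact
  interpret G: is_functor C D G by fact
  interpret H: is_functor C D H by fact
  note [simp] = \<tau>(1-3) \<sigma>(1-3)
  show ?thesis
  proof (rule naturally_isomorphicI[OF F H, where \<tau> = "\<lambda>A. \<sigma> A \<odot>\<^bsub>D\<^esub> \<tau> A"])
    show "(\<sigma> (tgt C f) \<odot>\<^bsub>D\<^esub> \<tau> (tgt C f)) \<odot>\<^bsub>D\<^esub> far F f
        = far H f \<odot>\<^bsub>D\<^esub> (\<sigma> (src C f) \<odot>\<^bsub>D\<^esub> \<tau> (src C f))" if f: "f \<in> Ar C" for f
    proof -
      have "(\<sigma> (tgt C f) \<odot>\<^bsub>D\<^esub> \<tau> (tgt C f)) \<odot>\<^bsub>D\<^esub> far F f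
          = (\<sigma> (tgt C f) \<odot>\<^bsub>D\<^esub> far G f) \<odot>\<^bsub>D\<^esub> \<tau> (src C f)"
        using f by (simp add: \<tau>(4))
      also have "\<dots> = far H f \<odot>\<^bsub>D\<^esub> (\<sigma> (src C f) \<odot>\<^bsub>D\<^esub> \<tau> (src C f))"
        using f by (subst \<sigma>(4)) simp_all
      finally show ?thesis .
    qed
  qed (auto intro!: F.D.iso_cmp)
qed

lemma naturally_isomorphic_whisker_left:
  assumes "naturally_isomorphic C D F G" "is_functor D E H"
  shows "naturally_isomorphic C E (H \<bullet> F) (H \<bullet> G)"
proof -
  obtain \<tau> where F: "is_functor C D F" and G: "is_functor C D G"
    and \<tau>: "\<And>A. A \<in> Ob C \<Longrightarrow> is_iso D (\<tau> A)" "\<And>A. A \<in> Ob C \<Longrightarrow> src D (\<tau> A) = fob F A"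
    "\<And>A. A \<in> Ob C \<Longrightarrow> tgt D (\<tau> A) = fob G A"
    "\<And>f. f \<in> Ar C \<Longrightarrow> \<tau> (tgt C f) \<odot>\<^bsub>D\<^esub> far F f = far G f \<odot>\<^bsub>D\<^esub> \<tau> (src C f)"
    by (rule naturally_isomorphicE[OF assms(1)]) blast
  interpret F: is_functor C D F by fact
  interpret G: is_functor C D G by fact
  interpret H: is_functor D E H by fact
  note [simp] = \<tau>(1-3)
  show ?thesis
  proof (rule naturally_isomorphicI[OF is_functor_comp[OF F assms(2)] is_functor_comp[OF G assms(2)],
        where \<tau> = "\<lambda>A. far H (\<tau> A)"])
    show "far H (\<tau> (tgt C f)) \<odot>\<^bsub>E\<^esub> far (H \<bullet> F) f = far (H \<bullet> G) f \<odot>\<^bsub>E\<^esub> far H (\<tau> (src C f))"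
      if f: "f \<in> Ar C" for f
      using f arg_cong[OF \<tau>(4)[OF f], of "far H"] by simp
  qed (auto intro!: H.far_iso)
qed

lemma naturally_isomorphic_whisker_right:
  assumes "naturally_isomorphic C D F G" "is_functor B C H"
  shows "naturally_isomorphic B D (F \<bullet> H) (G \<bullet> H)"
proof -
  obtain \<tau> where F: "is_functor C D F" and G: "is_functor C D G"
    and \<tau>: "\<And>A. A \<in> Ob C \<Longrightarrow> is_iso D (\<tau> A)" "\<And>A. A \<in> Ob C \<Longrightarrow> src D (\<tau> A) = fob F A"
    "\<And>A. A \<in> Ob C \<Longrightarrow> tgt D (\<tau> A) = fob G A"
    "\<And>f. f \<in> Ar C \<Longrightarrow> \<tau> (tgt C f) \<odot>\<^bsub>D\<^esub> far F f = far G f \<odot>\<^bsub>D\<^esub> \<tau> (src C f)"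
    by (rule naturally_isomorphicE[OF assms(1)]) blast
  interpret H: is_functor B C H by fact
  show ?thesis
  proof (rule naturally_isomorphicI[OF is_functor_comp[OF assms(2) F] is_functor_comp[OF assms(2) G],
        where \<tau> = "\<lambda>A. \<tau> (fob H A)"])
    show "\<tau> (fob H (tgt B f)) \<odot>\<^bsub>D\<^esub> far (F \<bullet> H) f = far (G \<bullet> H) f \<odot>\<^bsub>D\<^esub> \<tau> (fob H (src B f))"
      if f: "f \<in> Ar B" for f
      using f \<tau>(4)[of "far H f"] by simp
  qed (use \<tau> in auto)
qed

lemma naturally_isomorphic_prod:
  assumes "naturally_isomorphic C D F G" "naturally_isomorphic C' D' F' G'"
  shows "naturally_isomorphic (C \<times>\<^sub>C C') (D \<times>\<^sub>C D') (F \<times>\<^sub>f F') (G \<times>\<^sub>f G')"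
proof -
  obtain \<tau> where F: "is_functor C D F" and G: "is_functor C D G"
    and \<tau>: "\<And>A. A \<in> Ob C \<Longrightarrow> is_iso D (\<tau> A)" "\<And>A. A \<in> Ob C \<Longrightarrow> src D (\<tau> A) = fob F A"
    "\<And>A. A \<in> Ob C \<Longrightarrow> tgt D (\<tau> A) = fob G A"
    "\<And>f. f \<in> Ar C \<Longrightarrow> \<tau> (tgt C f) \<odot>\<^bsub>D\<^esub> far F f = far G f \<odot>\<^bsub>D\<^esub> \<tau> (src C f)"
    by (rule naturally_isomorphicE[OF assms(1)]) blast
  obtain \<tau>' where F': "is_functor C' D' F'" and G': "is_functor C' D' G'"
    and \<tau>': "\<And>A. A \<in> Ob C' \<Longrightarrow> is_iso D' (\<tau>' A)" "\<And>A. A \<in> Ob C' \<Longrightarrow> src D' (\<tau>' A) = fob F' A"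
    "\<And>A. A \<in> Ob C' \<Longrightarrow> tgt D' (\<tau>' A) = fob G' A"
    "\<And>f. f \<in> Ar C' \<Longrightarrow> \<tau>' (tgt C' f) \<odot>\<^bsub>D'\<^esub> far F' f = far G' f \<odot>\<^bsub>D'\<^esub> \<tau>' (src C' f)"
    by (rule naturally_isomorphicE[OF assms(2)]) blast
  have iso: "is_iso (D \<times>\<^sub>C D') (s, t)" if "is_iso D s" "is_iso D' t" for s t
  proof -
    obtain g h where "g \<in> hom D (tgt D s) (src D s)" "h \<in> hom D' (tgt D' t) (src D' t)"
      "g \<odot>\<^bsub>D\<^esub> s = idn D (src D s)" "s \<odot>\<^bsub>D\<^esub> g = idn D (tgt D s)"
      "h \<odot>\<^bsub>D'\<^esub> t = idn D' (src D' t)" "t \<odot>\<^bsub>D'\<^esub> h = idn D' (tgt D' t)"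
      using \<open>is_iso D s\<close> \<open>is_iso D' t\<close> unfolding is_iso_def by blast
    with that show ?thesis
      unfolding is_iso_def by (auto intro!: bexI[of _ "(g, h)"])
  qed
  show ?thesis
    by (rule naturally_isomorphicI[OF is_functor_prod[OF F F'] is_functor_prod[OF G G'],
        where \<tau> = "map_prod \<tau> \<tau>'"])
      (use \<tau> \<tau>' in \<open>auto intro!: iso\<close>)
qed

text \<open>A component in \<open>op_cat D\<close> points the other way in \<open>D\<close>, which
  exchanges \<open>F\<close> and \<open>G\<close>. This makes the representation lemma below, stated
  for arrows into an object, usable for arrows out of it.\<close>

lemma naturally_isomorphic_op:
  assumes "naturally_isomorphic (op_cat C) (op_cat D) F G"
  shows "naturally_isomorphic C D G F"
proof -
  obtain \<tau> where F: "is_functor (op_cat C) (op_cat D) F" and G: "is_functor (op_cat C) (op_cat D) G"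
    and \<tau>: "\<And>A. A \<in> Ob C \<Longrightarrow> is_iso D (\<tau> A)" "\<And>A. A \<in> Ob C \<Longrightarrow> tgt D (\<tau> A) = fob F A"
    "\<And>A. A \<in> Ob C \<Longrightarrow> src D (\<tau> A) = fob G A"
    "\<And>f. f \<in> Ar C \<Longrightarrow> far F f \<odot>\<^bsub>D\<^esub> \<tau> (src C f) = \<tau> (tgt C f) \<odot>\<^bsub>D\<^esub> far G f"
    by (rule naturally_isomorphicE[OF assms]) auto
  have "is_functor C D F" "is_functor C D G"
    using is_functor_op[OF F] is_functor_op[OF G] by auto
  then show ?thesis
    by (intro naturally_isomorphicI[where \<tau> = \<tau>]) (use \<tau> in auto)
qed


section \<open>Adjunctions\<close>

lemma bij_betw_inverseI:
  assumes "\<And>x. x \<in> X \<Longrightarrow> f x \<in> Y" "\<And>y. y \<in> Y \<Longrightarrow> g y \<in> X"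
    and "\<And>x. x \<in> X \<Longrightarrow> g (f x) = x" "\<And>y. y \<in> Y \<Longrightarrow> f (g y) = y"
  shows "bij_betw f X Y"
  using assms by (intro bij_betw_byWitness[where f' = g]) auto

text \<open>Both ways around the square are the same map, and composing with the bijections
  \<open>a\<close> and \<open>b\<close> does not affect bijectivity. This is the device for moving a
  bijection between hom-sets to identified hom-sets.\<close>

lemma bij_betw_square:
  assumes a: "bij_betw a X X'" and b: "bij_betw b Y Y'" and f: "f ` X \<subseteq> Y"
    and comm: "\<And>x. x \<in> X \<Longrightarrow> f' (a x) = b (f x)"
  shows "bij_betw f X Y \<longleftrightarrow> bij_betw f' X' Y'"
proof -
  have "bij_betw f X Y \<longleftrightarrow> bij_betw (b \<circ> f) X Y'"
    using bij_betw_comp_iff2[OF b f] .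
  also have "\<dots> \<longleftrightarrow> bij_betw (f' \<circ> a) X Y'"
    by (rule bij_betw_cong) (simp add: comm)
  also have "\<dots> \<longleftrightarrow> bij_betw f' X' Y'"
    using bij_betw_comp_iff[OF a, symmetric] .
  finally show ?thesis .
qed

text \<open>A form of the Yoneda lemma: \<open>F\<close> and \<open>G\<close> are isomorphic as soon as the arrows into
  \<open>F c\<close> and the arrows into \<open>G c\<close> can be identified with the same sets \<open>S Z c\<close>, so that
  composition acts on these sets in the same way.\<close>

lemma naturally_isomorphic_by_representation:
  assumes F: "is_functor C V F" and G: "is_functor C V G"
    and bij_F: "\<And>Z c. Z \<in> Ob V \<Longrightarrow> c \<in> Ob C \<Longrightarrow> bij_betw (\<Xi> Z c) (hom V Z (fob F c)) (S Z c)"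
    and bij_G: "\<And>Z c. Z \<in> Ob V \<Longrightarrow> c \<in> Ob C \<Longrightarrow> bij_betw (\<Psi> Z c) (hom V Z (fob G c)) (S Z c)"
    and pre_F: "\<And>z h c. z \<in> Ar V \<Longrightarrow> h \<in> Ar V \<Longrightarrow> tgt V z = src V h \<Longrightarrow> c \<in> Ob C \<Longrightarrow>
      tgt V h = fob F c \<Longrightarrow> \<Xi> (src V z) c (h \<odot>\<^bsub>V\<^esub> z) = p z c (\<Xi> (tgt V z) c h)"
    and pre_G: "\<And>z h c. z \<in> Ar V \<Longrightarrow> h \<in> Ar V \<Longrightarrow> tgt V z = src V h \<Longrightarrow> c \<in> Ob C \<Longrightarrow>
      tgt V h = fob G c \<Longrightarrow> \<Psi> (src V z) c (h \<odot>\<^bsub>V\<^esub> z) = p z c (\<Psi> (tgt V z) c h)"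
    and post_F: "\<And>u h. u \<in> Ar C \<Longrightarrow> h \<in> Ar V \<Longrightarrow> tgt V h = fob F (src C u) \<Longrightarrow>
      \<Xi> (src V h) (tgt C u) (far F u \<odot>\<^bsub>V\<^esub> h) = q (src V h) u (\<Xi> (src V h) (src C u) h)"
    and post_G: "\<And>u h. u \<in> Ar C \<Longrightarrow> h \<in> Ar V \<Longrightarrow> tgt V h = fob G (src C u) \<Longrightarrow>
      \<Psi> (src V h) (tgt C u) (far G u \<odot>\<^bsub>V\<^esub> h) = q (src V h) u (\<Psi> (src V h) (src C u) h)"
  shows "naturally_isomorphic C V F G"
proof -
  interpret F: is_functor C V F by fact
  interpret G: is_functor C V G by fact
  \<comment> \<open>As in the Yoneda lemma, the component at \<open>c\<close> is the arrow that
    corresponds to the universal element, the image of the identity of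
    \<open>fob F c\<close>.\<close>
  have "\<exists>t. t \<in> hom V (fob F c) (fob G c) \<and> \<Psi> (fob F c) c t = \<Xi> (fob F c) c (idn V (fob F c))"
    if c: "c \<in> Ob C" for c
    using bij_betwE[OF bij_F[of "fob F c" c]] bij_betw_imp_surj_on[OF bij_G[of "fob F c" c]] c
    by (metis F.fob_Ob F.D.idn_hom imageE)
  then obtain \<tau> where \<tau>: "\<And>c. c \<in> Ob C \<Longrightarrow> \<tau> c \<in> hom V (fob F c) (fob G c)"
    and \<Psi>_\<tau>: "\<And>c. c \<in> Ob C \<Longrightarrow> \<Psi> (fob F c) c (\<tau> c) = \<Xi> (fob F c) c (idn V (fob F c))"
    by metis
  have "\<exists>t. t \<in> hom V (fob G c) (fob F c) \<and> \<Xi> (fob G c) c t = \<Psi> (fob G c) c (idn V (fob G c))"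
    if c: "c \<in> Ob C" for c
    using bij_betwE[OF bij_G[of "fob G c" c]] bij_betw_imp_surj_on[OF bij_F[of "fob G c" c]] c
    by (metis G.fob_Ob F.D.idn_hom imageE)
  then obtain \<sigma> where \<sigma>: "\<And>c. c \<in> Ob C \<Longrightarrow> \<sigma> c \<in> hom V (fob G c) (fob F c)"
    and \<Xi>_\<sigma>: "\<And>c. c \<in> Ob C \<Longrightarrow> \<Xi> (fob G c) c (\<sigma> c) = \<Psi> (fob G c) c (idn V (fob G c))"
    by metis
  note [simp] = \<tau>[simplified] \<sigma>[simplified]
  \<comment> \<open>Compatibility with precomposition extends the defining equation of
    \<open>\<tau> c\<close> from the identity to every \<open>h\<close>.\<close>
  have \<Psi>_cmp: "\<Psi> (src V h) c (\<tau> c \<odot>\<^bsub>V\<^esub> h) = \<Xi> (src V h) c h"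
    if "h \<in> Ar V" "tgt V h = fob F c" "c \<in> Ob C" for h c
    using that pre_G[of h "\<tau> c" c] pre_F[of h "idn V (fob F c)" c] \<Psi>_\<tau>[of c] by simp
  have \<Xi>_cmp: "\<Xi> (src V h) c (\<sigma> c \<odot>\<^bsub>V\<^esub> h) = \<Psi> (src V h) c h"
    if "h \<in> Ar V" "tgt V h = fob G c" "c \<in> Ob C" for h c
    using that pre_F[of h "\<sigma> c" c] pre_G[of h "idn V (fob G c)" c] \<Xi>_\<sigma>[of c] by simp
  have inj_F: "h = k" if "h \<in> Ar V" "k \<in> Ar V" "src V h = src V k" "tgt V h = fob F c"
    "tgt V k = fob F c" "c \<in> Ob C" "\<Xi> (src V h) c h = \<Xi> (src V k) c k" for h k c
    using bij_F[of "src V h" c] that unfolding bij_betw_def inj_on_def by auto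
  have inj_G: "h = k" if "h \<in> Ar V" "k \<in> Ar V" "src V h = src V k" "tgt V h = fob G c"
    "tgt V k = fob G c" "c \<in> Ob C" "\<Psi> (src V h) c h = \<Psi> (src V k) c k" for h k c
    using bij_G[of "src V h" c] that unfolding bij_betw_def inj_on_def by auto
  show ?thesis
  proof (rule naturally_isomorphicI[OF F G, where \<tau> = \<tau>])
    fix c assume c: "c \<in> Ob C"
    have "\<tau> c \<odot>\<^bsub>V\<^esub> \<sigma> c = idn V (fob G c)"
      using c \<Psi>_cmp[of "\<sigma> c" c] \<Xi>_\<sigma>[of c] by (intro inj_G[where c = c]) auto
    moreover have "\<sigma> c \<odot>\<^bsub>V\<^esub> \<tau> c = idn V (fob F c)"
      using c \<Xi>_cmp[of "\<tau> c" c] \<Psi>_\<tau>[of c] by (intro inj_F[where c = c]) auto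
    ultimately show "is_iso V (\<tau> c) \<and> src V (\<tau> c) = fob F c \<and> tgt V (\<tau> c) = fob G c"
      using c by (auto intro!: F.D.isoI[where g = "\<sigma> c"])
  next
    fix u assume u: "u \<in> Ar C"
    have "\<Psi> (fob F (src C u)) (tgt C u) (far G u \<odot>\<^bsub>V\<^esub> \<tau> (src C u))
        = q (fob F (src C u)) u (\<Xi> (fob F (src C u)) (src C u) (idn V (fob F (src C u))))"
      using u post_G[of u "\<tau> (src C u)"] \<Psi>_\<tau>[of "src C u"] by simp
    also have "\<dots> = \<Xi> (fob F (src C u)) (tgt C u) (far F u)"
      using u post_F[of u "idn V (fob F (src C u))"] by simp
    also have "\<dots> = \<Psi> (fob F (src C u)) (tgt C u) (\<tau> (tgt C u) \<odot>\<^bsub>V\<^esub> far F u)"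
      using u \<Psi>_cmp[of "far F u" "tgt C u"] by simp
    finally show "\<tau> (tgt C u) \<odot>\<^bsub>V\<^esub> far F u = far G u \<odot>\<^bsub>V\<^esub> \<tau> (src C u)"
      using u by (intro inj_G[where c = "tgt C u"]) auto
  qed
qed

text \<open>The hom-set form of an adjunction is the convenient one for composing adjunctions and
  for replacing a functor by an isomorphic one. An arrow of \<open>D\<close> determines its target,
  but of its source only \<open>fob F A\<close> and not \<open>A\<close>; hence
  \<open>\<phi>\<close> has an argument \<open>A\<close> and none for \<open>B\<close>.\<close>

locale hom_adjunction = F: is_functor C D F + G: is_functor D C G
  for C :: "('o, 'a) cat" and D :: "('p, 'b) cat"
    and F :: "('o, 'a, 'p, 'b) func" and G :: "('p, 'b, 'o, 'a) func" +
  fixes \<phi> :: "'o \<Rightarrow> 'b \<Rightarrow> 'a"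
  assumes bij: "A \<in> Ob C \<Longrightarrow> B \<in> Ob D \<Longrightarrow>
      bij_betw (\<phi> A) (hom D (fob F A) B) (hom C A (fob G B))"
    and transpose_pre: "f \<in> Ar C \<Longrightarrow> u \<in> Ar D \<Longrightarrow> src D u = fob F (tgt C f) \<Longrightarrow>
      \<phi> (src C f) (u \<odot>\<^bsub>D\<^esub> far F f) = \<phi> (tgt C f) u \<odot>\<^bsub>C\<^esub> f"
    and transpose_post: "A \<in> Ob C \<Longrightarrow> u \<in> Ar D \<Longrightarrow> src D u = fob F A \<Longrightarrow> v \<in> Ar D \<Longrightarrow>
      src D v = tgt D u \<Longrightarrow> \<phi> A (v \<odot>\<^bsub>D\<^esub> u) = far G v \<odot>\<^bsub>C\<^esub> \<phi> A u"
begin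

lemma transpose_simps [simp]:
  assumes "A \<in> Ob C" "u \<in> Ar D" "src D u = fob F A"
  shows "\<phi> A u \<in> Ar C" "src C (\<phi> A u) = A" "tgt C (\<phi> A u) = fob G (tgt D u)"
  using bij_betwE[OF bij[of A "tgt D u"]] assms by auto

lemma transpose_inj:
  assumes "\<phi> A u = \<phi> A v" "A \<in> Ob C" "u \<in> Ar D" "v \<in> Ar D"
    "src D u = fob F A" "src D v = fob F A" "tgt D u = tgt D v"
  shows "u = v"
  using bij[of A "tgt D u"] assms unfolding bij_betw_def inj_on_def by auto

lemma transpose_surj:
  assumes "f \<in> Ar C" "src C f = A" "tgt C f = fob G B" "B \<in> Ob D"
  obtains u where "u \<in> Ar D" "src D u = fob F A" "tgt D u = B" "\<phi> A u = f"
proof -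
  have "f \<in> \<phi> A ` hom D (fob F A) B"
    using bij_betw_imp_surj_on[OF bij[of A B]] assms by auto
  then show thesis
    using that by auto
qed

text \<open>Unit and counit are obtained by transposing identities. Equations between arrows of
  \<open>D\<close> are checked after transposing, since \<open>\<phi> A\<close> is injective on
  hom-sets.\<close>

lemma adjoint_pair: "adjoint_pair C D F G"
proof -
  have "\<exists>e. e \<in> Ar D \<and> src D e = fob F (fob G B) \<and> tgt D e = B \<and> \<phi> (fob G B) e = idn C (fob G B)"
    if B: "B \<in> Ob D" for B
    by (rule transpose_surj[of "idn C (fob G B)" "fob G B" B]) (use B in auto)
  then obtain e where e [simp]:
    "\<And>B. B \<in> Ob D \<Longrightarrow> e B \<in> Ar D" "\<And>B. B \<in> Ob D \<Longrightarrow> src D (e B) = fob F (fob G B)"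
    "\<And>B. B \<in> Ob D \<Longrightarrow> tgt D (e B) = B" "\<And>B. B \<in> Ob D \<Longrightarrow> \<phi> (fob G B) (e B) = idn C (fob G B)"
    by metis
  define \<eta> where "\<eta> A = \<phi> A (idn D (fob F A))" for A
  have \<eta> [simp]: "\<eta> A \<in> Ar C" "src C (\<eta> A) = A" "tgt C (\<eta> A) = fob G (fob F A)"
    if "A \<in> Ob C" for A
    using that by (auto simp: \<eta>_def)
  have "adjunction C D F G \<eta> e"
  proof (intro_locales; (unfold_locales)?)
    show "\<eta> A \<in> hom C (fob id_func A) (fob (G \<bullet> F) A)" if "A \<in> Ob C" for A
      using that by simp
    show "e B \<in> hom D (fob (F \<bullet> G) B) (fob id_func B)" if "B \<in> Ob D" for B
      using that by simp
    show "e (fob F A) \<odot>\<^bsub>D\<^esub> far F (\<eta> A) = idn D (fob F A)" if "A \<in> Ob C" for A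
      using that transpose_pre[of "\<eta> A" "e (fob F A)"]
      by (intro transpose_inj[where A = A]) (auto simp: \<eta>_def[of A, symmetric])
    show "far G (e B) \<odot>\<^bsub>C\<^esub> \<eta> (fob G B) = idn C (fob G B)" if "B \<in> Ob D" for B
      using that transpose_post[of "fob G B" "idn D (fob F (fob G B))" "e B"]
      by (simp add: \<eta>_def)
    show "\<eta> B \<odot>\<^bsub>C\<^esub> far id_func f = far (G \<bullet> F) f \<odot>\<^bsub>C\<^esub> \<eta> A" if "f \<in> hom C A B" for f A B
      using that transpose_pre[of f "idn D (fob F (tgt C f))"]
        transpose_post[of "src C f" "idn D (fob F (src C f))" "far F f"]
      by (auto simp: \<eta>_def)
    show "e B' \<odot>\<^bsub>D\<^esub> far (F \<bullet> G) v = far id_func v \<odot>\<^bsub>D\<^esub> e B" if "v \<in> hom D B B'" for v B B'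
      using that transpose_pre[of "far G v" "e B'"] transpose_post[of "fob G B" "e B" v]
      by (intro transpose_inj[where A = "fob G B"]) auto
  qed (use is_functor_id[OF F.C.category_axioms] is_functor_id[OF F.D.category_axioms]
      is_functor_comp[OF F.is_functor_axioms G.is_functor_axioms]
      is_functor_comp[OF G.is_functor_axioms F.is_functor_axioms] in \<open>auto simp: is_functor_def\<close>)
  then show ?thesis unfolding adjoint_pair_def by blast
qed

end

context adjunction
begin

lemma unit_simps [simp]:
  assumes "A \<in> Ob C"
  shows "\<eta> A \<in> Ar C" "src C (\<eta> A) = A" "tgt C (\<eta> A) = fob G (fob F A)"
  using unit.component[OF assms] by auto

lemma counit_simps [simp]:
  assumes "B \<in> Ob D"
  shows "\<epsilon> B \<in> Ar D" "src D (\<epsilon> B) = fob F (fob G B)" "tgt D (\<epsilon> B) = B"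
  using counit.component[OF assms] by auto

lemma unit_natural: "f \<in> Ar C \<Longrightarrow> \<eta> (tgt C f) \<odot>\<^bsub>C\<^esub> f = far G (far F f) \<odot>\<^bsub>C\<^esub> \<eta> (src C f)"
  using unit.naturality[of f "src C f" "tgt C f"] by simp

lemma counit_natural: "f \<in> Ar D \<Longrightarrow> \<epsilon> (tgt D f) \<odot>\<^bsub>D\<^esub> far F (far G f) = f \<odot>\<^bsub>D\<^esub> \<epsilon> (src D f)"
  using counit.naturality[of f "src D f" "tgt D f"] by simp

lemma counit_transpose:
  assumes "f \<in> Ar C" "tgt C f = fob G B" "B \<in> Ob D"
  shows "far G (\<epsilon> B \<odot>\<^bsub>D\<^esub> far F f) \<odot>\<^bsub>C\<^esub> \<eta> (src C f) = f"
proof -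
  have "far G (\<epsilon> B \<odot>\<^bsub>D\<^esub> far F f) \<odot>\<^bsub>C\<^esub> \<eta> (src C f)
      = far G (\<epsilon> B) \<odot>\<^bsub>C\<^esub> (far G (far F f) \<odot>\<^bsub>C\<^esub> \<eta> (src C f))"
    using assms by simp
  also have "\<dots> = (far G (\<epsilon> B) \<odot>\<^bsub>C\<^esub> \<eta> (fob G B)) \<odot>\<^bsub>C\<^esub> f"
    using assms unit_natural[of f] by simp
  finally show ?thesis
    using assms triangle_right by simp
qed

lemma unit_transpose:
  assumes "u \<in> Ar D" "src D u = fob F A" "A \<in> Ob C"
  shows "\<epsilon> (tgt D u) \<odot>\<^bsub>D\<^esub> far F (far G u \<odot>\<^bsub>C\<^esub> \<eta> A) = u"
proof -
  have "\<epsilon> (tgt D u) \<odot>\<^bsub>D\<^esub> far F (far G u \<odot>\<^bsub>C\<^esub> \<eta> A) = (\<epsilon> (tgt D u) \<odot>\<^bsub>D\<^esub> far F (far G u)) \<odot>\<^bsub>D\<^esub> far F (\<eta> A)"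
    using assms by simp
  also have "\<dots> = u \<odot>\<^bsub>D\<^esub> (\<epsilon> (fob F A) \<odot>\<^bsub>D\<^esub> far F (\<eta> A))"
    using assms counit_natural[of u] by simp
  finally show ?thesis
    using assms triangle_left by simp
qed

lemma unit_bij:
  assumes "A \<in> Ob C" "B \<in> Ob D"
  shows "bij_betw (\<lambda>u. far G u \<odot>\<^bsub>C\<^esub> \<eta> A) (hom D (fob F A) B) (hom C A (fob G B))"
  by (rule bij_betw_inverseI[where g = "\<lambda>f. \<epsilon> B \<odot>\<^bsub>D\<^esub> far F f"])
    (use assms counit_transpose unit_transpose in auto)

lemma counit_bij:
  assumes "A \<in> Ob C" "B \<in> Ob D"
  shows "bij_betw (\<lambda>f. \<epsilon> B \<odot>\<^bsub>D\<^esub> far F f) (hom C A (fob G B)) (hom D (fob F A) B)"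
  by (rule bij_betw_inverseI[where g = "\<lambda>u. far G u \<odot>\<^bsub>C\<^esub> \<eta> A"])
    (use assms counit_transpose unit_transpose in auto)

lemma hom_adjunction: "hom_adjunction C D F G (\<lambda>A u. far G u \<odot>\<^bsub>C\<^esub> \<eta> A)"
  by unfold_locales (auto simp: unit_natural unit_bij)

lemma adjoint_pair: "adjoint_pair C D F G"
  using adjunction_axioms unfolding adjoint_pair_def by blast

end

lemma adjoint_pairE:
  assumes "adjoint_pair C D F G"
  obtains \<phi> where "hom_adjunction C D F G \<phi>"
  using assms adjunction.hom_adjunction unfolding adjoint_pair_def by metis

lemma adjoint_pair_functors:
  assumes "adjoint_pair C D F G"
  shows "is_functor C D F" "is_functor D C G"
  using adjoint_pairE[OF assms] unfolding hom_adjunction_def by metis+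

lemma hom_adjunctionI:
  assumes "is_functor C D F" "is_functor D C G"
    and "\<And>A B. A \<in> Ob C \<Longrightarrow> B \<in> Ob D \<Longrightarrow>
      bij_betw (\<phi> A) (hom D (fob F A) B) (hom C A (fob G B))"
    and "\<And>f u. f \<in> Ar C \<Longrightarrow> u \<in> Ar D \<Longrightarrow> src D u = fob F (tgt C f) \<Longrightarrow>
      \<phi> (src C f) (u \<odot>\<^bsub>D\<^esub> far F f) = \<phi> (tgt C f) u \<odot>\<^bsub>C\<^esub> f"
    and "\<And>A u v. A \<in> Ob C \<Longrightarrow> u \<in> Ar D \<Longrightarrow> src D u = fob F A \<Longrightarrow> v \<in> Ar D \<Longrightarrow>
      src D v = tgt D u \<Longrightarrow> \<phi> A (v \<odot>\<^bsub>D\<^esub> u) = far G v \<odot>\<^bsub>C\<^esub> \<phi> A u"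
  shows "hom_adjunction C D F G \<phi>"
  using assms by (simp add: hom_adjunction_def hom_adjunction_axioms_def)

lemma adjoint_pair_comp:
  assumes "adjoint_pair C D F G" "adjoint_pair D E F' G'"
  shows "adjoint_pair C E (F' \<bullet> F) (G \<bullet> G')"
proof -
  obtain \<phi> where "hom_adjunction C D F G \<phi>" by (rule adjoint_pairE[OF assms(1)])
  then interpret A: hom_adjunction C D F G \<phi> .
  obtain \<psi> where "hom_adjunction D E F' G' \<psi>" by (rule adjoint_pairE[OF assms(2)])
  then interpret B: hom_adjunction D E F' G' \<psi> .
  have "hom_adjunction C E (F' \<bullet> F) (G \<bullet> G') (\<lambda>A u. \<phi> A (\<psi> (fob F A) u))"
  proof (rule hom_adjunctionI)
    show "bij_betw (\<lambda>u. \<phi> A (\<psi> (fob F A) u)) (hom E (fob (F' \<bullet> F) A) B) (hom C A (fob (G \<bullet> G') B))"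
      if "A \<in> Ob C" "B \<in> Ob E" for A B
      using bij_betw_trans[OF B.bij[of "fob F A" B] A.bij[of A "fob G' B"]] that
      by (simp add: comp_def)
    show "\<phi> (src C f) (\<psi> (fob F (src C f)) (u \<odot>\<^bsub>E\<^esub> far (F' \<bullet> F) f))
        = \<phi> (tgt C f) (\<psi> (fob F (tgt C f)) u) \<odot>\<^bsub>C\<^esub> f"
      if "f \<in> Ar C" "u \<in> Ar E" "src E u = fob (F' \<bullet> F) (tgt C f)" for f u
      using that B.transpose_pre[of "far F f" u] by (simp add: A.transpose_pre del: B.transpose_post)
  qed (auto intro!: is_functor_comp A.F.is_functor_axioms A.G.is_functor_axioms
        B.F.is_functor_axioms B.G.is_functor_axioms simp: A.transpose_post B.transpose_post)
  then show ?thesis by (rule hom_adjunction.adjoint_pair)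
qed

lemma (in category) bij_betw_pre_iso:
  assumes "is_iso C s" "w \<in> Ob C"
  shows "bij_betw (\<lambda>h. h \<odot> s) (hom C (tgt C s) w) (hom C (src C s) w)"
proof -
  obtain t where t: "t \<in> Ar C" "src C t = tgt C s" "tgt C t = src C s"
    "t \<odot> s = idn C (src C s)" "s \<odot> t = idn C (tgt C s)"
    by (rule isoE[OF assms(1)])
  then show ?thesis
    using assms by (intro bij_betw_inverseI[where g = "\<lambda>h. h \<odot> t"]) auto
qed

lemma (in category) bij_betw_post_iso:
  assumes "is_iso C s" "Z \<in> Ob C"
  shows "bij_betw (\<lambda>h. s \<odot> h) (hom C Z (src C s)) (hom C Z (tgt C s))"
proof -
  obtain t where t: "t \<in> Ar C" "src C t = tgt C s" "tgt C t = src C s"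
    "t \<odot> s = idn C (src C s)" "s \<odot> t = idn C (tgt C s)"
    by (rule isoE[OF assms(1)])
  then show ?thesis
    using assms cancel_left[OF t(4)] cancel_left[OF t(5)]
    by (intro bij_betw_inverseI[where g = "\<lambda>h. t \<odot> h"]) auto
qed

text \<open>Needed for ends: a right adjoint is first found for an isomorphic form of the weight
  \<open>const_b\<close> that factors through \<open>inM\<close>, and is then carried over to
  \<open>const_b\<close>.\<close>

lemma adjoint_pair_left_iso:
  assumes "naturally_isomorphic C D F F'" "adjoint_pair C D F G"
  shows "adjoint_pair C D F' G"
proof -
  obtain \<phi> where "hom_adjunction C D F G \<phi>" by (rule adjoint_pairE[OF assms(2)])
  then interpret A: hom_adjunction C D F G \<phi> .
  obtain \<tau> where F': "is_functor C D F'"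
    and \<tau>: "\<And>A. A \<in> Ob C \<Longrightarrow> is_iso D (\<tau> A)" "\<And>A. A \<in> Ob C \<Longrightarrow> src D (\<tau> A) = fob F A"
    "\<And>A. A \<in> Ob C \<Longrightarrow> tgt D (\<tau> A) = fob F' A"
    "\<And>f. f \<in> Ar C \<Longrightarrow> \<tau> (tgt C f) \<odot>\<^bsub>D\<^esub> far F f = far F' f \<odot>\<^bsub>D\<^esub> \<tau> (src C f)"
    by (rule naturally_isomorphicE[OF assms(1)]) blast
  interpret F': is_functor C D F' by fact
  note [simp] = \<tau>(1-3)
  have "hom_adjunction C D F' G (\<lambda>A u. \<phi> A (u \<odot>\<^bsub>D\<^esub> \<tau> A))"
  proof (rule hom_adjunctionI[OF F' A.G.is_functor_axioms])
    show "bij_betw (\<lambda>u. \<phi> A (u \<odot>\<^bsub>D\<^esub> \<tau> A)) (hom D (fob F' A) B) (hom C A (fob G B))"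
      if "A \<in> Ob C" "B \<in> Ob D" for A B
      using bij_betw_trans[OF A.F.D.bij_betw_pre_iso[of "\<tau> A" B], of "\<phi> A"]
        A.bij[of A B] that by (simp add: comp_def)
    show "\<phi> (src C f) ((u \<odot>\<^bsub>D\<^esub> far F' f) \<odot>\<^bsub>D\<^esub> \<tau> (src C f)) = \<phi> (tgt C f) (u \<odot>\<^bsub>D\<^esub> \<tau> (tgt C f)) \<odot>\<^bsub>C\<^esub> f"
      if "f \<in> Ar C" "u \<in> Ar D" "src D u = fob F' (tgt C f)" for f u
      using that A.transpose_pre[of f "u \<odot>\<^bsub>D\<^esub> \<tau> (tgt C f)"] by (simp add: \<tau>(4))
    show "\<phi> A ((v \<odot>\<^bsub>D\<^esub> u) \<odot>\<^bsub>D\<^esub> \<tau> A) = far G v \<odot>\<^bsub>C\<^esub> \<phi> A (u \<odot>\<^bsub>D\<^esub> \<tau> A)"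
      if "A \<in> Ob C" "u \<in> Ar D" "src D u = fob F' A" "v \<in> Ar D" "src D v = tgt D u" for A u v
      using that A.transpose_post[of A "u \<odot>\<^bsub>D\<^esub> \<tau> A" v] by simp
  qed
  then show ?thesis by (rule hom_adjunction.adjoint_pair)
qed

text \<open>Arrows to \<open>Z\<close> out of \<open>F c\<close> and out of \<open>F' c\<close> both
  correspond to arrows \<open>c \<rightarrow> G' Z\<close>. The representation lemma concerns arrows
  into an object, so it is applied in the opposite categories; this explains the reversed order of
  \<open>F'\<close> and \<open>F\<close> there.\<close>

lemma left_adjoint_unique:
  assumes "adjoint_pair C D F G" "adjoint_pair C D F' G'" "naturally_isomorphic D C G G'"
  shows "naturally_isomorphic C D F F'"
proof -
  obtain \<phi> where "hom_adjunction C D F G \<phi>" by (rule adjoint_pairE[OF assms(1)])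
  then interpret A: hom_adjunction C D F G \<phi> .
  obtain \<psi> where "hom_adjunction C D F' G' \<psi>" by (rule adjoint_pairE[OF assms(2)])
  then interpret B: hom_adjunction C D F' G' \<psi> .
  obtain \<tau> where
    \<tau>: "\<And>A. A \<in> Ob D \<Longrightarrow> is_iso C (\<tau> A)" "\<And>A. A \<in> Ob D \<Longrightarrow> src C (\<tau> A) = fob G A"
    "\<And>A. A \<in> Ob D \<Longrightarrow> tgt C (\<tau> A) = fob G' A"
    "\<And>f. f \<in> Ar D \<Longrightarrow> \<tau> (tgt D f) \<odot>\<^bsub>C\<^esub> far G f = far G' f \<odot>\<^bsub>C\<^esub> \<tau> (src D f)"
    by (rule naturally_isomorphicE[OF assms(3)]) blast
  note [simp] = \<tau>(1-3)
  have swap: "hom (op_cat D) Z W = hom D W Z" for Z W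
    by auto
  have "naturally_isomorphic (op_cat C) (op_cat D) F' F"
  proof (rule naturally_isomorphic_by_representation[where \<Xi> = "\<lambda>Z c h. \<psi> c h"
        and \<Psi> = "\<lambda>Z c h. \<tau> Z \<odot>\<^bsub>C\<^esub> \<phi> c h" and S = "\<lambda>Z c. hom C c (fob G' Z)"
        and p = "\<lambda>z c s. far G' z \<odot>\<^bsub>C\<^esub> s" and q = "\<lambda>Z u s. s \<odot>\<^bsub>C\<^esub> u"])
    show "bij_betw (\<psi> c) (hom (op_cat D) Z (fob F' c)) (hom C c (fob G' Z))"
      if "Z \<in> Ob (op_cat D)" "c \<in> Ob (op_cat C)" for Z c
      using that B.bij unfolding swap by simp
    show "bij_betw (\<lambda>h. \<tau> Z \<odot>\<^bsub>C\<^esub> \<phi> c h) (hom (op_cat D) Z (fob F c)) (hom C c (fob G' Z))"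
      if "Z \<in> Ob (op_cat D)" "c \<in> Ob (op_cat C)" for Z c
      using that bij_betw_trans[OF A.bij[of c Z], of "\<lambda>h. \<tau> Z \<odot>\<^bsub>C\<^esub> h"]
        A.F.C.bij_betw_post_iso[of "\<tau> Z" c] unfolding swap by (simp add: comp_def)
    show "\<tau> (src (op_cat D) z) \<odot>\<^bsub>C\<^esub> \<phi> c (h \<odot>\<^bsub>op_cat D\<^esub> z) = far G' z \<odot>\<^bsub>C\<^esub> (\<tau> (tgt (op_cat D) z) \<odot>\<^bsub>C\<^esub> \<phi> c h)"
      if "z \<in> Ar (op_cat D)" "h \<in> Ar (op_cat D)" "tgt (op_cat D) z = src (op_cat D) h"
        "c \<in> Ob (op_cat C)" "tgt (op_cat D) h = fob F c" for z h c
    proof -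
      have "\<tau> (tgt D z) \<odot>\<^bsub>C\<^esub> \<phi> c (z \<odot>\<^bsub>D\<^esub> h) = (\<tau> (tgt D z) \<odot>\<^bsub>C\<^esub> far G z) \<odot>\<^bsub>C\<^esub> \<phi> c h"
        using that by (simp add: A.transpose_post)
      then show ?thesis using that by (simp add: \<tau>(4))
    qed
    show "\<psi> (tgt (op_cat C) u) (far F' u \<odot>\<^bsub>op_cat D\<^esub> h) = \<psi> (src (op_cat C) u) h \<odot>\<^bsub>C\<^esub> u"
      if "u \<in> Ar (op_cat C)" "h \<in> Ar (op_cat D)" "tgt (op_cat D) h = fob F' (src (op_cat C) u)"
      for u h
      using that by (simp add: B.transpose_pre)
  qed (use A.F.is_functor_axioms B.F.is_functor_axioms in
      \<open>auto intro!: is_functor_op simp: A.transpose_pre B.transpose_post\<close>)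
  then show ?thesis by (rule naturally_isomorphic_op)
qed

lemma right_adjoint_terminal:
  assumes "adjoint_pair C D F G" "is_terminal D t"
  shows "is_terminal C (fob G t)"
proof -
  obtain \<phi> where "hom_adjunction C D F G \<phi>" by (rule adjoint_pairE[OF assms(1)])
  then interpret A: hom_adjunction C D F G \<phi> .
  have t: "t \<in> Ob D" and unique: "\<And>B. B \<in> Ob D \<Longrightarrow> \<exists>!f. f \<in> hom D B t"
    using assms(2) by (auto simp: is_terminal_def)
  have "\<exists>!f. f \<in> hom C A (fob G t)" if A: "A \<in> Ob C" for A
  proof -
    obtain f where f: "hom D (fob F A) t = {f}"
      using unique[of "fob F A"] A by (auto simp del: in_hom_iff)
    have "hom C A (fob G t) = {\<phi> A f}"
      using bij_betw_imp_surj_on[OF A.bij[of A t]] A t f by simp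
    then show ?thesis by (metis singleton_iff)
  qed
  then show ?thesis
    using t by (simp add: is_terminal_def)
qed


section \<open>Equivalences\<close>

lemma fully_faithful_comp:
  assumes "is_functor C D F" "fully_faithful C D F" "fully_faithful D E G"
  shows "fully_faithful C E (G \<bullet> F)"
  unfolding fully_faithful_def
proof (intro ballI)
  interpret is_functor C D F by fact
  fix A B assume AB: "A \<in> Ob C" "B \<in> Ob C"
  show "bij_betw (far (G \<bullet> F)) (hom C A B) (hom E (fob (G \<bullet> F) A) (fob (G \<bullet> F) B))"
    using bij_betw_trans[OF fully_faithfulD[OF assms(2) AB] fully_faithfulD[OF assms(3), of "fob F A" "fob F B"]] AB
    by (simp add: comp_func_def)
qed

text \<open>Naturality of \<open>\<alpha>\<close> expresses \<open>f \<odot> \<alpha>\<close>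
  through \<open>far F f\<close> and the target of \<open>f\<close>, and the isomorphism
  \<open>\<alpha>\<close> can be cancelled.\<close>

lemma faithful_of_retraction:
  assumes GF: "naturally_isomorphic C C (G \<bullet> F) id_func" and C: "category C"
    and fg: "f \<in> Ar C" "g \<in> Ar C" "src C f = src C g" "tgt C f = tgt C g" "far F f = far F g"
  shows "f = g"
proof -
  obtain \<alpha> where \<alpha>: "\<And>A. A \<in> Ob C \<Longrightarrow> is_iso C (\<alpha> A)" "\<And>A. A \<in> Ob C \<Longrightarrow> tgt C (\<alpha> A) = A"
    "\<And>f. f \<in> Ar C \<Longrightarrow> \<alpha> (tgt C f) \<odot>\<^bsub>C\<^esub> far G (far F f) = f \<odot>\<^bsub>C\<^esub> \<alpha> (src C f)"
    by (rule naturally_isomorphicE[OF GF]) auto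
  interpret category C by fact
  have "f \<odot>\<^bsub>C\<^esub> \<alpha> (src C f) = g \<odot>\<^bsub>C\<^esub> \<alpha> (src C f)"
    using \<alpha>(3)[of f] \<alpha>(3)[of g] fg by simp
  then show ?thesis
    using bij_betw_pre_iso[of "\<alpha> (src C f)" "tgt C f"] \<alpha>(1,2) fg
    unfolding bij_betw_def inj_on_def by auto
qed

lemma fully_faithful_of_inverse:
  assumes GF: "naturally_isomorphic C C (G \<bullet> F) id_func" and FG: "naturally_isomorphic D D (F \<bullet> G) id_func"
    and F: "is_functor C D F" and G: "is_functor D C G"
  shows "fully_faithful C D F"
  unfolding fully_faithful_def
proof (intro ballI)
  interpret F: is_functor C D F by fact
  interpret G: is_functor D C G by fact
  obtain \<alpha> where \<alpha>: "\<And>A. A \<in> Ob C \<Longrightarrow> is_iso C (\<alpha> A)" "\<And>A. A \<in> Ob C \<Longrightarrow> src C (\<alpha> A) = fob G (fob F A)"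
    "\<And>A. A \<in> Ob C \<Longrightarrow> tgt C (\<alpha> A) = A"
    "\<And>f. f \<in> Ar C \<Longrightarrow> \<alpha> (tgt C f) \<odot>\<^bsub>C\<^esub> far G (far F f) = f \<odot>\<^bsub>C\<^esub> \<alpha> (src C f)"
    by (rule naturally_isomorphicE[OF GF]) auto
  note [simp] = \<alpha>(1-3)
  fix A B assume AB: "A \<in> Ob C" "B \<in> Ob C"
  have "\<exists>f. f \<in> hom C A B \<and> far F f = k" if k: "k \<in> hom D (fob F A) (fob F B)" for k
  proof -
    obtain a where a: "a \<in> Ar C" "src C a = A" "tgt C a = fob G (fob F A)"
      "a \<odot>\<^bsub>C\<^esub> \<alpha> A = idn C (fob G (fob F A))"
      using F.C.isoE[of "\<alpha> A"] \<alpha>(1-3)[OF AB(1)] by metis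
    \<comment> \<open>The naturality square of \<open>\<alpha>\<close> forces this choice of a
      preimage of \<open>k\<close>; \<open>a\<close> is the inverse of
      \<open>\<alpha> A\<close>.\<close>
    define f where "f = \<alpha> B \<odot>\<^bsub>C\<^esub> (far G k \<odot>\<^bsub>C\<^esub> a)"
    have f: "f \<in> Ar C" "src C f = A" "tgt C f = B"
      using a AB k by (auto simp: f_def)
    have "\<alpha> B \<odot>\<^bsub>C\<^esub> far G (far F f) = \<alpha> B \<odot>\<^bsub>C\<^esub> far G k"
      using \<alpha>(4)[OF f(1)] f AB a k by (simp add: f_def)
    then have "far G (far F f) = far G k"
      using F.C.bij_betw_post_iso[of "\<alpha> B" "fob G (fob F A)"] f AB k
      unfolding bij_betw_def inj_on_def by auto
    \<comment> \<open>\<open>G\<close> is faithful too, because \<open>F \<bullet> G\<close> is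
      isomorphic to the identity.\<close>
    then have "far F f = k"
      using faithful_of_retraction[OF FG F.D.category_axioms, of "far F f" k] f k by auto
    with f show ?thesis by auto
  qed
  moreover have "inj_on (far F) (hom C A B)"
    using faithful_of_retraction[OF GF F.C.category_axioms] by (auto intro!: inj_onI)
  ultimately show "bij_betw (far F) (hom C A B) (hom D (fob F A) (fob F B))"
    unfolding bij_betw_def by fastforce
qed

lemma equivalence_fully_faithful: "is_equivalence C D F \<Longrightarrow> fully_faithful C D F"
  unfolding is_equivalence_def by (blast intro: fully_faithful_of_inverse)

text \<open>The two given natural isomorphisms need not satisfy the triangle identities. In hom-set
  form this does not matter: \<open>G\<close> is fully faithful and \<open>\<alpha> A\<close> is
  invertible, so applying \<open>G\<close> and composing with \<open>\<alpha> A\<close> is a natural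
  bijection, and a matching counit is derived from it.\<close>

lemma adjoint_pair_of_inverse:
  assumes GF: "naturally_isomorphic C C (G \<bullet> F) id_func" and FG: "naturally_isomorphic D D (F \<bullet> G) id_func"
    and F: "is_functor C D F" and G: "is_functor D C G"
  shows "adjoint_pair C D F G"
proof -
  interpret F: is_functor C D F by fact
  interpret G: is_functor D C G by fact
  obtain \<alpha> where \<alpha>: "\<And>A. A \<in> Ob C \<Longrightarrow> is_iso C (\<alpha> A)" "\<And>A. A \<in> Ob C \<Longrightarrow> src C (\<alpha> A) = A"
    "\<And>A. A \<in> Ob C \<Longrightarrow> tgt C (\<alpha> A) = fob G (fob F A)"
    "\<And>f. f \<in> Ar C \<Longrightarrow> \<alpha> (tgt C f) \<odot>\<^bsub>C\<^esub> f = far G (far F f) \<odot>\<^bsub>C\<^esub> \<alpha> (src C f)"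
    by (rule naturally_isomorphicE[OF naturally_isomorphic_sym[OF GF]]) auto
  note [simp] = \<alpha>(1-3)
  have ff: "fully_faithful D C G"
    by (rule fully_faithful_of_inverse[OF FG GF G F])
  have "hom_adjunction C D F G (\<lambda>A u. far G u \<odot>\<^bsub>C\<^esub> \<alpha> A)"
  proof (rule hom_adjunctionI[OF F G])
    show "bij_betw (\<lambda>u. far G u \<odot>\<^bsub>C\<^esub> \<alpha> A) (hom D (fob F A) B) (hom C A (fob G B))"
      if "A \<in> Ob C" "B \<in> Ob D" for A B
      using bij_betw_trans[OF fully_faithfulD[OF ff, of "fob F A" B], of "\<lambda>h. h \<odot>\<^bsub>C\<^esub> \<alpha> A"]
        F.C.bij_betw_pre_iso[of "\<alpha> A" "fob G B"] that by (simp add: comp_def)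
  qed (auto simp: \<alpha>(4))
  then show ?thesis by (rule hom_adjunction.adjoint_pair)
qed

text \<open>The situation is symmetric in a functor and its quasi-inverse. For \<open>jM\<close> at
  the terminal object, coends use the left adjoint and ends the right one.\<close>

lemma equivalence_adjoints:
  assumes "is_equivalence C D F"
  obtains G where "adjoint_pair C D F G" "adjoint_pair D C G F"
  using assms adjoint_pair_of_inverse unfolding is_equivalence_def by metis


section \<open>Orthogonality\<close>

text \<open>In the language of localisation, \<open>w\<close> is local with respect to
  \<open>u\<close>: it cannot distinguish \<open>u\<close> from an isomorphism.\<close>

definition orthogonal :: "('o, 'a) cat \<Rightarrow> 'a \<Rightarrow> 'o \<Rightarrow> bool" where
  "orthogonal C u w \<longleftrightarrow> bij_betw (\<lambda>h. h \<odot>\<^bsub>C\<^esub> u) (hom C (tgt C u) w) (hom C (src C u) w)"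

context category
begin

lemma orthogonal_inj:
  assumes "orthogonal C u w" "h \<odot> u = k \<odot> u" "h \<in> Ar C" "k \<in> Ar C"
    "src C h = tgt C u" "src C k = tgt C u" "tgt C h = w" "tgt C k = w"
  shows "h = k"
  using assms unfolding orthogonal_def bij_betw_def inj_on_def by auto

lemma orthogonal_surj:
  assumes "orthogonal C u w" "k \<in> Ar C" "src C k = src C u" "tgt C k = w"
  obtains h where "h \<in> Ar C" "src C h = tgt C u" "tgt C h = w" "h \<odot> u = k"
proof -
  have "k \<in> (\<lambda>h. h \<odot> u) ` hom C (tgt C u) w"
    using assms bij_betw_imp_surj_on unfolding orthogonal_def by fastforce
  then show thesis using that by auto
qed

lemma orthogonal_iso: "is_iso C u \<Longrightarrow> w \<in> Ob C \<Longrightarrow> orthogonal C u w"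
  unfolding orthogonal_def by (rule bij_betw_pre_iso)

lemma orthogonal_cmp:
  assumes "orthogonal C u w" "orthogonal C v w" "u \<in> Ar C" "v \<in> Ar C" "tgt C u = src C v"
  shows "orthogonal C (v \<odot> u) w"
proof -
  have "bij_betw ((\<lambda>h. h \<odot> u) \<circ> (\<lambda>h. h \<odot> v)) (hom C (tgt C v) w) (hom C (src C u) w)"
    using assms unfolding orthogonal_def by (intro bij_betw_trans) auto
  also have "?this \<longleftrightarrow> bij_betw (\<lambda>h. h \<odot> (v \<odot> u)) (hom C (tgt C v) w) (hom C (src C u) w)"
    using assms by (intro bij_betw_cong) auto
  finally show ?thesis
    using assms by (simp add: orthogonal_def)
qed

lemma orthogonal_target_iso:
  assumes "orthogonal C u (src C s)" "is_iso C s" "u \<in> Ar C"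
  shows "orthogonal C u (tgt C s)"
proof -
  have "bij_betw (\<lambda>h. h \<odot> u) (hom C (tgt C u) (src C s)) (hom C (src C u) (src C s)) \<longleftrightarrow>
      bij_betw (\<lambda>h. h \<odot> u) (hom C (tgt C u) (tgt C s)) (hom C (src C u) (tgt C s))"
    by (rule bij_betw_square[where a = "\<lambda>h. s \<odot> h" and b = "\<lambda>h. s \<odot> h"])
      (use assms in \<open>auto intro!: bij_betw_post_iso\<close>)
  then show ?thesis using assms by (simp add: orthogonal_def)
qed

text \<open>Extending the identity of the source along \<open>u\<close> gives \<open>r\<close> with
  \<open>r \<odot> u\<close> the identity. Then \<open>u \<odot> r\<close> and the identity of the
  target agree when composed with \<open>u\<close>, so orthogonality to the target makes them
  equal.\<close>

lemma iso_of_orthogonal: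
  assumes u: "u \<in> Ar C" and "orthogonal C u (src C u)" "orthogonal C u (tgt C u)"
  shows "is_iso C u"
proof -
  obtain r where r: "r \<in> Ar C" "src C r = tgt C u" "tgt C r = src C u" "r \<odot> u = idn C (src C u)"
    by (rule orthogonal_surj[OF assms(2), of "idn C (src C u)"]) (use u in auto)
  have "u \<odot> r = idn C (tgt C u)"
    by (rule orthogonal_inj[OF assms(3)]) (use u r in auto)
  then show ?thesis using u r by (intro isoI[where g = r]) auto
qed

end

context hom_adjunction
begin

text \<open>Transposition turns precomposition with \<open>far F u\<close> into precomposition with
  \<open>u\<close>. Hence \<open>F\<close> inverts exactly those \<open>u\<close> for which all
  objects \<open>fob G B\<close> are local.\<close>

lemma orthogonal_iff:
  assumes "u \<in> Ar C" "B \<in> Ob D"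
  shows "orthogonal D (far F u) B \<longleftrightarrow> orthogonal C u (fob G B)"
  unfolding orthogonal_def
proof (rule bij_betw_square[where a = "\<phi> (tgt C u)" and b = "\<phi> (src C u)"])
  show "bij_betw (\<phi> (tgt C u)) (hom D (tgt D (far F u)) B) (hom C (tgt C u) (fob G B))"
    "bij_betw (\<phi> (src C u)) (hom D (src D (far F u)) B) (hom C (src C u) (fob G B))"
    using assms bij[of "tgt C u" B] bij[of "src C u" B] by auto
qed (use assms in \<open>auto simp: transpose_pre\<close>)

lemma orthogonal_of_iso:
  assumes "u \<in> Ar C" "is_iso D (far F u)" "B \<in> Ob D"
  shows "orthogonal C u (fob G B)"
  using assms orthogonal_iff F.D.orthogonal_iso by blast

lemma iso_of_orthogonal:
  assumes "u \<in> Ar C" "\<And>B. B \<in> Ob D \<Longrightarrow> orthogonal C u (fob G B)"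
  shows "is_iso D (far F u)"
  using assms orthogonal_iff[of u] by (intro F.D.iso_of_orthogonal) auto

text \<open>Once \<open>far G\<close> identifies arrows \<open>F A \<rightarrow> B\<close> with
  arrows \<open>G (F A) \<rightarrow> G B\<close>, precomposition with the unit is the transposition
  \<open>\<phi> A\<close>, a bijection.\<close>

lemma orthogonal_unit:
  assumes ff: "fully_faithful D C G" and AB: "A \<in> Ob C" "B \<in> Ob D"
  shows "orthogonal C (\<phi> A (idn D (fob F A))) (fob G B)"
proof -
  let ?\<eta> = "\<phi> A (idn D (fob F A))"
  have "bij_betw (\<phi> A) (hom D (fob F A) B) (hom C A (fob G B)) \<longleftrightarrow>
      bij_betw (\<lambda>h. h \<odot>\<^bsub>C\<^esub> ?\<eta>) (hom C (fob G (fob F A)) (fob G B)) (hom C A (fob G B))"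
  proof (rule bij_betw_square[where a = "far G" and b = id])
    show "bij_betw (far G) (hom D (fob F A) B) (hom C (fob G (fob F A)) (fob G B))"
      using AB by (intro fully_faithfulD[OF ff]) auto
  qed (use AB transpose_post[of A "idn D (fob F A)", symmetric] in auto)
  then show ?thesis using bij[OF AB] AB by (simp add: orthogonal_def)
qed

end


section \<open>Finite products\<close>

context category
begin

lemma to_terminal_simps [simp]:
  assumes "is_terminal C t" "A \<in> Ob C"
  shows "to_terminal C t A \<in> Ar C" "src C (to_terminal C t A) = A" "tgt C (to_terminal C t A) = t"
  using theI'[of "\<lambda>f. f \<in> hom C A t"] assms unfolding is_terminal_def to_terminal_def by auto

lemma terminal_unique:
  assumes "is_terminal C t" "f \<in> Ar C" "g \<in> Ar C" "src C f = src C g" "tgt C f = t" "tgt C g = t"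
  shows "f = g"
  using assms src_Ob[of g] unfolding is_terminal_def by (metis in_hom_iff)

end

definition is_product :: "('o, 'a) cat \<Rightarrow> 'o \<Rightarrow> 'o \<Rightarrow> 'o \<Rightarrow> 'a \<Rightarrow> 'a \<Rightarrow> bool" where
  "is_product C A B Q p q \<longleftrightarrow> Q \<in> Ob C \<and> p \<in> hom C Q A \<and> q \<in> hom C Q B \<and>
    (\<forall>Z u v. u \<in> hom C Z A \<longrightarrow> v \<in> hom C Z B \<longrightarrow>
      (\<exists>!h. h \<in> hom C Z Q \<and> p \<odot>\<^bsub>C\<^esub> h = u \<and> q \<odot>\<^bsub>C\<^esub> h = v))"

lemma finite_products_exist:
  assumes "category C" "is_terminal C t"
    and prod: "\<And>A B. A \<in> Ob C \<Longrightarrow> B \<in> Ob C \<Longrightarrow> \<exists>Q p q. is_product C A B Q p q"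
  obtains S where "finite_products C S"
proof -
  obtain Q p q where Q: "\<And>A B. A \<in> Ob C \<Longrightarrow> B \<in> Ob C \<Longrightarrow> is_product C A B (Q A B) (p A B) (q A B)"
    using prod by metis
  interpret category C by fact
  define S where "S = \<lparr>unt = t, prd = Q, pr1 = p, pr2 = q\<rparr>"
  have S: "unt S = t" "prd S = Q" "pr1 S = p" "pr2 S = q"
    by (simp_all add: S_def)
  have "finite_products C S"
  proof (intro finite_products.intro finite_products_axioms.intro category_axioms, unfold S)
    show "\<exists>!h. h \<in> hom C Z (Q A B) \<and> p A B \<odot>\<^bsub>C\<^esub> h = u \<and> q A B \<odot>\<^bsub>C\<^esub> h = v"
      if "u \<in> hom C Z A" "v \<in> hom C Z B" for u v Z A B
      using Q[of A B, unfolded is_product_def] tgt_Ob[of u] tgt_Ob[of v] that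
      by (simp only: in_hom_iff)
  qed (use Q assms(2) in \<open>simp_all only: is_product_def\<close>)
  then show thesis by (rule that)
qed

context finite_products
begin

lemma unt_Ob [simp]: "unt S \<in> Ob C"
  using top_terminal by (simp add: is_terminal_def)

lemmas top_terminal [simp]

lemma pr_simps [simp]:
  assumes "A \<in> Ob C" "B \<in> Ob C"
  shows "prd S A B \<in> Ob C"
    "pr1 S A B \<in> Ar C" "src C (pr1 S A B) = prd S A B" "tgt C (pr1 S A B) = A"
    "pr2 S A B \<in> Ar C" "src C (pr2 S A B) = prd S A B" "tgt C (pr2 S A B) = B"
  using prd_in[OF assms] pr1_hom[OF assms] pr2_hom[OF assms] by auto

lemma pairing_simps [simp]:
  assumes "u \<in> Ar C" "v \<in> Ar C" "src C u = src C v"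
  shows "pairing C S u v \<in> Ar C" "src C (pairing C S u v) = src C v"
    "tgt C (pairing C S u v) = prd S (tgt C u) (tgt C v)"
    "A = tgt C u \<Longrightarrow> B = tgt C v \<Longrightarrow> pr1 S A B \<odot>\<^bsub>C\<^esub> pairing C S u v = u"
    "A = tgt C u \<Longrightarrow> B = tgt C v \<Longrightarrow> pr2 S A B \<odot>\<^bsub>C\<^esub> pairing C S u v = v"
  using theI'[OF prd_universal[of u "src C u" "tgt C u" v "tgt C v"]] assms
  unfolding pairing_def by auto

lemma prd_eqI:
  assumes "h \<in> Ar C" "k \<in> Ar C" "src C h = src C k" "tgt C h = prd S A B" "tgt C k = prd S A B"
    "A \<in> Ob C" "B \<in> Ob C" "pr1 S A B \<odot>\<^bsub>C\<^esub> h = pr1 S A B \<odot>\<^bsub>C\<^esub> k" "pr2 S A B \<odot>\<^bsub>C\<^esub> h = pr2 S A B \<odot>\<^bsub>C\<^esub> k"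
  shows "h = k"
  using prd_universal[of "pr1 S A B \<odot>\<^bsub>C\<^esub> h" "src C h" A "pr2 S A B \<odot>\<^bsub>C\<^esub> h" B] assms by auto

lemma pairing_cmp [simp]:
  assumes "u \<in> Ar C" "v \<in> Ar C" "h \<in> Ar C" "src C u = src C v" "tgt C h = src C v"
  shows "pairing C S u v \<odot>\<^bsub>C\<^esub> h = pairing C S (u \<odot>\<^bsub>C\<^esub> h) (v \<odot>\<^bsub>C\<^esub> h)"
proof (rule prd_eqI[where A = "tgt C u" and B = "tgt C v"])
  show "pr1 S (tgt C u) (tgt C v) \<odot>\<^bsub>C\<^esub> (pairing C S u v \<odot>\<^bsub>C\<^esub> h)
      = pr1 S (tgt C u) (tgt C v) \<odot>\<^bsub>C\<^esub> pairing C S (u \<odot>\<^bsub>C\<^esub> h) (v \<odot>\<^bsub>C\<^esub> h)"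
    using assms cmp_assoc_simp[of h "pairing C S u v" "pr1 S (tgt C u) (tgt C v)"]
    by (simp del: cmp_assoc_simp)
  show "pr2 S (tgt C u) (tgt C v) \<odot>\<^bsub>C\<^esub> (pairing C S u v \<odot>\<^bsub>C\<^esub> h)
      = pr2 S (tgt C u) (tgt C v) \<odot>\<^bsub>C\<^esub> pairing C S (u \<odot>\<^bsub>C\<^esub> h) (v \<odot>\<^bsub>C\<^esub> h)"
    using assms cmp_assoc_simp[of h "pairing C S u v" "pr2 S (tgt C u) (tgt C v)"]
    by (simp del: cmp_assoc_simp)
qed (use assms in auto)

lemma pairing_pr [simp]:
  "h \<in> Ar C \<Longrightarrow> tgt C h = prd S A B \<Longrightarrow> A \<in> Ob C \<Longrightarrow> B \<in> Ob C \<Longrightarrow>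
    pairing C S (pr1 S A B \<odot>\<^bsub>C\<^esub> h) (pr2 S A B \<odot>\<^bsub>C\<^esub> h) = h"
  "A \<in> Ob C \<Longrightarrow> B \<in> Ob C \<Longrightarrow> pairing C S (pr1 S A B) (pr2 S A B) = idn C (prd S A B)"
  by (rule prd_eqI[where A = A and B = B]; simp)+

lemma par_simps [simp]:
  assumes "u \<in> Ar C" "v \<in> Ar C"
  shows "par C S u v \<in> Ar C" "src C (par C S u v) = prd S (src C u) (src C v)"
    "tgt C (par C S u v) = prd S (tgt C u) (tgt C v)"
  using assms by (simp_all add: par_def)

lemma par_cmp_pairing:
  assumes "u \<in> Ar C" "v \<in> Ar C" "f \<in> Ar C" "g \<in> Ar C" "src C f = src C g"
    "tgt C f = src C u" "tgt C g = src C v"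
  shows "par C S u v \<odot>\<^bsub>C\<^esub> pairing C S f g = pairing C S (u \<odot>\<^bsub>C\<^esub> f) (v \<odot>\<^bsub>C\<^esub> g)"
  using assms by (simp add: par_def)

lemma par_cmp:
  assumes "u \<in> Ar C" "v \<in> Ar C" "f \<in> Ar C" "g \<in> Ar C" "tgt C f = src C u" "tgt C g = src C v"
  shows "par C S u v \<odot>\<^bsub>C\<^esub> par C S f g = par C S (u \<odot>\<^bsub>C\<^esub> f) (v \<odot>\<^bsub>C\<^esub> g)"
  using assms by (simp add: par_def)

lemma par_idn [simp]:
  "A \<in> Ob C \<Longrightarrow> B \<in> Ob C \<Longrightarrow> par C S (idn C A) (idn C B) = idn C (prd S A B)"
  by (simp add: par_def)

lemma par_iso:
  assumes "is_iso C u" "is_iso C v"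
  shows "is_iso C (par C S u v)"
proof -
  obtain u' where u': "u' \<in> Ar C" "src C u' = tgt C u" "tgt C u' = src C u"
    "u' \<odot>\<^bsub>C\<^esub> u = idn C (src C u)" "u \<odot>\<^bsub>C\<^esub> u' = idn C (tgt C u)"
    by (rule isoE[OF assms(1)])
  obtain v' where v': "v' \<in> Ar C" "src C v' = tgt C v" "tgt C v' = src C v"
    "v' \<odot>\<^bsub>C\<^esub> v = idn C (src C v)" "v \<odot>\<^bsub>C\<^esub> v' = idn C (tgt C v)"
    by (rule isoE[OF assms(2)])
  show ?thesis
    using assms u' v' by (intro isoI[where g = "par C S u' v'"]) (auto simp: par_cmp)
qed

lemma product_functor_simps [simp]:
  "fob (product_functor C S) (A, B) = prd S A B" "far (product_functor C S) (u, v) = par C S u v"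
  by (simp_all add: product_functor_def)

lemma product_functor: "is_functor (C \<times>\<^sub>C C) C (product_functor C S)"
  by (rule is_functorI)
    (auto intro!: category_prod category_axioms simp: par_cmp)

definition swap :: "'o \<Rightarrow> 'o \<Rightarrow> 'a" where
  "swap A B = pairing C S (pr2 S A B) (pr1 S A B)"

lemma swap_simps [simp]:
  assumes "A \<in> Ob C" "B \<in> Ob C"
  shows "swap A B \<in> Ar C" "src C (swap A B) = prd S A B" "tgt C (swap A B) = prd S B A"
    "is_iso C (swap A B)"
  using assms by (auto simp: swap_def intro!: isoI[where g = "swap B A"])

lemma swap_par:
  assumes "u \<in> Ar C" "v \<in> Ar C" "A = tgt C u" "B = tgt C v"
  shows "swap A B \<odot>\<^bsub>C\<^esub> par C S u v = par C S v u \<odot>\<^bsub>C\<^esub> swap (src C u) (src C v)"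
  using assms by (simp add: swap_def par_def)

text \<open>An arrow into a product is a pair, so extensions along \<open>u\<close> are found, and
  are unique, in each component.\<close>

lemma orthogonal_prd:
  assumes u: "u \<in> Ar C" and AB: "A \<in> Ob C" "B \<in> Ob C"
    and orth: "orthogonal C u A" "orthogonal C u B"
  shows "orthogonal C u (prd S A B)"
  unfolding orthogonal_def bij_betw_def
proof (intro conjI inj_onI subset_antisym subsetI)
  fix h k assume "h \<in> hom C (tgt C u) (prd S A B)" "k \<in> hom C (tgt C u) (prd S A B)"
    and eq: "h \<odot>\<^bsub>C\<^esub> u = k \<odot>\<^bsub>C\<^esub> u"
  then have hk: "h \<in> Ar C" "src C h = tgt C u" "tgt C h = prd S A B"
    "k \<in> Ar C" "src C k = tgt C u" "tgt C k = prd S A B"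
    by auto
  have "pr1 S A B \<odot>\<^bsub>C\<^esub> h = pr1 S A B \<odot>\<^bsub>C\<^esub> k"
    by (rule orthogonal_inj[OF orth(1)]) (simp_all add: hk u AB eq)
  moreover have "pr2 S A B \<odot>\<^bsub>C\<^esub> h = pr2 S A B \<odot>\<^bsub>C\<^esub> k"
    by (rule orthogonal_inj[OF orth(2)]) (simp_all add: hk u AB eq)
  ultimately show "h = k"
    by (intro prd_eqI[where A = A and B = B and h = h]) (simp_all add: hk AB)
next
  fix k assume k: "k \<in> (\<lambda>h. h \<odot>\<^bsub>C\<^esub> u) ` hom C (tgt C u) (prd S A B)"
  then show "k \<in> hom C (src C u) (prd S A B)"
    using u by auto
next
  fix k assume "k \<in> hom C (src C u) (prd S A B)"
  then have k: "k \<in> Ar C" "src C k = src C u" "tgt C k = prd S A B"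
    by auto
  obtain f where f: "f \<in> Ar C" "src C f = tgt C u" "tgt C f = A" "f \<odot>\<^bsub>C\<^esub> u = pr1 S A B \<odot>\<^bsub>C\<^esub> k"
    by (rule orthogonal_surj[OF orth(1), of "pr1 S A B \<odot>\<^bsub>C\<^esub> k"]) (simp_all add: k AB)
  obtain g where g: "g \<in> Ar C" "src C g = tgt C u" "tgt C g = B" "g \<odot>\<^bsub>C\<^esub> u = pr2 S A B \<odot>\<^bsub>C\<^esub> k"
    by (rule orthogonal_surj[OF orth(2), of "pr2 S A B \<odot>\<^bsub>C\<^esub> k"]) (simp_all add: k AB)
  have "pairing C S f g \<odot>\<^bsub>C\<^esub> u = k"
    by (simp add: f g u k AB)
  then show "k \<in> (\<lambda>h. h \<odot>\<^bsub>C\<^esub> u) ` hom C (tgt C u) (prd S A B)"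
    by (intro image_eqI[where x = "pairing C S f g"]) (simp_all add: f g)
qed

text \<open>Replacing the idle factor by an isomorphic object conjugates the arrow by isomorphisms,
  and these do not affect orthogonality.\<close>

lemma orthogonal_par_iso:
  assumes orth: "orthogonal C (par C S u (idn C (src C s))) w" and s: "is_iso C s"
    and "u \<in> Ar C" "w \<in> Ob C"
  shows "orthogonal C (par C S u (idn C (tgt C s))) w"
proof -
  obtain t where t: "t \<in> Ar C" "src C t = tgt C s" "tgt C t = src C s"
    "t \<odot>\<^bsub>C\<^esub> s = idn C (src C s)" "s \<odot>\<^bsub>C\<^esub> t = idn C (tgt C s)" "is_iso C t"
    by (rule isoE[OF s])
  have "par C S u (idn C (tgt C s)) = par C S (idn C (tgt C u)) s \<odot>\<^bsub>C\<^esub>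
      (par C S u (idn C (src C s)) \<odot>\<^bsub>C\<^esub> par C S (idn C (src C u)) t)"
    using assms t by (simp add: par_cmp)
  also have "orthogonal C \<dots> w"
    using assms t
    by (intro orthogonal_cmp[OF orthogonal_cmp[OF orthogonal_iso orth] orthogonal_iso]) (auto intro!: par_iso)
  finally show ?thesis .
qed

end

definition swap_func :: "('o \<times> 'p, 'a \<times> 'b, 'p \<times> 'o, 'b \<times> 'a) func" where
  "swap_func = \<lparr>fob = prod.swap, far = prod.swap\<rparr>"

lemma swap_func_simps [simp]:
  "fob swap_func (A, B) = (B, A)" "far swap_func (f, g) = (g, f)"
  by (simp_all add: swap_func_def)

lemma swap_func_functor:
  assumes "category C" "category D"
  shows "is_functor (C \<times>\<^sub>C D) (D \<times>\<^sub>C C) swap_func"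
  using assms by (intro is_functorI category_prod) auto

lemma prod_func_swap: "(F \<times>\<^sub>f G) \<bullet> swap_func = swap_func \<bullet> (G \<times>\<^sub>f F)"
  by (rule func_eqI) (auto simp: prod_func_def swap_func_def)

lemma (in finite_products) product_functor_swap:
  "naturally_isomorphic (C \<times>\<^sub>C C) C (product_functor C S) (product_functor C S \<bullet> swap_func)"
  by (rule naturally_isomorphicI[where \<tau> = "\<lambda>(A, B). swap A B"])
    (auto intro!: product_functor is_functor_comp[OF swap_func_functor] category_axioms simp: swap_par)

lemma (in hom_adjunction) right_adjoint_preserves_products:
  assumes "finite_products C S" "finite_products D S'" and AB: "A \<in> Ob D" "B \<in> Ob D"
  shows "is_iso C (pairing C S (far G (pr1 S' A B)) (far G (pr2 S' A B)))"
proof -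
  interpret C: finite_products C S by fact
  interpret D: finite_products D S' by fact
  let ?Q = "prd S (fob G A) (fob G B)"
  \<comment> \<open>The inverse of the comparison arrow is the transpose of the pair of arrows whose
    transposes are the two projections.\<close>
  obtain a where a: "a \<in> Ar D" "src D a = fob F ?Q" "tgt D a = A" "\<phi> ?Q a = pr1 S (fob G A) (fob G B)"
    by (rule transpose_surj[of "pr1 S (fob G A) (fob G B)" ?Q A]) (use AB in auto)
  obtain b where b: "b \<in> Ar D" "src D b = fob F ?Q" "tgt D b = B" "\<phi> ?Q b = pr2 S (fob G A) (fob G B)"
    by (rule transpose_surj[of "pr2 S (fob G A) (fob G B)" ?Q B]) (use AB in auto)
  let ?c = "pairing C S (far G (pr1 S' A B)) (far G (pr2 S' A B))"
  let ?d = "\<phi> ?Q (pairing D S' a b)"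
  have d: "far G (pr1 S' A B) \<odot>\<^bsub>C\<^esub> ?d = pr1 S (fob G A) (fob G B)"
    "far G (pr2 S' A B) \<odot>\<^bsub>C\<^esub> ?d = pr2 S (fob G A) (fob G B)"
    using a b AB transpose_post[of ?Q "pairing D S' a b", symmetric] by auto
  have cd: "?c \<odot>\<^bsub>C\<^esub> ?d = idn C ?Q"
    using a b AB d by simp
  obtain e where e: "e \<in> Ar D" "src D e = fob F (fob G (prd S' A B))" "tgt D e = prd S' A B"
    "\<phi> (fob G (prd S' A B)) e = ?d \<odot>\<^bsub>C\<^esub> ?c"
    by (rule transpose_surj[of "?d \<odot>\<^bsub>C\<^esub> ?c" "fob G (prd S' A B)" "prd S' A B"]) (use a b AB in auto)
  obtain e' where e': "e' \<in> Ar D" "src D e' = fob F (fob G (prd S' A B))" "tgt D e' = prd S' A B"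
    "\<phi> (fob G (prd S' A B)) e' = idn C (fob G (prd S' A B))"
    by (rule transpose_surj[of "idn C (fob G (prd S' A B))" "fob G (prd S' A B)" "prd S' A B"]) (use AB in auto)
  have eq: "far G (pr1 S' A B) \<odot>\<^bsub>C\<^esub> (?d \<odot>\<^bsub>C\<^esub> ?c) = far G (pr1 S' A B)"
    "far G (pr2 S' A B) \<odot>\<^bsub>C\<^esub> (?d \<odot>\<^bsub>C\<^esub> ?c) = far G (pr2 S' A B)"
    using a b AB F.C.cmp_assoc_simp[of ?c ?d "far G (pr1 S' A B)"]
      F.C.cmp_assoc_simp[of ?c ?d "far G (pr2 S' A B)"] d
    by (simp_all del: F.C.cmp_assoc_simp)
  \<comment> \<open>The remaining composite is an endomorphism of the image under \<open>G\<close>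
    of a product. It is transposed back to \<open>D\<close>, where arrows into the product can be
    compared by projections.\<close>
  have "e = e'"
  proof (rule D.prd_eqI[where A = A and B = B])
    show "pr1 S' A B \<odot>\<^bsub>D\<^esub> e = pr1 S' A B \<odot>\<^bsub>D\<^esub> e'" "pr2 S' A B \<odot>\<^bsub>D\<^esub> e = pr2 S' A B \<odot>\<^bsub>D\<^esub> e'"
      by (rule transpose_inj[where A = "fob G (prd S' A B)"];
          use AB e e' eq in \<open>simp add: transpose_post\<close>)+
  qed (use AB e e' in auto)
  then have "?d \<odot>\<^bsub>C\<^esub> ?c = idn C (fob G (prd S' A B))"
    using e e' by simp
  then show ?thesis
    using cd a b AB by (intro F.C.isoI[where g = ?d]) auto
qed

text \<open>In a full coreflective subcategory, products are computed in the ambient category and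
  then coreflected; likewise the terminal object.\<close>

lemma (in hom_adjunction) coreflective_finite_products:
  assumes ff: "fully_faithful C D F" and "finite_products D S'"
  obtains S where "finite_products C S"
proof (rule finite_products_exist[OF F.C.category_axioms])
  interpret D: finite_products D S' by fact
  show "is_terminal C (fob G (unt S'))"
    by (rule right_adjoint_terminal[OF adjoint_pair D.top_terminal])
  fix A B assume AB: "A \<in> Ob C" "B \<in> Ob C"
  let ?R = "prd S' (fob F A) (fob F B)"
  let ?Q = "fob G ?R"
  \<comment> \<open>This is the counit at the ambient product. Full faithfulness of \<open>F\<close>
    turns its two components into the projections \<open>p\<close> and \<open>q\<close>, and
    \<open>e_cmp\<close> shows that an arrow into \<open>?Q\<close> is determined by its composite
    with \<open>e\<close>.\<close>
  obtain e where e: "e \<in> Ar D" "src D e = fob F ?Q" "tgt D e = ?R" "\<phi> ?Q e = idn C ?Q"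
    by (rule transpose_surj[of "idn C ?Q" ?Q ?R]) (use AB in auto)
  have e_cmp: "\<phi> (src C h) (e \<odot>\<^bsub>D\<^esub> far F h) = h" if "h \<in> Ar C" "tgt C h = ?Q" for h
    using that transpose_pre[of h e] e by simp
  have "pr1 S' (fob F A) (fob F B) \<odot>\<^bsub>D\<^esub> e \<in> far F ` hom C ?Q A"
    "pr2 S' (fob F A) (fob F B) \<odot>\<^bsub>D\<^esub> e \<in> far F ` hom C ?Q B"
    using fully_faithfulD[OF ff, of ?Q A] fully_faithfulD[OF ff, of ?Q B] AB e unfolding bij_betw_def by auto
  then obtain p q where p: "p \<in> Ar C" "src C p = ?Q" "tgt C p = A"
      "far F p = pr1 S' (fob F A) (fob F B) \<odot>\<^bsub>D\<^esub> e"
    and q: "q \<in> Ar C" "src C q = ?Q" "tgt C q = B"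
      "far F q = pr2 S' (fob F A) (fob F B) \<odot>\<^bsub>D\<^esub> e"
    by auto
  have faithful: "f = g" if "far F f = far F g" "f \<in> Ar C" "g \<in> Ar C" "src C f = src C g" "tgt C f = tgt C g" for f g
    using fully_faithfulD[OF ff, of "src C f" "tgt C f"] that unfolding bij_betw_def inj_on_def by auto
  have "\<exists>!h. h \<in> hom C Z ?Q \<and> p \<odot>\<^bsub>C\<^esub> h = u \<and> q \<odot>\<^bsub>C\<^esub> h = v"
    if u: "u \<in> hom C Z A" and v: "v \<in> hom C Z B" for Z u v
  proof (rule ex1I[where a = "\<phi> Z (pairing D S' (far F u) (far F v))"])
    let ?h = "\<phi> Z (pairing D S' (far F u) (far F v))"
    have Z: "Z \<in> Ob C"
      using u by auto
    have "e \<odot>\<^bsub>D\<^esub> far F ?h = pairing D S' (far F u) (far F v)"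
      by (rule transpose_inj[where A = Z]) (use e_cmp[of ?h] u v e Z in auto)
    then show "?h \<in> hom C Z ?Q \<and> p \<odot>\<^bsub>C\<^esub> ?h = u \<and> q \<odot>\<^bsub>C\<^esub> ?h = v"
      using u v p q e Z by (auto intro!: faithful)
  next
    fix h assume h: "h \<in> hom C Z ?Q \<and> p \<odot>\<^bsub>C\<^esub> h = u \<and> q \<odot>\<^bsub>C\<^esub> h = v"
    have "e \<odot>\<^bsub>D\<^esub> far F h = pairing D S' (far F u) (far F v)"
    proof (rule D.prd_eqI[where A = "fob F A" and B = "fob F B"])
      show "pr1 S' (fob F A) (fob F B) \<odot>\<^bsub>D\<^esub> (e \<odot>\<^bsub>D\<^esub> far F h)
          = pr1 S' (fob F A) (fob F B) \<odot>\<^bsub>D\<^esub> pairing D S' (far F u) (far F v)"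
        using u v h F.far_cmp_simp[of h p] p e AB by auto
      show "pr2 S' (fob F A) (fob F B) \<odot>\<^bsub>D\<^esub> (e \<odot>\<^bsub>D\<^esub> far F h)
          = pr2 S' (fob F A) (fob F B) \<odot>\<^bsub>D\<^esub> pairing D S' (far F u) (far F v)"
        using u v h F.far_cmp_simp[of h q] q e AB by auto
    qed (use u v h e AB in auto)
    then show "h = \<phi> Z (pairing D S' (far F u) (far F v))"
      using e_cmp[of h] h by auto
  qed
  then show "\<exists>Q p q. is_product C A B Q p q"
    using p q AB by (intro exI[of _ ?Q] exI[of _ p] exI[of _ q]) (simp add: is_product_def)
qed (rule that)

text \<open>The unit at the product is orthogonal to its target, a value of \<open>G\<close>, and
  also to its source, a product of such values. An arrow orthogonal to both its ends is
  invertible.\<close>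

lemma (in hom_adjunction) reflective_product:
  assumes ff: "fully_faithful D C G" and S: "finite_products C S" and AB: "A \<in> Ob D" "B \<in> Ob D"
  obtains s where "is_iso C s" "src C s = prd S (fob G A) (fob G B)"
    "tgt C s = fob G (fob F (prd S (fob G A) (fob G B)))"
proof
  interpret S: finite_products C S by fact
  let ?Q = "prd S (fob G A) (fob G B)"
  let ?s = "\<phi> ?Q (idn D (fob F ?Q))"
  have Q: "?Q \<in> Ob C" using AB by simp
  have s: "?s \<in> Ar C" "src C ?s = ?Q" "tgt C ?s = fob G (fob F ?Q)"
    using Q by auto
  have "orthogonal C ?s ?Q"
    using AB Q s by (intro S.orthogonal_prd orthogonal_unit[OF ff]) auto
  moreover have "orthogonal C ?s (fob G (fob F ?Q))"
    using Q by (intro orthogonal_unit[OF ff]) auto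
  ultimately show "is_iso C ?s"
    using s by (intro F.C.iso_of_orthogonal) auto
  show "src C ?s = ?Q" "tgt C ?s = fob G (fob F ?Q)"
    by (fact s)+
qed


section \<open>Enrichment by weighted exponentials\<close>

text \<open>\<open>V\<close> acts on \<open>P\<close> by \<open>(Z, Q) \<mapsto> W Z \<times> Q\<close>. For objects \<open>a\<close>, \<open>b\<close> of the full
  subcategory \<open>A\<close>, the object \<open>R (i a \<Rightarrow> i b)\<close> represents \<open>Z \<mapsto> P(W Z \<times> i a, i b)\<close>: \<open>act a b\<close> is this
  bijection.\<close>

locale weighted_exponentials =
  P: finite_products P Sp + adjunction V P W R \<eta> \<epsilon> + i: is_functor A P i
  for V :: "('v, 'w) cat" and P :: "('p, 'q) cat" and W R \<eta> \<epsilon> and Sp :: "('p, 'q) fin_prod"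
    and A :: "('o, 'a) cat" and i :: "('o, 'a, 'p, 'q) func" +
  fixes ex :: "'p \<Rightarrow> 'p \<Rightarrow> 'p" and ev :: "'p \<Rightarrow> 'p \<Rightarrow> 'q"
  assumes full: "fully_faithful A P i"
    and exponential: "a \<in> Ob A \<Longrightarrow> Q \<in> Ob P \<Longrightarrow>
      is_exponential P Sp (fob i a) Q (ex (fob i a) Q) (ev (fob i a) Q)"
begin

abbreviation expn :: "'o \<Rightarrow> 'o \<Rightarrow> 'p" where
  "expn a b \<equiv> ex (fob i a) (fob i b)"

lemma ev_simps [simp]:
  assumes "a \<in> Ob A" "b \<in> Ob A"
  shows "expn a b \<in> Ob P" "ev (fob i a) (fob i b) \<in> Ar P"
    "src P (ev (fob i a) (fob i b)) = prd Sp (expn a b) (fob i a)"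
    "tgt P (ev (fob i a) (fob i b)) = fob i b"
  using exponential[of a "fob i b"] assms by (auto simp: is_exponential_def)

definition uncurry :: "'o \<Rightarrow> 'o \<Rightarrow> 'q \<Rightarrow> 'q" where
  "uncurry a b k = ev (fob i a) (fob i b) \<odot>\<^bsub>P\<^esub> par P Sp k (idn P (fob i a))"

lemma uncurry_simps [simp]:
  assumes "a \<in> Ob A" "b \<in> Ob A" "k \<in> Ar P" "tgt P k = expn a b"
  shows "uncurry a b k \<in> Ar P" "src P (uncurry a b k) = prd Sp (src P k) (fob i a)"
    "tgt P (uncurry a b k) = fob i b"
  using assms by (auto simp: uncurry_def)

lemma uncurry_ex1:
  assumes "a \<in> Ob A" "b \<in> Ob A" "Q \<in> Ob P" "u \<in> hom P (prd Sp Q (fob i a)) (fob i b)"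
  shows "\<exists>!h. h \<in> hom P Q (expn a b) \<and> uncurry a b h = u"
proof -
  have "is_exponential P Sp (fob i a) (fob i b) (expn a b) (ev (fob i a) (fob i b))"
    using assms by (intro exponential) auto
  then show ?thesis
    using assms(3,4) unfolding is_exponential_def uncurry_def by blast
qed

lemma uncurry_bij:
  assumes "a \<in> Ob A" "b \<in> Ob A" "Q \<in> Ob P"
  shows "bij_betw (uncurry a b) (hom P Q (expn a b)) (hom P (prd Sp Q (fob i a)) (fob i b))"
proof -
  note ex1 = uncurry_ex1[OF assms]
  have hom: "uncurry a b h \<in> hom P (prd Sp Q (fob i a)) (fob i b)" if "h \<in> hom P Q (expn a b)" for h
    using that assms by auto
  show ?thesis
    unfolding bij_betw_def
  proof (intro conjI inj_onI subset_antisym subsetI)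
    show "h = k" if "h \<in> hom P Q (expn a b)" "k \<in> hom P Q (expn a b)" "uncurry a b h = uncurry a b k" for h k
      using ex1[OF hom[OF that(1)]] that by metis
    show "u \<in> uncurry a b ` hom P Q (expn a b)" if "u \<in> hom P (prd Sp Q (fob i a)) (fob i b)" for u
      using ex1[OF that] by blast
  qed (use hom in blast)
qed

lemma uncurry_inj:
  assumes "uncurry a b h = uncurry a b k" "a \<in> Ob A" "b \<in> Ob A" "h \<in> Ar P" "k \<in> Ar P"
    "src P h = src P k" "tgt P h = expn a b" "tgt P k = expn a b"
  shows "h = k"
  using uncurry_bij[of a b "src P k"] assms unfolding bij_betw_def inj_on_def by auto

lemma uncurry_pre:
  assumes "a \<in> Ob A" "b \<in> Ob A" "k \<in> Ar P" "tgt P k = expn a b" "w \<in> Ar P" "tgt P w = src P k"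
  shows "uncurry a b (k \<odot>\<^bsub>P\<^esub> w) = uncurry a b k \<odot>\<^bsub>P\<^esub> par P Sp w (idn P (fob i a))"
  using assms by (simp add: uncurry_def P.par_cmp)

text \<open>\<open>exponential_functor\<close> is meaningful only for exponentiable first arguments,
  so functoriality is established for this restricted composite rather than for its factors.\<close>

definition expn_func :: "('o \<times> 'o, 'a \<times> 'a, 'p, 'q) func" where
  "expn_func = exponential_functor P Sp ex ev \<bullet> (i \<times>\<^sub>f i)"

lemma expn_func_ob [simp]: "fob expn_func (a, b) = expn a b"
  by (simp add: expn_func_def exponential_functor_def)

lemma expn_func_ar:
  assumes uv: "u \<in> Ar A" "v \<in> Ar A"
  shows "far expn_func (u, v) \<in> hom P (expn (tgt A u) (src A v)) (expn (src A u) (tgt A v)) \<and>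
    uncurry (src A u) (tgt A v) (far expn_func (u, v)) =
      far i v \<odot>\<^bsub>P\<^esub> (ev (fob i (tgt A u)) (fob i (src A v)) \<odot>\<^bsub>P\<^esub>
        par P Sp (idn P (expn (tgt A u) (src A v))) (far i u))"
proof -
  let ?rhs = "far i v \<odot>\<^bsub>P\<^esub> (ev (fob i (tgt A u)) (fob i (src A v)) \<odot>\<^bsub>P\<^esub>
        par P Sp (idn P (expn (tgt A u) (src A v))) (far i u))"
  have rhs: "?rhs \<in> hom P (prd Sp (expn (tgt A u) (src A v)) (fob i (src A u))) (fob i (tgt A v))"
    using uv by simp
  have "\<exists>!h. h \<in> hom P (expn (tgt A u) (src A v)) (expn (src A u) (tgt A v)) \<and>
      uncurry (src A u) (tgt A v) h = ?rhs"
    using uv by (intro uncurry_ex1 rhs) auto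
  from theI'[OF this] show ?thesis
    using uv by (simp add: expn_func_def exponential_functor_def uncurry_def)
qed

lemma expn_func_ar_simps [simp]:
  assumes "u \<in> Ar A" "v \<in> Ar A"
  shows "far expn_func (u, v) \<in> Ar P" "src P (far expn_func (u, v)) = expn (tgt A u) (src A v)"
    "tgt P (far expn_func (u, v)) = expn (src A u) (tgt A v)"
  using expn_func_ar[OF assms] by auto

lemma uncurry_post:
  assumes uv: "u \<in> Ar A" "v \<in> Ar A" and k: "k \<in> Ar P" "tgt P k = expn (tgt A u) (src A v)"
  shows "uncurry (src A u) (tgt A v) (far expn_func (u, v) \<odot>\<^bsub>P\<^esub> k) =
    far i v \<odot>\<^bsub>P\<^esub> (uncurry (tgt A u) (src A v) k \<odot>\<^bsub>P\<^esub> par P Sp (idn P (src P k)) (far i u))"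
proof -
  have "uncurry (src A u) (tgt A v) (far expn_func (u, v) \<odot>\<^bsub>P\<^esub> k) =
      uncurry (src A u) (tgt A v) (far expn_func (u, v)) \<odot>\<^bsub>P\<^esub> par P Sp k (idn P (fob i (src A u)))"
    using assms by (simp add: uncurry_pre)
  also have "\<dots> = far i v \<odot>\<^bsub>P\<^esub> (uncurry (tgt A u) (src A v) k \<odot>\<^bsub>P\<^esub> par P Sp (idn P (src P k)) (far i u))"
    using assms expn_func_ar[OF uv] by (simp add: uncurry_def P.par_cmp)
  finally show ?thesis .
qed

lemma expn_functor: "is_functor (op_cat A \<times>\<^sub>C A) P expn_func"
proof (rule is_functorI)
  fix x assume "x \<in> Ob (op_cat A \<times>\<^sub>C A)"
  then obtain a b where x: "x = (a, b)" "a \<in> Ob A" "b \<in> Ob A"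
    by (cases x) auto
  then have "uncurry a b (far expn_func (idn A a, idn A b)) = uncurry a b (idn P (expn a b))"
    using expn_func_ar[of "idn A a" "idn A b"] by (simp add: uncurry_def)
  then have "far expn_func (idn A a, idn A b) = idn P (expn a b)"
    by (rule uncurry_inj) (use x in auto)
  then show "far expn_func (idn (op_cat A \<times>\<^sub>C A) x) = idn P (fob expn_func x)"
    using x by simp
next
  fix f g assume fg: "f \<in> Ar (op_cat A \<times>\<^sub>C A)" "g \<in> Ar (op_cat A \<times>\<^sub>C A)"
    "tgt (op_cat A \<times>\<^sub>C A) f = src (op_cat A \<times>\<^sub>C A) g"
  obtain u v u' v' where f: "f = (u, v)" "u \<in> Ar A" "v \<in> Ar A" and g: "g = (u', v')" "u' \<in> Ar A" "v' \<in> Ar A"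
    and eq: "src A u = tgt A u'" "tgt A v = src A v'"
    using fg by (cases f; cases g) auto
  have "uncurry (src A u') (tgt A v') (far expn_func (u', v') \<odot>\<^bsub>P\<^esub> far expn_func (u, v)) =
      uncurry (src A u') (tgt A v') (far expn_func (u \<odot>\<^bsub>A\<^esub> u', v' \<odot>\<^bsub>A\<^esub> v))"
    using f g eq expn_func_ar[of u v] expn_func_ar[of "u \<odot>\<^bsub>A\<^esub> u'" "v' \<odot>\<^bsub>A\<^esub> v"]
      uncurry_post[of u' v' "far expn_func (u, v)"]
    by (simp add: P.par_cmp)
  then have "far expn_func (u', v') \<odot>\<^bsub>P\<^esub> far expn_func (u, v) = far expn_func (u \<odot>\<^bsub>A\<^esub> u', v' \<odot>\<^bsub>A\<^esub> v)"
    by (rule uncurry_inj) (use f g eq in auto)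
  then show "far expn_func (g \<odot>\<^bsub>op_cat A \<times>\<^sub>C A\<^esub> f) = far expn_func g \<odot>\<^bsub>P\<^esub> far expn_func f"
    using f g by simp
qed (auto intro!: category_prod category_op i.C.category_axioms P.category_axioms)

definition whom :: "('o \<times> 'o, 'a \<times> 'a, 'v, 'w) func" where
  "whom = R \<bullet> expn_func"

lemma whom_ob [simp]: "fob whom (a, b) = fob R (expn a b)"
  by (simp add: whom_def)

lemma whom_functor: "is_functor (op_cat A \<times>\<^sub>C A) V whom"
  unfolding whom_def by (rule is_functor_comp[OF expn_functor right.is_functor_axioms])

definition act :: "'o \<Rightarrow> 'o \<Rightarrow> 'w \<Rightarrow> 'q" where
  "act a b h = uncurry a b (\<epsilon> (expn a b) \<odot>\<^bsub>P\<^esub> far W h)"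

lemma act_simps [simp]:
  assumes "a \<in> Ob A" "b \<in> Ob A" "h \<in> Ar V" "tgt V h = fob R (expn a b)"
  shows "act a b h \<in> Ar P" "src P (act a b h) = prd Sp (fob W (src V h)) (fob i a)"
    "tgt P (act a b h) = fob i b"
  using assms by (auto simp: act_def)

lemma act_bij:
  assumes "a \<in> Ob A" "b \<in> Ob A" "Z \<in> Ob V"
  shows "bij_betw (act a b) (hom V Z (fob whom (a, b))) (hom P (prd Sp (fob W Z) (fob i a)) (fob i b))"
  using bij_betw_trans[OF counit_bij[of Z "expn a b"] uncurry_bij[of a b "fob W Z"]] assms
  by (simp add: comp_def act_def[abs_def])

lemma act_inj:
  assumes "act a b h = act a b k" "a \<in> Ob A" "b \<in> Ob A" "h \<in> Ar V" "k \<in> Ar V"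
    "src V h = src V k" "tgt V h = fob R (expn a b)" "tgt V k = fob R (expn a b)"
  shows "h = k"
  using act_bij[of a b "src V k"] assms unfolding bij_betw_def inj_on_def by auto

text \<open>The inverse of \<open>act a b\<close> must be told the stage \<open>Z\<close>, which
  cannot be read off from the source \<open>W Z \<times> i a\<close> of a given arrow.\<close>

definition curry :: "'v \<Rightarrow> 'o \<Rightarrow> 'o \<Rightarrow> 'q \<Rightarrow> 'w" where
  "curry Z a b = inv_into (hom V Z (fob whom (a, b))) (act a b)"

lemma curry_simps [simp]:
  assumes "a \<in> Ob A" "b \<in> Ob A" "Z \<in> Ob V" "k \<in> Ar P" "src P k = prd Sp (fob W Z) (fob i a)"
    "tgt P k = fob i b"
  shows "curry Z a b k \<in> Ar V" "src V (curry Z a b k) = Z" "tgt V (curry Z a b k) = fob R (expn a b)"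
    "act a b (curry Z a b k) = k"
proof -
  have "k \<in> act a b ` hom V Z (fob whom (a, b))"
    using bij_betw_imp_surj_on[OF act_bij[of a b Z]] assms by simp
  from inv_into_into[OF this] f_inv_into_f[OF this]
  show "curry Z a b k \<in> Ar V" "src V (curry Z a b k) = Z" "tgt V (curry Z a b k) = fob R (expn a b)"
    "act a b (curry Z a b k) = k"
    by (auto simp: curry_def)
qed

lemma act_pre:
  assumes "a \<in> Ob A" "b \<in> Ob A" "h \<in> Ar V" "tgt V h = fob R (expn a b)" "z \<in> Ar V" "tgt V z = src V h"
  shows "act a b (h \<odot>\<^bsub>V\<^esub> z) = act a b h \<odot>\<^bsub>P\<^esub> par P Sp (far W z) (idn P (fob i a))"
  using assms uncurry_pre[of a b "\<epsilon> (expn a b) \<odot>\<^bsub>P\<^esub> far W h" "far W z"] by (simp add: act_def)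

lemma act_post:
  assumes uv: "u \<in> Ar A" "v \<in> Ar A" and h: "h \<in> Ar V" "tgt V h = fob R (expn (tgt A u) (src A v))"
  shows "act (src A u) (tgt A v) (far whom (u, v) \<odot>\<^bsub>V\<^esub> h) =
    far i v \<odot>\<^bsub>P\<^esub> (act (tgt A u) (src A v) h \<odot>\<^bsub>P\<^esub> par P Sp (idn P (fob W (src V h))) (far i u))"
proof -
  \<comment> \<open>Naturality of the counit reduces the action on \<open>R\<close> of the
    exponentials to the action on the exponentials themselves, which \<open>uncurry_post\<close>
    describes.\<close>
  have "\<epsilon> (expn (src A u) (tgt A v)) \<odot>\<^bsub>P\<^esub> far W (far whom (u, v) \<odot>\<^bsub>V\<^esub> h)
      = (\<epsilon> (expn (src A u) (tgt A v)) \<odot>\<^bsub>P\<^esub> far W (far R (far expn_func (u, v)))) \<odot>\<^bsub>P\<^esub> far W h"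
    using assms by (simp add: whom_def)
  also have "\<dots> = far expn_func (u, v) \<odot>\<^bsub>P\<^esub> (\<epsilon> (expn (tgt A u) (src A v)) \<odot>\<^bsub>P\<^esub> far W h)"
    using assms counit_natural[of "far expn_func (u, v)"] by simp
  finally show ?thesis
    using assms by (simp add: act_def uncurry_post)
qed

text \<open>Arrows \<open>W Z \<times> i a \<rightarrow> i b\<close> compose with the parameter \<open>W Z\<close> duplicated. Since \<open>act\<close> is
  injective, the axioms of the enriched category follow from those of this composition.\<close>

lemma enrichment:
  assumes S: "finite_products V S" and terminal: "\<And>t. is_terminal V t \<Longrightarrow> is_terminal P (fob W t)"
  shows "enriches V A whom"
proof -
  interpret V: finite_products V S by fact
  interpret H: is_functor "op_cat A \<times>\<^sub>C A" V whom by (rule whom_functor)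
  have whom_ar [simp]: "far whom (u, v) \<in> Ar V" "src V (far whom (u, v)) = fob R (expn (tgt A u) (src A v))"
    "tgt V (far whom (u, v)) = fob R (expn (src A u) (tgt A v))" if "u \<in> Ar A" "v \<in> Ar A" for u v
    using that H.far_simps[of "(u, v)"] by auto
  let ?H = "\<lambda>a b. fob R (expn a b)"
  \<comment> \<open>Enriched composition represents the composite of the two generic arrows, the
    projections of the product of hom-objects, with the weight of that product duplicated.\<close>
  define m where "m a b c = curry (prd S (?H b c) (?H a b)) a c (act b c (pr1 S (?H b c) (?H a b)) \<odot>\<^bsub>P\<^esub>
      pairing P Sp (pr1 Sp (fob W (prd S (?H b c) (?H a b))) (fob i a)) (act a b (pr2 S (?H b c) (?H a b))))"
    for a b c
  have m [simp]: "m a b c \<in> Ar V" "src V (m a b c) = prd S (?H b c) (?H a b)" "tgt V (m a b c) = ?H a c"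
    and act_m: "act a c (m a b c) = act b c (pr1 S (?H b c) (?H a b)) \<odot>\<^bsub>P\<^esub>
      pairing P Sp (pr1 Sp (fob W (prd S (?H b c) (?H a b))) (fob i a)) (act a b (pr2 S (?H b c) (?H a b)))"
    if "a \<in> Ob A" "b \<in> Ob A" "c \<in> Ob A" for a b c
    using that by (simp_all add: m_def)
  \<comment> \<open>The same description for arbitrary \<open>g\<close> and \<open>h\<close> from a
    common stage. It is all that the remaining laws require of \<open>m\<close>.\<close>
  have act_cmp: "act a c (m a b c \<odot>\<^bsub>V\<^esub> pairing V S g h) =
      act b c g \<odot>\<^bsub>P\<^esub> pairing P Sp (pr1 Sp (fob W (src V h)) (fob i a)) (act a b h)"
    if abc: "a \<in> Ob A" "b \<in> Ob A" "c \<in> Ob A" and g: "g \<in> Ar V" "tgt V g = ?H b c"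
      and h: "h \<in> Ar V" "tgt V h = ?H a b" "src V g = src V h" for a b c g h
  proof -
    have "act a c (m a b c \<odot>\<^bsub>V\<^esub> pairing V S g h) =
        act a c (m a b c) \<odot>\<^bsub>P\<^esub> par P Sp (far W (pairing V S g h)) (idn P (fob i a))"
      using that by (intro act_pre) auto
    also have "\<dots> = act b c (pr1 S (?H b c) (?H a b) \<odot>\<^bsub>V\<^esub> pairing V S g h) \<odot>\<^bsub>P\<^esub>
        pairing P Sp (pr1 Sp (fob W (src V h)) (fob i a)) (act a b (pr2 S (?H b c) (?H a b) \<odot>\<^bsub>V\<^esub> pairing V S g h))"
      using that by (simp add: act_pre act_m par_def del: V.pairing_simps(4,5))
    finally show ?thesis
      using that by simp
  qed
  \<comment> \<open>The name of an ordinary arrow \<open>f\<close> is the arrow over the terminal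
    stage that ignores its parameter and applies \<open>f\<close>.\<close>
  define p where "p f = curry (unt S) (src A f) (tgt A f)
      (far i f \<odot>\<^bsub>P\<^esub> pr2 Sp (fob W (unt S)) (fob i (src A f)))" for f
  have p [simp]: "p f \<in> Ar V" "src V (p f) = unt S" "tgt V (p f) = ?H (src A f) (tgt A f)"
    and act_p: "act (src A f) (tgt A f) (p f) = far i f \<odot>\<^bsub>P\<^esub> pr2 Sp (fob W (unt S)) (fob i (src A f))"
    if "f \<in> Ar A" for f
    using that by (simp_all add: p_def)
  let ?t = "to_terminal V (unt S)"
  have act_pt: "act a b (p f \<odot>\<^bsub>V\<^esub> ?t Z) = far i f \<odot>\<^bsub>P\<^esub> pr2 Sp (fob W Z) (fob i a)"
    if "f \<in> Ar A" "src A f = a" "tgt A f = b" "Z \<in> Ob V" for a b f Z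
    using that act_p[of f] by (auto simp: act_pre par_def)
  have "cartesian_enrichment V S A whom (\<lambda>a. p (idn A a)) m p"
  proof (intro cartesian_enrichment.intro cartesian_enrichment_axioms.intro S i.C.category_axioms whom_functor)
    fix a b c d Hab Hbc Hcd assc
    assume abcd: "a \<in> Ob A" "b \<in> Ob A" "c \<in> Ob A" "d \<in> Ob A"
      and "Hab = fob whom (a, b)" "Hbc = fob whom (b, c)" "Hcd = fob whom (c, d)"
      and assc: "assc = pairing V S (pr1 S Hcd Hbc \<odot>\<^bsub>V\<^esub> pr1 S (prd S Hcd Hbc) Hab)
        (pairing V S (pr2 S Hcd Hbc \<odot>\<^bsub>V\<^esub> pr1 S (prd S Hcd Hbc) Hab) (pr2 S (prd S Hcd Hbc) Hab))"
    then have H: "Hab = ?H a b" "Hbc = ?H b c" "Hcd = ?H c d"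
      by simp_all
    \<comment> \<open>Associativity is tested on the generic triple: \<open>x\<close>,
      \<open>y\<close>, \<open>z\<close> are the three projections from the common stage
      \<open>Z\<close>.\<close>
    define x where "x = pr1 S Hcd Hbc \<odot>\<^bsub>V\<^esub> pr1 S (prd S Hcd Hbc) Hab"
    define y where "y = pr2 S Hcd Hbc \<odot>\<^bsub>V\<^esub> pr1 S (prd S Hcd Hbc) Hab"
    define z where "z = pr2 S (prd S Hcd Hbc) Hab"
    define Z where "Z = prd S (prd S Hcd Hbc) Hab"
    have xyz [simp]: "x \<in> Ar V" "src V x = Z" "tgt V x = ?H c d" "y \<in> Ar V" "src V y = Z" "tgt V y = ?H b c"
      "z \<in> Ar V" "src V z = Z" "tgt V z = ?H a b" "Z \<in> Ob V"
      using abcd by (auto simp: x_def y_def z_def Z_def H)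
    have "m a b d \<odot>\<^bsub>V\<^esub> par V S (m b c d) (idn V Hab) = m a b d \<odot>\<^bsub>V\<^esub> pairing V S (m b c d \<odot>\<^bsub>V\<^esub> pairing V S x y) z"
      using abcd by (simp add: par_def x_def y_def z_def H)
    also have "\<dots> = m a c d \<odot>\<^bsub>V\<^esub> pairing V S x (m a b c \<odot>\<^bsub>V\<^esub> pairing V S y z)"
      by (rule act_inj[where a = a and b = d]) (use abcd in \<open>auto simp: act_cmp\<close>)
    also have "\<dots> = m a c d \<odot>\<^bsub>V\<^esub> (par V S (idn V Hcd) (m a b c) \<odot>\<^bsub>V\<^esub> assc)"
      using abcd unfolding assc x_def[symmetric] y_def[symmetric] z_def[symmetric]
      by (simp add: V.par_cmp_pairing H)
    finally show "m a b d \<odot>\<^bsub>V\<^esub> par V S (m b c d) (idn V Hab) =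
        m a c d \<odot>\<^bsub>V\<^esub> (par V S (idn V Hcd) (m a b c) \<odot>\<^bsub>V\<^esub> assc)" .
  next
    fix a b Hab assume ab: "a \<in> Ob A" "b \<in> Ob A" and "Hab = fob whom (a, b)"
    then have H: "Hab = ?H a b" by simp
    show "m a b b \<odot>\<^bsub>V\<^esub> pairing V S (p (idn A b) \<odot>\<^bsub>V\<^esub> ?t Hab) (idn V Hab) = idn V Hab"
      by (rule act_inj[where a = a and b = b]) (use ab H in \<open>auto simp: act_cmp act_pt\<close>)
    show "m a a b \<odot>\<^bsub>V\<^esub> pairing V S (idn V Hab) (p (idn A a) \<odot>\<^bsub>V\<^esub> ?t Hab) = idn V Hab"
      by (rule act_inj[where a = a and b = b]) (use ab H in \<open>auto simp: act_cmp act_pt\<close>)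
  next
    fix a b assume ab: "a \<in> Ob A" "b \<in> Ob A"
    let ?q = "pr2 Sp (fob W (unt S)) (fob i a)"
    have one: "is_terminal P (fob W (unt S))"
      by (rule terminal) simp
    have pr1: "to_terminal P (fob W (unt S)) (fob i a) \<odot>\<^bsub>P\<^esub> ?q = pr1 Sp (fob W (unt S)) (fob i a)"
      by (rule P.terminal_unique[OF one]) (use ab one in auto)
    have iso: "is_iso P ?q"
      by (rule P.isoI[where g = "pairing P Sp (to_terminal P (fob W (unt S)) (fob i a)) (idn P (fob i a))"])
        (use ab one pr1 in simp_all)
    \<comment> \<open>At the terminal stage the weight is terminal, so the projection
      \<open>?q\<close> is invertible and arrows \<open>W 1 \<times> i a \<rightarrow> i b\<close>
      are just arrows \<open>i a \<rightarrow> i b\<close>. Full faithfulness of \<open>i\<close>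
      does the rest.\<close>
    have "bij_betw (\<lambda>f. far i f \<odot>\<^bsub>P\<^esub> ?q) (hom A a b) (hom P (prd Sp (fob W (unt S)) (fob i a)) (fob i b))"
      using bij_betw_trans[OF fully_faithfulD[OF full ab], of "\<lambda>k. k \<odot>\<^bsub>P\<^esub> ?q"]
        P.bij_betw_pre_iso[OF iso, of "fob i b"] ab by (simp add: comp_def)
    also have "?this \<longleftrightarrow> bij_betw (act a b \<circ> p) (hom A a b) (hom P (prd Sp (fob W (unt S)) (fob i a)) (fob i b))"
      by (rule bij_betw_cong) (auto simp: act_p)
    also have "\<dots> \<longleftrightarrow> bij_betw p (hom A a b) (hom V (unt S) (fob whom (a, b)))"
      by (rule bij_betw_comp_iff2[OF act_bij, symmetric]) (use ab in auto)
    finally show "bij_betw p (hom A a b) (hom V (unt S) (fob whom (a, b)))" .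
  next
    fix f g a b c assume fg: "f \<in> hom A a b" "g \<in> hom A b c"
    then have fg': "f \<in> Ar A" "src A f = a" "tgt A f = b" "g \<in> Ar A" "src A g = b" "tgt A g = c"
      "a \<in> Ob A" "b \<in> Ob A" "c \<in> Ob A"
      by auto
    have "act a c (p (g \<odot>\<^bsub>A\<^esub> f)) = act a c (m a b c \<odot>\<^bsub>V\<^esub> pairing V S (p g) (p f))"
      using fg' act_p[of f] act_p[of g] act_p[of "g \<odot>\<^bsub>A\<^esub> f"] by (simp add: act_cmp)
    then show "p (g \<odot>\<^bsub>A\<^esub> f) = m a b c \<odot>\<^bsub>V\<^esub> pairing V S (p g) (p f)"
      by (rule act_inj) (use fg' in auto)
  next
    fix u v a b a' b' Hab assume uv: "u \<in> hom A a' a" "v \<in> hom A b b'" and "Hab = fob whom (a, b)"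
    then have uv': "u \<in> Ar A" "src A u = a'" "tgt A u = a" "v \<in> Ar A" "src A v = b" "tgt A v = b'"
      "a \<in> Ob A" "b \<in> Ob A" "a' \<in> Ob A" "b' \<in> Ob A" and H: "Hab = ?H a b"
      by auto
    have "act a' b' (far whom (u, v)) = far i v \<odot>\<^bsub>P\<^esub> (act a b (idn V Hab) \<odot>\<^bsub>P\<^esub>
        par P Sp (idn P (fob W Hab)) (far i u))"
      using act_post[of u v "idn V Hab"] uv' H by simp
    also have "\<dots> = act a' b' (m a' a b' \<odot>\<^bsub>V\<^esub> pairing V S
          (m a b b' \<odot>\<^bsub>V\<^esub> pairing V S (p v \<odot>\<^bsub>V\<^esub> ?t Hab) (idn V Hab)) (p u \<odot>\<^bsub>V\<^esub> ?t Hab))"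
      using uv' H by (simp add: act_cmp act_pt par_def)
    finally show "far whom (u, v) = m a' a b' \<odot>\<^bsub>V\<^esub> pairing V S
          (m a b b' \<odot>\<^bsub>V\<^esub> pairing V S (p v \<odot>\<^bsub>V\<^esub> ?t Hab) (idn V Hab)) (p u \<odot>\<^bsub>V\<^esub> ?t Hab)"
      by (rule act_inj) (use uv' H in auto)
  qed auto
  then show ?thesis unfolding enriches_def by blast
qed

end


section \<open>Frobenius laws\<close>

text \<open>Here \<open>f\<close> denotes the substitution functor along an arrow of the base, and
  \<open>L\<close> the left adjoint written \<open>Sig\<close> in a doctrine. The assumption
  concerns the canonical arrow and not merely the existence of some isomorphism.\<close>

locale frobenius_adjunction =
  X: finite_products PX SX + Y: finite_products PY SY + adjunction PX PY L f \<eta> \<epsilon>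
  for PX :: "('p, 'q) cat" and SX and PY :: "('p, 'q) cat" and SY and L f \<eta> \<epsilon> +
  assumes frobenius: "P \<in> Ob PX \<Longrightarrow> Q \<in> Ob PY \<Longrightarrow>
    is_iso PY (pairing PY SY (far L (pr1 SX P (fob f Q)))
      (\<epsilon> Q \<odot>\<^bsub>PY\<^esub> far L (pr2 SX P (fob f Q))))"
begin

definition frob :: "'p \<Rightarrow> 'p \<Rightarrow> 'q" where
  "frob P Q = pairing PY SY (far L (pr1 SX P (fob f Q))) (\<epsilon> Q \<odot>\<^bsub>PY\<^esub> far L (pr2 SX P (fob f Q)))"

lemma frob_simps [simp]:
  assumes "P \<in> Ob PX" "Q \<in> Ob PY"
  shows "frob P Q \<in> Ar PY" "src PY (frob P Q) = fob L (prd SX P (fob f Q))"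
    "tgt PY (frob P Q) = prd SY (fob L P) Q" "is_iso PY (frob P Q)"
  using assms frobenius[OF assms] by (auto simp: frob_def)

lemma frob_natural:
  assumes uv: "u \<in> Ar PX" "v \<in> Ar PY"
  shows "frob (tgt PX u) (tgt PY v) \<odot>\<^bsub>PY\<^esub> far L (par PX SX u (far f v))
    = par PY SY (far L u) v \<odot>\<^bsub>PY\<^esub> frob (src PX u) (src PY v)"
proof -
  let ?p = "par PX SX u (far f v)"
  have 1: "far L (pr1 SX (tgt PX u) (fob f (tgt PY v))) \<odot>\<^bsub>PY\<^esub> far L ?p
      = far L u \<odot>\<^bsub>PY\<^esub> far L (pr1 SX (src PX u) (fob f (src PY v)))"
    using uv left.far_cmp_simp[of ?p "pr1 SX (tgt PX u) (fob f (tgt PY v))"] by (simp add: par_def)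
  have 2: "far L (pr2 SX (tgt PX u) (fob f (tgt PY v))) \<odot>\<^bsub>PY\<^esub> far L ?p
      = far L (far f v) \<odot>\<^bsub>PY\<^esub> far L (pr2 SX (src PX u) (fob f (src PY v)))"
    using uv left.far_cmp_simp[of ?p "pr2 SX (tgt PX u) (fob f (tgt PY v))"] by (simp add: par_def)
  \<comment> \<open>Naturality of the counit, reassociated so that it applies inside right-nested
    composites.\<close>
  have 3: "\<epsilon> (tgt PY v) \<odot>\<^bsub>PY\<^esub> (far L (far f v) \<odot>\<^bsub>PY\<^esub> k) = v \<odot>\<^bsub>PY\<^esub> (\<epsilon> (src PY v) \<odot>\<^bsub>PY\<^esub> k)"
    if "k \<in> Ar PY" "tgt PY k = fob L (fob f (src PY v))" for k
    using uv that counit_natural[of v] Y.cmp_assoc_simp[of k "far L (far f v)" "\<epsilon> (tgt PY v)"] by simp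
  show ?thesis
    using uv by (simp add: frob_def 1 2 3 Y.par_cmp_pairing)
qed

lemma frobenius_natural_iso:
  "naturally_isomorphic (PX \<times>\<^sub>C PY) PY (L \<bullet> product_functor PX SX \<bullet> (id_func \<times>\<^sub>f f))
    (product_functor PY SY \<bullet> (L \<times>\<^sub>f id_func))"
proof (rule naturally_isomorphicI[where \<tau> = "\<lambda>(P, Q). frob P Q"])
  show "is_functor (PX \<times>\<^sub>C PY) PY (L \<bullet> product_functor PX SX \<bullet> (id_func \<times>\<^sub>f f))"
    by (rule is_functor_comp[OF is_functor_comp[OF is_functor_prod[OF is_functor_id[OF X.category_axioms]
        right.is_functor_axioms] X.product_functor] left.is_functor_axioms])
  show "is_functor (PX \<times>\<^sub>C PY) PY (product_functor PY SY \<bullet> (L \<times>\<^sub>f id_func))"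
    by (rule is_functor_comp[OF is_functor_prod[OF left.is_functor_axioms is_functor_id[OF Y.category_axioms]]
        Y.product_functor])
qed (auto simp: frob_natural)

text \<open>Since \<open>W\<close> and \<open>f \<bullet> W'\<close> are isomorphic, uniqueness of
  left adjoints makes \<open>F\<close> isomorphic to \<open>F' \<bullet> L\<close>, and the
  Frobenius isomorphism moves \<open>L\<close> to one factor of the product. The second law is the
  first one conjugated by the symmetry of products.\<close>

lemma meets_natural_iso:
  assumes F: "adjoint_pair PX V F W" and F': "adjoint_pair PY V F' W'"
    and W: "naturally_isomorphic V PX W (f \<bullet> W')"
  shows "naturally_isomorphic (PX \<times>\<^sub>C PY) V (F \<bullet> product_functor PX SX \<bullet> (id_func \<times>\<^sub>f f))
      (F' \<bullet> product_functor PY SY \<bullet> (L \<times>\<^sub>f id_func))"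
    and "naturally_isomorphic (PY \<times>\<^sub>C PX) V (F \<bullet> product_functor PX SX \<bullet> (f \<times>\<^sub>f id_func))
      (F' \<bullet> product_functor PY SY \<bullet> (id_func \<times>\<^sub>f L))"
proof -
  have FL: "naturally_isomorphic PX V F (F' \<bullet> L)"
    by (rule left_adjoint_unique[OF F adjoint_pair_comp[OF adjoint_pair F'] W])
  have X2: "is_functor (PX \<times>\<^sub>C PY) PX (product_functor PX SX \<bullet> (id_func \<times>\<^sub>f f))"
    by (rule is_functor_comp[OF is_functor_prod[OF is_functor_id[OF X.category_axioms]
        right.is_functor_axioms] X.product_functor])
  have "naturally_isomorphic (PX \<times>\<^sub>C PY) V (F \<bullet> product_functor PX SX \<bullet> (id_func \<times>\<^sub>f f))
      (F' \<bullet> L \<bullet> product_functor PX SX \<bullet> (id_func \<times>\<^sub>f f))"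
    using naturally_isomorphic_whisker_right[OF FL X2] by (simp add: comp_func_assoc)
  also have "naturally_isomorphic (PX \<times>\<^sub>C PY) V \<dots> (F' \<bullet> product_functor PY SY \<bullet> (L \<times>\<^sub>f id_func))"
    by (rule naturally_isomorphic_whisker_left[OF frobenius_natural_iso adjoint_pair_functors(1)[OF F']])
  finally show iso: "naturally_isomorphic (PX \<times>\<^sub>C PY) V (F \<bullet> product_functor PX SX \<bullet> (id_func \<times>\<^sub>f f))
      (F' \<bullet> product_functor PY SY \<bullet> (L \<times>\<^sub>f id_func))" .
  have swap: "is_functor (PY \<times>\<^sub>C PX) (PX \<times>\<^sub>C PY) swap_func"
    by (intro swap_func_functor X.category_axioms Y.category_axioms)
  have "naturally_isomorphic (PY \<times>\<^sub>C PX) V (F \<bullet> product_functor PX SX \<bullet> (f \<times>\<^sub>f id_func))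
      (F \<bullet> (product_functor PX SX \<bullet> swap_func) \<bullet> (f \<times>\<^sub>f id_func))"
    by (rule naturally_isomorphic_whisker_left[OF naturally_isomorphic_whisker_right[OF X.product_functor_swap
          is_functor_prod[OF right.is_functor_axioms is_functor_id[OF X.category_axioms]]]
        adjoint_pair_functors(1)[OF F]])
  also have "\<dots> = (F \<bullet> product_functor PX SX \<bullet> (id_func \<times>\<^sub>f f)) \<bullet> swap_func"
    by (simp add: comp_func_assoc prod_func_swap)
  also have "naturally_isomorphic (PY \<times>\<^sub>C PX) V \<dots>
      ((F' \<bullet> product_functor PY SY \<bullet> (L \<times>\<^sub>f id_func)) \<bullet> swap_func)"
    by (rule naturally_isomorphic_whisker_right[OF iso swap])
  also have "\<dots> = F' \<bullet> (product_functor PY SY \<bullet> swap_func) \<bullet> (id_func \<times>\<^sub>f L)"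
    by (simp add: comp_func_assoc prod_func_swap)
  also have "naturally_isomorphic (PY \<times>\<^sub>C PX) V \<dots> (F' \<bullet> product_functor PY SY \<bullet> (id_func \<times>\<^sub>f L))"
    by (rule naturally_isomorphic_whisker_left[OF naturally_isomorphic_whisker_right[OF
          naturally_isomorphic_sym[OF Y.product_functor_swap]
          is_functor_prod[OF is_functor_id[OF Y.category_axioms] left.is_functor_axioms]]
        adjoint_pair_functors(1)[OF F']])
  finally show "naturally_isomorphic (PY \<times>\<^sub>C PX) V (F \<bullet> product_functor PX SX \<bullet> (f \<times>\<^sub>f id_func))
      (F' \<bullet> product_functor PY SY \<bullet> (id_func \<times>\<^sub>f L))" .
qed

end

text \<open>One locale for both mixed laws: \<open>M\<close> is the subcategory onto which
  \<open>Dia\<close> reflects, and \<open>N\<close> is the opposite one. The second law of a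
  doctrine exchanges their roles.\<close>

locale mixed_frobenius_law =
  P: finite_products P S + adjunction P M Dia i \<eta> \<epsilon> + i': is_functor N P i'
  for P :: "('p, 'q) cat" and S and M :: "('m, 'k) cat" and Dia i \<eta> \<epsilon> and N :: "('n, 'l) cat" and i' +
  assumes mixed: "Q \<in> Ob P \<Longrightarrow> n \<in> Ob N \<Longrightarrow> is_iso M (far Dia (par P S (\<eta> Q) (idn P (fob i' n))))"
begin

lemma orthogonal_par_unit:
  assumes "Q \<in> Ob P" "n \<in> Ob N" "m \<in> Ob M"
  shows "orthogonal P (par P S (\<eta> Q) (idn P (fob i' n))) (fob i m)"
  using assms mixed by (intro hom_adjunction.orthogonal_of_iso[OF hom_adjunction]) auto

lemma meets_reflection:
  assumes F: "adjoint_pair P V F W" and W: "naturally_isomorphic V P W (i \<bullet> K)" and K: "is_functor V M K"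
  shows "naturally_isomorphic (P \<times>\<^sub>C N) V (F \<bullet> product_functor P S \<bullet> (id_func \<times>\<^sub>f i'))
      (F \<bullet> product_functor P S \<bullet> ((i \<bullet> Dia) \<times>\<^sub>f i'))"
    and "naturally_isomorphic (N \<times>\<^sub>C P) V (F \<bullet> product_functor P S \<bullet> (i' \<times>\<^sub>f id_func))
      (F \<bullet> product_functor P S \<bullet> (i' \<times>\<^sub>f (i \<bullet> Dia)))"
proof -
  obtain \<phi> where "hom_adjunction P V F W \<phi>" by (rule adjoint_pairE[OF F])
  then interpret F: hom_adjunction P V F W \<phi> .
  interpret K: is_functor V M K by fact
  obtain \<omega> where \<omega>: "\<And>Z. Z \<in> Ob V \<Longrightarrow> is_iso P (\<omega> Z)" "\<And>Z. Z \<in> Ob V \<Longrightarrow> src P (\<omega> Z) = fob i (fob K Z)"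
    "\<And>Z. Z \<in> Ob V \<Longrightarrow> tgt P (\<omega> Z) = fob W Z"
    by (rule naturally_isomorphicE[OF naturally_isomorphic_sym[OF W]]) auto
  \<comment> \<open>Invertibility under \<open>F\<close> is tested by orthogonality to the values of
    \<open>W\<close>, and \<open>W Z\<close> is isomorphic to \<open>fob i (fob K Z)\<close>, for
    which the mixed law gives orthogonality.\<close>
  have iso: "is_iso V (far F (par P S (\<eta> Q) (idn P (fob i' n))))" if "Q \<in> Ob P" "n \<in> Ob N" for Q n
  proof (rule F.iso_of_orthogonal)
    fix Z assume Z: "Z \<in> Ob V"
    have "orthogonal P (par P S (\<eta> Q) (idn P (fob i' n))) (tgt P (\<omega> Z))"
      by (rule P.orthogonal_target_iso) (use Z \<omega> that orthogonal_par_unit in auto)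
    then show "orthogonal P (par P S (\<eta> Q) (idn P (fob i' n))) (fob W Z)"
      using Z \<omega> by simp
  qed (use that in auto)
  have iD: "is_functor P P (i \<bullet> Dia)"
    by (rule is_functor_comp[OF left.is_functor_axioms right.is_functor_axioms])
  have idP: "is_functor P P id_func"
    by (rule is_functor_id[OF P.category_axioms])
  show PN: "naturally_isomorphic (P \<times>\<^sub>C N) V (F \<bullet> product_functor P S \<bullet> (id_func \<times>\<^sub>f i'))
      (F \<bullet> product_functor P S \<bullet> ((i \<bullet> Dia) \<times>\<^sub>f i'))"
  proof (rule naturally_isomorphicI[where \<tau> = "\<lambda>(Q, n). far F (par P S (\<eta> Q) (idn P (fob i' n)))"])
    show "is_functor (P \<times>\<^sub>C N) V (F \<bullet> product_functor P S \<bullet> (id_func \<times>\<^sub>f i'))"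
      by (rule is_functor_comp[OF is_functor_comp[OF is_functor_prod[OF idP i'.is_functor_axioms]
          P.product_functor] adjoint_pair_functors(1)[OF F]])
    show "is_functor (P \<times>\<^sub>C N) V (F \<bullet> product_functor P S \<bullet> ((i \<bullet> Dia) \<times>\<^sub>f i'))"
      by (rule is_functor_comp[OF is_functor_comp[OF is_functor_prod[OF iD i'.is_functor_axioms]
          P.product_functor] adjoint_pair_functors(1)[OF F]])
    fix x assume "x \<in> Ar (P \<times>\<^sub>C N)"
    then obtain u v where x: "x = (u, v)" "u \<in> Ar P" "v \<in> Ar N"
      by (cases x) auto
    have "par P S (\<eta> (tgt P u)) (idn P (fob i' (tgt N v))) \<odot>\<^bsub>P\<^esub> par P S u (far i' v)
        = par P S (far i (far Dia u)) (far i' v) \<odot>\<^bsub>P\<^esub> par P S (\<eta> (src P u)) (idn P (fob i' (src N v)))"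
      using x by (simp add: P.par_cmp unit_natural)
    from arg_cong[OF this, of "far F"] show "(case tgt (P \<times>\<^sub>C N) x of (Q, n) \<Rightarrow> far F (par P S (\<eta> Q) (idn P (fob i' n))))
        \<odot>\<^bsub>V\<^esub> far (F \<bullet> product_functor P S \<bullet> (id_func \<times>\<^sub>f i')) x
        = far (F \<bullet> product_functor P S \<bullet> ((i \<bullet> Dia) \<times>\<^sub>f i')) x \<odot>\<^bsub>V\<^esub>
          (case src (P \<times>\<^sub>C N) x of (Q, n) \<Rightarrow> far F (par P S (\<eta> Q) (idn P (fob i' n))))"
      using x by simp
  qed (use iso in auto)
  have swap: "is_functor (N \<times>\<^sub>C P) (P \<times>\<^sub>C N) swap_func"
    by (intro swap_func_functor i'.C.category_axioms P.category_axioms)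
  \<comment> \<open>Symmetry of the product, once for \<open>G\<close> the identity and once for
    \<open>G\<close> the reflection, carries the first law to the second.\<close>
  have sw: "naturally_isomorphic (N \<times>\<^sub>C P) V (F \<bullet> product_functor P S \<bullet> (i' \<times>\<^sub>f G))
      ((F \<bullet> product_functor P S \<bullet> (G \<times>\<^sub>f i')) \<bullet> swap_func)" if G: "is_functor P P G" for G
  proof -
    have "naturally_isomorphic (N \<times>\<^sub>C P) V (F \<bullet> product_functor P S \<bullet> (i' \<times>\<^sub>f G))
        (F \<bullet> (product_functor P S \<bullet> swap_func) \<bullet> (i' \<times>\<^sub>f G))"
      by (rule naturally_isomorphic_whisker_left[OF naturally_isomorphic_whisker_right[OF P.product_functor_swap
            is_functor_prod[OF i'.is_functor_axioms G]] adjoint_pair_functors(1)[OF F]])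
    then show ?thesis by (simp add: comp_func_assoc prod_func_swap)
  qed
  note sw[OF idP]
  also note naturally_isomorphic_whisker_right[OF PN swap]
  also note naturally_isomorphic_sym[OF sw[OF iD]]
  finally show "naturally_isomorphic (N \<times>\<^sub>C P) V (F \<bullet> product_functor P S \<bullet> (i' \<times>\<^sub>f id_func))
      (F \<bullet> product_functor P S \<bullet> (i' \<times>\<^sub>f (i \<bullet> Dia)))" .
qed

end


section \<open>Change of base for weighted exponentials\<close>

text \<open>\<open>MX\<close> and \<open>MY\<close> are the fibres of either one of the two indexed
  subcategories, with \<open>fM\<close> its substitution functor; both families of laws for
  \<open>nat\<close> are instances.\<close>

locale weighted_change =
  X: weighted_exponentials V PX WX RX \<eta>X \<epsilon>X SX MX iX exX evX +
  Y: weighted_exponentials V PY WY RY \<eta>Y \<epsilon>Y SY MY iY exY evY +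
  f: frobenius_adjunction PX SX PY SY L f \<eta>f \<epsilon>f +
  fM: is_functor MY MX fM
  for V :: "('v, 'w) cat" and PX PY :: "('p, 'q) cat" and MX MY :: "('m, 'k) cat"
    and WX RX \<eta>X \<epsilon>X SX iX exX evX WY RY \<eta>Y \<epsilon>Y SY iY exY evY L f \<eta>f \<epsilon>f fM +
  assumes weight: "naturally_isomorphic V PX WX (f \<bullet> WY)"
    and inclusion: "naturally_isomorphic MY PX (iX \<bullet> fM) (f \<bullet> iY)"
begin

text \<open>Both sides are represented by the arrows \<open>f\<^sup>*(W Z \<times> i M) \<rightarrow> i L\<close>: on the left because \<open>f\<^sup>*\<close>
  preserves products, on the right because \<open>W Z \<times> i M\<close> again lies in the image of \<open>i\<close>, where
  \<open>f\<^sup>*\<close> restricts to a functor with right adjoint \<open>A\<close>.\<close>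

lemma whom_right_adjoint:
  assumes A: "adjoint_pair MY MX fM A" and J: "adjoint_pair PY MY J iY"
    and K: "naturally_isomorphic V PY WY (iY \<bullet> K)" "is_functor V MY K"
  shows "naturally_isomorphic (op_cat MY \<times>\<^sub>C MX) V (X.whom \<bullet> (fM \<times>\<^sub>f id_func)) (Y.whom \<bullet> (id_func \<times>\<^sub>f A))"
proof -
  obtain \<alpha> \<beta> where "adjunction MY MX fM A \<alpha> \<beta>"
    using A unfolding adjoint_pair_def by blast
  then interpret A: adjunction MY MX fM A \<alpha> \<beta> .
  interpret K: is_functor V MY K by fact
  obtain \<omega> where \<omega> [simp]: "\<And>Z. Z \<in> Ob V \<Longrightarrow> is_iso PX (\<omega> Z)"
    "\<And>Z. Z \<in> Ob V \<Longrightarrow> src PX (\<omega> Z) = fob f (fob WY Z)" "\<And>Z. Z \<in> Ob V \<Longrightarrow> tgt PX (\<omega> Z) = fob WX Z"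
    and \<omega>_nat: "\<And>z. z \<in> Ar V \<Longrightarrow> \<omega> (tgt V z) \<odot>\<^bsub>PX\<^esub> far f (far WY z) = far WX z \<odot>\<^bsub>PX\<^esub> \<omega> (src V z)"
    by (rule naturally_isomorphicE[OF naturally_isomorphic_sym[OF weight]]) auto
  obtain \<sigma> where \<sigma> [simp]: "\<And>m. m \<in> Ob MY \<Longrightarrow> is_iso PX (\<sigma> m)"
    "\<And>m. m \<in> Ob MY \<Longrightarrow> src PX (\<sigma> m) = fob f (fob iY m)" "\<And>m. m \<in> Ob MY \<Longrightarrow> tgt PX (\<sigma> m) = fob iX (fob fM m)"
    and \<sigma>_nat: "\<And>u. u \<in> Ar MY \<Longrightarrow> \<sigma> (tgt MY u) \<odot>\<^bsub>PX\<^esub> far f (far iY u) = far iX (far fM u) \<odot>\<^bsub>PX\<^esub> \<sigma> (src MY u)"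
    by (rule naturally_isomorphicE[OF naturally_isomorphic_sym[OF inclusion]]) auto
  have \<omega>_Ar [simp]: "\<omega> Z \<in> Ar PX" if "Z \<in> Ob V" for Z
    using X.P.iso_Ar[OF \<omega>(1)[OF that]] .
  have \<sigma>_Ar [simp]: "\<sigma> m \<in> Ar PX" if "m \<in> Ob MY" for m
    using X.P.iso_Ar[OF \<sigma>(1)[OF that]] .
  let ?pr1 = "\<lambda>Z m. pr1 SY (fob WY Z) (fob iY m)"
  let ?pr2 = "\<lambda>Z m. pr2 SY (fob WY Z) (fob iY m)"
  \<comment> \<open>The comparison from the substituted product to the product of the weight over
    \<open>X\<close> with the substituted object: substitution preserves products, and
    \<open>\<omega>\<close> and \<open>\<sigma>\<close> adjust the two factors.\<close>
  define c where "c Z m = pairing PX SX (\<omega> Z \<odot>\<^bsub>PX\<^esub> far f (?pr1 Z m)) (\<sigma> m \<odot>\<^bsub>PX\<^esub> far f (?pr2 Z m))" for Z m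
  have c [simp]: "c Z m \<in> Ar PX" "src PX (c Z m) = fob f (prd SY (fob WY Z) (fob iY m))"
    "tgt PX (c Z m) = prd SX (fob WX Z) (fob iX (fob fM m))" if "Z \<in> Ob V" "m \<in> Ob MY" for Z m
    using that by (auto simp: c_def)
  have c_iso: "is_iso PX (c Z m)" if "Z \<in> Ob V" "m \<in> Ob MY" for Z m
  proof -
    have "c Z m = par PX SX (\<omega> Z) (\<sigma> m) \<odot>\<^bsub>PX\<^esub> pairing PX SX (far f (?pr1 Z m)) (far f (?pr2 Z m))"
      using that by (simp add: c_def X.P.par_cmp_pairing)
    moreover have "is_iso PX (pairing PX SX (far f (?pr1 Z m)) (far f (?pr2 Z m)))"
      using that by (intro hom_adjunction.right_adjoint_preserves_products[OF f.hom_adjunction]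
          X.P.finite_products_axioms Y.P.finite_products_axioms) auto
    ultimately show ?thesis
      using that by (auto intro!: X.P.iso_cmp X.P.par_iso)
  qed
  have c_nat: "c (tgt V z) (tgt MY u) \<odot>\<^bsub>PX\<^esub> far f (par PY SY (far WY z) (far iY u))
      = par PX SX (far WX z) (far iX (far fM u)) \<odot>\<^bsub>PX\<^esub> c (src V z) (src MY u)"
    if zu: "z \<in> Ar V" "u \<in> Ar MY" for z u
  proof -
    let ?p = "par PY SY (far WY z) (far iY u)"
    have 1: "far f (?pr1 (tgt V z) (tgt MY u)) \<odot>\<^bsub>PX\<^esub> far f ?p = far f (far WY z) \<odot>\<^bsub>PX\<^esub> far f (?pr1 (src V z) (src MY u))"
      using zu f.right.far_cmp_simp[of ?p "?pr1 (tgt V z) (tgt MY u)"] by (simp add: par_def)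
    have 2: "far f (?pr2 (tgt V z) (tgt MY u)) \<odot>\<^bsub>PX\<^esub> far f ?p = far f (far iY u) \<odot>\<^bsub>PX\<^esub> far f (?pr2 (src V z) (src MY u))"
      using zu f.right.far_cmp_simp[of ?p "?pr2 (tgt V z) (tgt MY u)"] by (simp add: par_def)
    have 3: "\<omega> (tgt V z) \<odot>\<^bsub>PX\<^esub> (far f (far WY z) \<odot>\<^bsub>PX\<^esub> k) = far WX z \<odot>\<^bsub>PX\<^esub> (\<omega> (src V z) \<odot>\<^bsub>PX\<^esub> k)"
      if "k \<in> Ar PX" "tgt PX k = fob f (fob WY (src V z))" for k
      using zu that \<omega>_nat[of z] X.P.cmp_assoc_simp[of k "far f (far WY z)" "\<omega> (tgt V z)"] by simp
    have 4: "\<sigma> (tgt MY u) \<odot>\<^bsub>PX\<^esub> (far f (far iY u) \<odot>\<^bsub>PX\<^esub> k) = far iX (far fM u) \<odot>\<^bsub>PX\<^esub> (\<sigma> (src MY u) \<odot>\<^bsub>PX\<^esub> k)"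
      if "k \<in> Ar PX" "tgt PX k = fob f (fob iY (src MY u))" for k
      using zu that \<sigma>_nat[of u] X.P.cmp_assoc_simp[of k "far f (far iY u)" "\<sigma> (tgt MY u)"] by simp
    show ?thesis
      using zu by (simp add: c_def 1 2 3 4 X.P.par_cmp_pairing)
  qed
  \<comment> \<open>The counit of \<open>fM\<close> and \<open>A\<close>, included in
    \<open>PX\<close> and read on the substitute of \<open>iY (A l)\<close> by means of
    \<open>\<sigma>\<close>.\<close>
  define \<kappa> where "\<kappa> l = far iX (\<beta> l) \<odot>\<^bsub>PX\<^esub> \<sigma> (fob A l)" for l
  have \<kappa> [simp]: "\<kappa> l \<in> Ar PX" "src PX (\<kappa> l) = fob f (fob iY (fob A l))" "tgt PX (\<kappa> l) = fob iX l"
    if "l \<in> Ob MX" for l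
    using that by (auto simp: \<kappa>_def)
  have \<kappa>_nat: "\<kappa> (tgt MX v) \<odot>\<^bsub>PX\<^esub> far f (far iY (far A v)) = far iX v \<odot>\<^bsub>PX\<^esub> \<kappa> (src MX v)"
    if v: "v \<in> Ar MX" for v
  proof -
    have "\<kappa> (tgt MX v) \<odot>\<^bsub>PX\<^esub> far f (far iY (far A v))
        = far iX (\<beta> (tgt MX v) \<odot>\<^bsub>MX\<^esub> far fM (far A v)) \<odot>\<^bsub>PX\<^esub> \<sigma> (fob A (src MX v))"
      using v \<sigma>_nat[of "far A v"] by (simp add: \<kappa>_def)
    then show ?thesis
      using v by (simp add: A.counit_natural \<kappa>_def)
  qed
  have \<kappa>_bij: "bij_betw (\<lambda>t. \<kappa> l \<odot>\<^bsub>PX\<^esub> far f t) (hom PY Q (fob iY (fob A l))) (hom PX (fob f Q) (fob iX l))"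
    if l: "l \<in> Ob MX" and s: "is_iso PY s" "src PY s = Q" "tgt PY s = fob iY B" and B: "B \<in> Ob MY" for l s Q B
  proof -
    have sAr: "s \<in> Ar PY" using s by simp
    have Q: "Q \<in> Ob PY" using sAr s(2) by auto
    \<comment> \<open>For an object in the image of \<open>iY\<close>, substituting and then
      composing with \<open>\<kappa> l\<close> is the transposition for \<open>fM\<close> and
      \<open>A\<close>, transported along the two full embeddings and
      \<open>\<sigma> B\<close>.\<close>
    have "bij_betw ((\<lambda>k. k \<odot>\<^bsub>PX\<^esub> \<sigma> B) \<circ> (far iX \<circ> (\<lambda>n. \<beta> l \<odot>\<^bsub>MX\<^esub> far fM n)))
        (hom MY B (fob A l)) (hom PX (fob f (fob iY B)) (fob iX l))"
    proof (rule bij_betw_trans[OF bij_betw_trans])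
      show "bij_betw (\<lambda>n. \<beta> l \<odot>\<^bsub>MX\<^esub> far fM n) (hom MY B (fob A l)) (hom MX (fob fM B) l)"
        by (rule A.counit_bij[OF B l])
      show "bij_betw (far iX) (hom MX (fob fM B) l) (hom PX (fob iX (fob fM B)) (fob iX l))"
        using B l by (intro fully_faithfulD[OF X.full]) auto
      show "bij_betw (\<lambda>k. k \<odot>\<^bsub>PX\<^esub> \<sigma> B) (hom PX (fob iX (fob fM B)) (fob iX l)) (hom PX (fob f (fob iY B)) (fob iX l))"
        using B l X.P.bij_betw_pre_iso[of "\<sigma> B" "fob iX l"] by simp
    qed
    also have "?this \<longleftrightarrow> bij_betw (\<lambda>t. \<kappa> l \<odot>\<^bsub>PX\<^esub> far f t) (hom PY (fob iY B) (fob iY (fob A l)))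
        (hom PX (fob f (fob iY B)) (fob iX l))"
    proof (rule bij_betw_square[where a = "far iY" and b = id])
      show "bij_betw (far iY) (hom MY B (fob A l)) (hom PY (fob iY B) (fob iY (fob A l)))"
        using B l by (intro fully_faithfulD[OF Y.full]) auto
      show "\<kappa> l \<odot>\<^bsub>PX\<^esub> far f (far iY n) = id (((\<lambda>k. k \<odot>\<^bsub>PX\<^esub> \<sigma> B) \<circ> (far iX \<circ> (\<lambda>n. \<beta> l \<odot>\<^bsub>MX\<^esub> far fM n))) n)"
        if "n \<in> hom MY B (fob A l)" for n
        using that \<sigma>_nat[of n] B l by (auto simp: \<kappa>_def)
    qed (use B l in auto)
    \<comment> \<open>From \<open>iY B\<close> to the isomorphic object \<open>Q\<close>, by
      precomposing with \<open>s\<close> on one side and with its substitute on the other.\<close>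
    also have "\<dots> \<longleftrightarrow> bij_betw (\<lambda>t. \<kappa> l \<odot>\<^bsub>PX\<^esub> far f t) (hom PY Q (fob iY (fob A l))) (hom PX (fob f Q) (fob iX l))"
    proof (rule bij_betw_square[where a = "\<lambda>t. t \<odot>\<^bsub>PY\<^esub> s" and b = "\<lambda>t. t \<odot>\<^bsub>PX\<^esub> far f s"])
      show "bij_betw (\<lambda>t. t \<odot>\<^bsub>PY\<^esub> s) (hom PY (fob iY B) (fob iY (fob A l))) (hom PY Q (fob iY (fob A l)))"
        using Y.P.bij_betw_pre_iso[OF s(1), of "fob iY (fob A l)"] s l by simp
      show "bij_betw (\<lambda>t. t \<odot>\<^bsub>PX\<^esub> far f s) (hom PX (fob f (fob iY B)) (fob iX l)) (hom PX (fob f Q) (fob iX l))"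
        using X.P.bij_betw_pre_iso[OF f.right.far_iso[OF s(1)], of "fob iX l"] s sAr l by simp
    qed (use B l s sAr Q in auto)
    finally show ?thesis .
  qed
  obtain \<phi> where "hom_adjunction PY MY J iY \<phi>" by (rule adjoint_pairE[OF J])
  then interpret J: hom_adjunction PY MY J iY \<phi> .
  obtain \<theta> where \<theta> [simp]: "\<And>Z. Z \<in> Ob V \<Longrightarrow> is_iso PY (\<theta> Z)"
    "\<And>Z. Z \<in> Ob V \<Longrightarrow> src PY (\<theta> Z) = fob WY Z" "\<And>Z. Z \<in> Ob V \<Longrightarrow> tgt PY (\<theta> Z) = fob iY (fob K Z)"
    by (rule naturally_isomorphicE[OF K(1)]) auto
  have \<kappa>_bij': "bij_betw (\<lambda>t. \<kappa> l \<odot>\<^bsub>PX\<^esub> far f t) (hom PY (prd SY (fob WY Z) (fob iY m)) (fob iY (fob A l)))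
      (hom PX (fob f (prd SY (fob WY Z) (fob iY m))) (fob iX l))"
    if Z: "Z \<in> Ob V" and m: "m \<in> Ob MY" and l: "l \<in> Ob MX" for Z m l
  proof -
    \<comment> \<open>The weight is replaced by \<open>iY (K Z)\<close>; then the unit at a product
      of two objects of the reflective subcategory is the required isomorphism into the image of
      \<open>iY\<close>.\<close>
    obtain s where s: "is_iso PY s" "src PY s = prd SY (fob iY (fob K Z)) (fob iY m)"
      "tgt PY s = fob iY (fob J (prd SY (fob iY (fob K Z)) (fob iY m)))"
      by (rule J.reflective_product[OF Y.full Y.P.finite_products_axioms, of "fob K Z" m]) (use Z m in auto)
    have \<theta>Ar: "\<theta> Z \<in> Ar PY" and sAr: "s \<in> Ar PY"
      using \<theta>(1)[OF Z] s(1) by (simp_all del: \<theta>)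
    have "is_iso PY (s \<odot>\<^bsub>PY\<^esub> par PY SY (\<theta> Z) (idn PY (fob iY m)))"
      using Z m s \<theta>Ar by (intro Y.P.iso_cmp Y.P.par_iso) auto
    then show ?thesis
      by (rule \<kappa>_bij[where B = "fob J (prd SY (fob iY (fob K Z)) (fob iY m))", OF l]) (use Z m s \<theta>Ar sAr in auto)
  qed
  have id_op: "is_functor (op_cat MY) (op_cat MY) id_func"
    by (rule is_functor_id[OF category_op[OF Y.i.C.category_axioms]])
  have id_MX: "is_functor MX MX id_func"
    by (rule is_functor_id[OF X.i.C.category_axioms])
  show ?thesis
  proof (rule naturally_isomorphic_by_representation[where
        S = "\<lambda>Z (m, l). hom PX (fob f (prd SY (fob WY Z) (fob iY m))) (fob iX l)"
        and \<Xi> = "\<lambda>Z (m, l) h. X.act (fob fM m) l h \<odot>\<^bsub>PX\<^esub> c Z m"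
        and \<Psi> = "\<lambda>Z (m, l) g. \<kappa> l \<odot>\<^bsub>PX\<^esub> far f (Y.act m (fob A l) g)"
        and p = "\<lambda>z (m, l) t. t \<odot>\<^bsub>PX\<^esub> far f (par PY SY (far WY z) (idn PY (fob iY m)))"
        and q = "\<lambda>Z (u, v) t. far iX v \<odot>\<^bsub>PX\<^esub> (t \<odot>\<^bsub>PX\<^esub> far f (par PY SY (idn PY (fob WY Z)) (far iY u)))"])
    show "is_functor (op_cat MY \<times>\<^sub>C MX) V (X.whom \<bullet> (fM \<times>\<^sub>f id_func))"
      by (rule is_functor_comp[OF is_functor_prod[OF is_functor_op[OF fM.is_functor_axioms] id_MX] X.whom_functor])
    show "is_functor (op_cat MY \<times>\<^sub>C MX) V (Y.whom \<bullet> (id_func \<times>\<^sub>f A))"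
      by (rule is_functor_comp[OF is_functor_prod[OF id_op A.right.is_functor_axioms] Y.whom_functor])
  next
    fix Z x assume Z: "Z \<in> Ob V" and "x \<in> Ob (op_cat MY \<times>\<^sub>C MX)"
    then obtain m l where x: "x = (m, l)" "m \<in> Ob MY" "l \<in> Ob MX"
      by (cases x) auto
    have "bij_betw ((\<lambda>k. k \<odot>\<^bsub>PX\<^esub> c Z m) \<circ> X.act (fob fM m) l) (hom V Z (fob X.whom (fob fM m, l)))
        (hom PX (fob f (prd SY (fob WY Z) (fob iY m))) (fob iX l))"
      by (rule bij_betw_trans[OF X.act_bij])
        (use x Z X.P.bij_betw_pre_iso[OF c_iso[of Z m], of "fob iX l"] in auto)
    then show "bij_betw ((\<lambda>(m, l) h. X.act (fob fM m) l h \<odot>\<^bsub>PX\<^esub> c Z m) x)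
        (hom V Z (fob (X.whom \<bullet> (fM \<times>\<^sub>f id_func)) x))
        (case x of (m, l) \<Rightarrow> hom PX (fob f (prd SY (fob WY Z) (fob iY m))) (fob iX l))"
      using x by (simp add: comp_def)
    have "bij_betw ((\<lambda>t. \<kappa> l \<odot>\<^bsub>PX\<^esub> far f t) \<circ> Y.act m (fob A l)) (hom V Z (fob Y.whom (m, fob A l)))
        (hom PX (fob f (prd SY (fob WY Z) (fob iY m))) (fob iX l))"
      by (rule bij_betw_trans[OF Y.act_bij \<kappa>_bij']) (use x Z in auto)
    then show "bij_betw ((\<lambda>(m, l) g. \<kappa> l \<odot>\<^bsub>PX\<^esub> far f (Y.act m (fob A l) g)) x)
        (hom V Z (fob (Y.whom \<bullet> (id_func \<times>\<^sub>f A)) x))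
        (case x of (m, l) \<Rightarrow> hom PX (fob f (prd SY (fob WY Z) (fob iY m))) (fob iX l))"
      using x by (simp add: comp_def)
  next
    fix z h x assume z: "z \<in> Ar V" "tgt V z = src V h" and h: "h \<in> Ar V" and "x \<in> Ob (op_cat MY \<times>\<^sub>C MX)"
      and tgt: "tgt V h = fob (X.whom \<bullet> (fM \<times>\<^sub>f id_func)) x"
    then obtain m l where x: "x = (m, l)" "m \<in> Ob MY" "l \<in> Ob MX"
      by (cases x) auto
    then show "(case x of (m, l) \<Rightarrow> \<lambda>h. X.act (fob fM m) l h \<odot>\<^bsub>PX\<^esub> c (src V z) m) (h \<odot>\<^bsub>V\<^esub> z) =
        (case x of (m, l) \<Rightarrow> \<lambda>t. t \<odot>\<^bsub>PX\<^esub> far f (par PY SY (far WY z) (idn PY (fob iY m))))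
          ((case x of (m, l) \<Rightarrow> \<lambda>h. X.act (fob fM m) l h \<odot>\<^bsub>PX\<^esub> c (tgt V z) m) h)"
      using z h tgt c_nat[of z "idn MY m"] by (simp add: X.act_pre)
  next
    fix z h x assume z: "z \<in> Ar V" "tgt V z = src V h" and h: "h \<in> Ar V" and "x \<in> Ob (op_cat MY \<times>\<^sub>C MX)"
      and tgt: "tgt V h = fob (Y.whom \<bullet> (id_func \<times>\<^sub>f A)) x"
    then obtain m l where x: "x = (m, l)" "m \<in> Ob MY" "l \<in> Ob MX"
      by (cases x) auto
    then show "(case x of (m, l) \<Rightarrow> \<lambda>g. \<kappa> l \<odot>\<^bsub>PX\<^esub> far f (Y.act m (fob A l) g)) (h \<odot>\<^bsub>V\<^esub> z) =
        (case x of (m, l) \<Rightarrow> \<lambda>t. t \<odot>\<^bsub>PX\<^esub> far f (par PY SY (far WY z) (idn PY (fob iY m))))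
          ((case x of (m, l) \<Rightarrow> \<lambda>g. \<kappa> l \<odot>\<^bsub>PX\<^esub> far f (Y.act m (fob A l) g)) h)"
      using z h tgt by (simp add: Y.act_pre)
  next
    fix x h assume "x \<in> Ar (op_cat MY \<times>\<^sub>C MX)" and h: "h \<in> Ar V"
      and tgt: "tgt V h = fob (X.whom \<bullet> (fM \<times>\<^sub>f id_func)) (src (op_cat MY \<times>\<^sub>C MX) x)"
    then obtain u v where x: "x = (u, v)" "u \<in> Ar MY" "v \<in> Ar MX"
      by (cases x) auto
    then show "(case tgt (op_cat MY \<times>\<^sub>C MX) x of (m, l) \<Rightarrow> \<lambda>h'. X.act (fob fM m) l h' \<odot>\<^bsub>PX\<^esub> c (src V h) m)
        (far (X.whom \<bullet> (fM \<times>\<^sub>f id_func)) x \<odot>\<^bsub>V\<^esub> h) =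
        (case x of (u, v) \<Rightarrow> \<lambda>t. far iX v \<odot>\<^bsub>PX\<^esub> (t \<odot>\<^bsub>PX\<^esub> far f (par PY SY (idn PY (fob WY (src V h))) (far iY u))))
          ((case src (op_cat MY \<times>\<^sub>C MX) x of (m, l) \<Rightarrow> \<lambda>h'. X.act (fob fM m) l h' \<odot>\<^bsub>PX\<^esub> c (src V h) m) h)"
      using h tgt c_nat[of "idn V (src V h)" u] X.act_post[of "far fM u" v h] by simp
  next
    fix x h assume "x \<in> Ar (op_cat MY \<times>\<^sub>C MX)" and h: "h \<in> Ar V"
      and tgt: "tgt V h = fob (Y.whom \<bullet> (id_func \<times>\<^sub>f A)) (src (op_cat MY \<times>\<^sub>C MX) x)"
    then obtain u v where x: "x = (u, v)" "u \<in> Ar MY" "v \<in> Ar MX"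
      by (cases x) auto
    have "\<kappa> (tgt MX v) \<odot>\<^bsub>PX\<^esub> (far f (far iY (far A v)) \<odot>\<^bsub>PX\<^esub> k) = far iX v \<odot>\<^bsub>PX\<^esub> (\<kappa> (src MX v) \<odot>\<^bsub>PX\<^esub> k)"
      if "k \<in> Ar PX" "tgt PX k = fob f (fob iY (fob A (src MX v)))" for k
      using x that \<kappa>_nat[of v] X.P.cmp_assoc_simp[of k "far f (far iY (far A v))" "\<kappa> (tgt MX v)"] by simp
    then show "(case tgt (op_cat MY \<times>\<^sub>C MX) x of (m, l) \<Rightarrow> \<lambda>g. \<kappa> l \<odot>\<^bsub>PX\<^esub> far f (Y.act m (fob A l) g))
        (far (Y.whom \<bullet> (id_func \<times>\<^sub>f A)) x \<odot>\<^bsub>V\<^esub> h) =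
        (case x of (u, v) \<Rightarrow> \<lambda>t. far iX v \<odot>\<^bsub>PX\<^esub> (t \<odot>\<^bsub>PX\<^esub> far f (par PY SY (idn PY (fob WY (src V h))) (far iY u))))
          ((case src (op_cat MY \<times>\<^sub>C MX) x of (m, l) \<Rightarrow> \<lambda>g. \<kappa> l \<odot>\<^bsub>PX\<^esub> far f (Y.act m (fob A l) g)) h)"
      using x h tgt Y.act_post[of u "far A v" h] by simp
  qed
qed

text \<open>Here both sides are represented by the arrows \<open>i L \<times> f\<^sup>*(W Z) \<rightarrow> f\<^sup>*(i M)\<close>: by the Frobenius law
  their transposes are arrows \<open>\<Sigma>\<^sub>f(i L) \<times> W Z \<rightarrow> i M\<close>, and by the mixed law these factor uniquely
  through the unit \<open>\<Sigma>\<^sub>f(i L) \<rightarrow> i J(\<Sigma>\<^sub>f(i L))\<close>.\<close>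

lemma whom_left_adjoint:
  assumes J: "adjunction PY MY J iY \<eta>J \<epsilon>J"
    and orth: "\<And>Q Z m. Q \<in> Ob PY \<Longrightarrow> Z \<in> Ob V \<Longrightarrow> m \<in> Ob MY \<Longrightarrow>
      orthogonal PY (par PY SY (\<eta>J Q) (idn PY (fob WY Z))) (fob iY m)"
  shows "naturally_isomorphic (op_cat MX \<times>\<^sub>C MY) V (X.whom \<bullet> (id_func \<times>\<^sub>f fM))
    (Y.whom \<bullet> ((J \<bullet> L \<bullet> iX) \<times>\<^sub>f id_func))"
proof -
  interpret J: adjunction PY MY J iY \<eta>J \<epsilon>J by fact
  obtain \<phi> where "hom_adjunction PX PY L f \<phi>" by (rule adjoint_pairE[OF f.adjoint_pair])
  then interpret \<phi>: hom_adjunction PX PY L f \<phi> .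
  obtain \<omega> where \<omega> [simp]: "\<And>Z. Z \<in> Ob V \<Longrightarrow> is_iso PX (\<omega> Z)"
    "\<And>Z. Z \<in> Ob V \<Longrightarrow> src PX (\<omega> Z) = fob f (fob WY Z)" "\<And>Z. Z \<in> Ob V \<Longrightarrow> tgt PX (\<omega> Z) = fob WX Z"
    and \<omega>_nat: "\<And>z. z \<in> Ar V \<Longrightarrow> \<omega> (tgt V z) \<odot>\<^bsub>PX\<^esub> far f (far WY z) = far WX z \<odot>\<^bsub>PX\<^esub> \<omega> (src V z)"
    by (rule naturally_isomorphicE[OF naturally_isomorphic_sym[OF weight]]) auto
  obtain \<sigma> where \<sigma> [simp]: "\<And>m. m \<in> Ob MY \<Longrightarrow> is_iso PX (\<sigma> m)"
    "\<And>m. m \<in> Ob MY \<Longrightarrow> src PX (\<sigma> m) = fob iX (fob fM m)" "\<And>m. m \<in> Ob MY \<Longrightarrow> tgt PX (\<sigma> m) = fob f (fob iY m)"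
    and \<sigma>_nat: "\<And>u. u \<in> Ar MY \<Longrightarrow> \<sigma> (tgt MY u) \<odot>\<^bsub>PX\<^esub> far iX (far fM u) = far f (far iY u) \<odot>\<^bsub>PX\<^esub> \<sigma> (src MY u)"
    by (rule naturally_isomorphicE[OF inclusion]) auto
  have \<omega>_Ar [simp]: "\<omega> Z \<in> Ar PX" if "Z \<in> Ob V" for Z
    using X.P.iso_Ar[OF \<omega>(1)[OF that]] .
  have \<sigma>_Ar [simp]: "\<sigma> m \<in> Ar PX" if "m \<in> Ob MY" for m
    using X.P.iso_Ar[OF \<sigma>(1)[OF that]] .
  let ?Q = "\<lambda>Z l. prd SX (fob iX l) (fob f (fob WY Z))"
  \<comment> \<open>The factors are exchanged because \<open>frob\<close> expects the object of
    \<open>PX\<close> first, whereas \<open>act\<close> has the weight first.\<close>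
  define d where "d Z l = pairing PX SX (\<omega> Z \<odot>\<^bsub>PX\<^esub> pr2 SX (fob iX l) (fob f (fob WY Z)))
    (pr1 SX (fob iX l) (fob f (fob WY Z)))" for Z l
  have d [simp]: "d Z l \<in> Ar PX" "src PX (d Z l) = ?Q Z l" "tgt PX (d Z l) = prd SX (fob WX Z) (fob iX l)"
    if "Z \<in> Ob V" "l \<in> Ob MX" for Z l
    using that by (auto simp: d_def)
  have d_iso: "is_iso PX (d Z l)" if "Z \<in> Ob V" "l \<in> Ob MX" for Z l
  proof -
    have "d Z l = par PX SX (\<omega> Z) (idn PX (fob iX l)) \<odot>\<^bsub>PX\<^esub> X.P.swap (fob iX l) (fob f (fob WY Z))"
      using that by (simp add: d_def X.P.swap_def X.P.par_cmp_pairing)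
    then show ?thesis
      using that by (auto intro!: X.P.iso_cmp X.P.par_iso)
  qed
  have d_nat: "d (tgt V z) (tgt MX u) \<odot>\<^bsub>PX\<^esub> par PX SX (far iX u) (far f (far WY z))
      = par PX SX (far WX z) (far iX u) \<odot>\<^bsub>PX\<^esub> d (src V z) (src MX u)"
    if zu: "z \<in> Ar V" "u \<in> Ar MX" for z u
  proof -
    have "\<omega> (tgt V z) \<odot>\<^bsub>PX\<^esub> (far f (far WY z) \<odot>\<^bsub>PX\<^esub> k) = far WX z \<odot>\<^bsub>PX\<^esub> (\<omega> (src V z) \<odot>\<^bsub>PX\<^esub> k)"
      if "k \<in> Ar PX" "tgt PX k = fob f (fob WY (src V z))" for k
      using zu that \<omega>_nat[of z] X.P.cmp_assoc_simp[of k "far f (far WY z)" "\<omega> (tgt V z)"] by simp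
    then show ?thesis
      using zu by (simp add: d_def par_def)
  qed
  let ?E = "J \<bullet> L \<bullet> iX"
  have E: "is_functor MX MY ?E"
    by (rule is_functor_comp[OF is_functor_comp[OF X.i.is_functor_axioms f.left.is_functor_axioms]
        J.left.is_functor_axioms])
  let ?par = "\<lambda>Z l. par PY SY (\<eta>J (fob L (fob iX l))) (idn PY (fob WY Z))"
  let ?swap = "\<lambda>Z l. Y.P.swap (fob iY (fob ?E l)) (fob WY Z)"
  \<comment> \<open>The Frobenius isomorphism, then the unit of \<open>J\<close> on the first
    factor, then the exchange that puts the weight first.\<close>
  define n where "n Z l = ?swap Z l \<odot>\<^bsub>PY\<^esub> (?par Z l \<odot>\<^bsub>PY\<^esub> f.frob (fob iX l) (fob WY Z))" for Z l
  have n [simp]: "n Z l \<in> Ar PY" "src PY (n Z l) = fob L (?Q Z l)"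
    "tgt PY (n Z l) = prd SY (fob WY Z) (fob iY (fob ?E l))" if "Z \<in> Ob V" "l \<in> Ob MX" for Z l
    using that by (auto simp: n_def)
  \<comment> \<open>Of the three factors of \<open>n Z l\<close>, the outer two are isomorphisms,
    and the middle one is orthogonal to \<open>iY m\<close> by \<open>orth\<close>.\<close>
  have n_orth: "orthogonal PY (n Z l) (fob iY m)" if "Z \<in> Ob V" "l \<in> Ob MX" "m \<in> Ob MY" for Z l m
    unfolding n_def using that
    by (intro Y.P.orthogonal_cmp[OF Y.P.orthogonal_cmp[OF Y.P.orthogonal_iso orth] Y.P.orthogonal_iso]) auto
  have n_nat: "n (tgt V z) (tgt MX u) \<odot>\<^bsub>PY\<^esub> far L (par PX SX (far iX u) (far f (far WY z)))
      = par PY SY (far WY z) (far iY (far ?E u)) \<odot>\<^bsub>PY\<^esub> n (src V z) (src MX u)"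
    if zu: "z \<in> Ar V" "u \<in> Ar MX" for z u
  proof -
    have 1: "f.frob (fob iX (tgt MX u)) (fob WY (tgt V z)) \<odot>\<^bsub>PY\<^esub> far L (par PX SX (far iX u) (far f (far WY z)))
        = par PY SY (far L (far iX u)) (far WY z) \<odot>\<^bsub>PY\<^esub> f.frob (fob iX (src MX u)) (fob WY (src V z))"
      using zu f.frob_natural[of "far iX u" "far WY z"] by simp
    have par: "?par (tgt V z) (tgt MX u) \<odot>\<^bsub>PY\<^esub> par PY SY (far L (far iX u)) (far WY z)
        = par PY SY (far iY (far ?E u)) (far WY z) \<odot>\<^bsub>PY\<^esub> ?par (src V z) (src MX u)"
      using zu J.unit_natural[of "far L (far iX u)"] by (simp add: Y.P.par_cmp)
    have 2: "?par (tgt V z) (tgt MX u) \<odot>\<^bsub>PY\<^esub> (par PY SY (far L (far iX u)) (far WY z) \<odot>\<^bsub>PY\<^esub> k)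
        = par PY SY (far iY (far ?E u)) (far WY z) \<odot>\<^bsub>PY\<^esub> (?par (src V z) (src MX u) \<odot>\<^bsub>PY\<^esub> k)"
      if "k \<in> Ar PY" "tgt PY k = prd SY (fob L (fob iX (src MX u))) (fob WY (src V z))" for k
      using zu that par Y.P.cmp_assoc_simp[of k "par PY SY (far L (far iX u)) (far WY z)" "?par (tgt V z) (tgt MX u)"]
      by simp
    have 3: "?swap (tgt V z) (tgt MX u) \<odot>\<^bsub>PY\<^esub> (par PY SY (far iY (far ?E u)) (far WY z) \<odot>\<^bsub>PY\<^esub> k)
        = par PY SY (far WY z) (far iY (far ?E u)) \<odot>\<^bsub>PY\<^esub> (?swap (src V z) (src MX u) \<odot>\<^bsub>PY\<^esub> k)"
      if "k \<in> Ar PY" "tgt PY k = prd SY (fob iY (fob ?E (src MX u))) (fob WY (src V z))" for k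
      using zu that Y.P.swap_par[of "far iY (far ?E u)" "far WY z"]
        Y.P.cmp_assoc_simp[of k "par PY SY (far iY (far ?E u)) (far WY z)" "?swap (tgt V z) (tgt MX u)"]
      by simp
    have "n (tgt V z) (tgt MX u) \<odot>\<^bsub>PY\<^esub> far L (par PX SX (far iX u) (far f (far WY z)))
        = ?swap (tgt V z) (tgt MX u) \<odot>\<^bsub>PY\<^esub> (?par (tgt V z) (tgt MX u) \<odot>\<^bsub>PY\<^esub>
          (f.frob (fob iX (tgt MX u)) (fob WY (tgt V z)) \<odot>\<^bsub>PY\<^esub> far L (par PX SX (far iX u) (far f (far WY z)))))"
      using zu by (simp add: n_def)
    also have "\<dots> = par PY SY (far WY z) (far iY (far ?E u)) \<odot>\<^bsub>PY\<^esub> n (src V z) (src MX u)"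
      unfolding 1 using zu 2 3 by (simp add: n_def)
    finally show ?thesis .
  qed
  have id_op: "is_functor (op_cat MX) (op_cat MX) id_func"
    by (rule is_functor_id[OF category_op[OF X.i.C.category_axioms]])
  have id_MY: "is_functor MY MY id_func"
    by (rule is_functor_id[OF Y.i.C.category_axioms])
  show ?thesis
  proof (rule naturally_isomorphic_by_representation[where
        S = "\<lambda>Z (l, m). hom PX (?Q Z l) (fob f (fob iY m))"
        and \<Xi> = "\<lambda>Z (l, m) h. \<sigma> m \<odot>\<^bsub>PX\<^esub> (X.act l (fob fM m) h \<odot>\<^bsub>PX\<^esub> d Z l)"
        and \<Psi> = "\<lambda>Z (l, m) g. \<phi> (?Q Z l) (Y.act (fob ?E l) m g \<odot>\<^bsub>PY\<^esub> n Z l)"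
        and p = "\<lambda>z (l, m) t. t \<odot>\<^bsub>PX\<^esub> par PX SX (idn PX (fob iX l)) (far f (far WY z))"
        and q = "\<lambda>Z (u, v) t. far f (far iY v) \<odot>\<^bsub>PX\<^esub> (t \<odot>\<^bsub>PX\<^esub> par PX SX (far iX u) (idn PX (fob f (fob WY Z))))"])
    show "is_functor (op_cat MX \<times>\<^sub>C MY) V (X.whom \<bullet> (id_func \<times>\<^sub>f fM))"
      by (rule is_functor_comp[OF is_functor_prod[OF id_op fM.is_functor_axioms] X.whom_functor])
    show "is_functor (op_cat MX \<times>\<^sub>C MY) V (Y.whom \<bullet> (?E \<times>\<^sub>f id_func))"
      by (rule is_functor_comp[OF is_functor_prod[OF is_functor_op[OF E] id_MY] Y.whom_functor])
  next
    fix Z x assume Z: "Z \<in> Ob V" and "x \<in> Ob (op_cat MX \<times>\<^sub>C MY)"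
    then obtain l m where x: "x = (l, m)" "l \<in> Ob MX" "m \<in> Ob MY"
      by (cases x) auto
    have "bij_betw ((\<lambda>k. \<sigma> m \<odot>\<^bsub>PX\<^esub> k) \<circ> ((\<lambda>k. k \<odot>\<^bsub>PX\<^esub> d Z l) \<circ> X.act l (fob fM m)))
        (hom V Z (fob X.whom (l, fob fM m))) (hom PX (?Q Z l) (fob f (fob iY m)))"
    proof (rule bij_betw_trans[OF bij_betw_trans])
      show "bij_betw (X.act l (fob fM m)) (hom V Z (fob X.whom (l, fob fM m)))
          (hom PX (prd SX (fob WX Z) (fob iX l)) (fob iX (fob fM m)))"
        using x Z by (intro X.act_bij) auto
      show "bij_betw (\<lambda>k. k \<odot>\<^bsub>PX\<^esub> d Z l) (hom PX (prd SX (fob WX Z) (fob iX l)) (fob iX (fob fM m)))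
          (hom PX (?Q Z l) (fob iX (fob fM m)))"
        using x Z X.P.bij_betw_pre_iso[OF d_iso[of Z l], of "fob iX (fob fM m)"] by simp
      show "bij_betw (\<lambda>k. \<sigma> m \<odot>\<^bsub>PX\<^esub> k) (hom PX (?Q Z l) (fob iX (fob fM m))) (hom PX (?Q Z l) (fob f (fob iY m)))"
        using x Z X.P.bij_betw_post_iso[of "\<sigma> m" "?Q Z l"] by simp
    qed
    then show "bij_betw ((\<lambda>(l, m) h. \<sigma> m \<odot>\<^bsub>PX\<^esub> (X.act l (fob fM m) h \<odot>\<^bsub>PX\<^esub> d Z l)) x)
        (hom V Z (fob (X.whom \<bullet> (id_func \<times>\<^sub>f fM)) x))
        (case x of (l, m) \<Rightarrow> hom PX (?Q Z l) (fob f (fob iY m)))"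
      using x by (simp add: comp_def)
    have "bij_betw (\<phi> (?Q Z l) \<circ> ((\<lambda>k. k \<odot>\<^bsub>PY\<^esub> n Z l) \<circ> Y.act (fob ?E l) m))
        (hom V Z (fob Y.whom (fob ?E l, m))) (hom PX (?Q Z l) (fob f (fob iY m)))"
    proof (rule bij_betw_trans[OF bij_betw_trans])
      show "bij_betw (Y.act (fob ?E l) m) (hom V Z (fob Y.whom (fob ?E l, m)))
          (hom PY (prd SY (fob WY Z) (fob iY (fob ?E l))) (fob iY m))"
        using x Z by (intro Y.act_bij) auto
      show "bij_betw (\<lambda>k. k \<odot>\<^bsub>PY\<^esub> n Z l) (hom PY (prd SY (fob WY Z) (fob iY (fob ?E l))) (fob iY m))
          (hom PY (fob L (?Q Z l)) (fob iY m))"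
        using x Z n_orth[of Z l m] by (simp add: orthogonal_def)
      show "bij_betw (\<phi> (?Q Z l)) (hom PY (fob L (?Q Z l)) (fob iY m)) (hom PX (?Q Z l) (fob f (fob iY m)))"
        using x Z by (intro \<phi>.bij) auto
    qed
    then show "bij_betw ((\<lambda>(l, m) g. \<phi> (?Q Z l) (Y.act (fob ?E l) m g \<odot>\<^bsub>PY\<^esub> n Z l)) x)
        (hom V Z (fob (Y.whom \<bullet> (?E \<times>\<^sub>f id_func)) x))
        (case x of (l, m) \<Rightarrow> hom PX (?Q Z l) (fob f (fob iY m)))"
      using x by (simp add: comp_def)
  next
    fix z h x assume z: "z \<in> Ar V" "tgt V z = src V h" and h: "h \<in> Ar V" and "x \<in> Ob (op_cat MX \<times>\<^sub>C MY)"
      and tgt: "tgt V h = fob (X.whom \<bullet> (id_func \<times>\<^sub>f fM)) x"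
    then obtain l m where x: "x = (l, m)" "l \<in> Ob MX" "m \<in> Ob MY"
      by (cases x) auto
    then show "(case x of (l, m) \<Rightarrow> \<lambda>h. \<sigma> m \<odot>\<^bsub>PX\<^esub> (X.act l (fob fM m) h \<odot>\<^bsub>PX\<^esub> d (src V z) l)) (h \<odot>\<^bsub>V\<^esub> z) =
        (case x of (l, m) \<Rightarrow> \<lambda>t. t \<odot>\<^bsub>PX\<^esub> par PX SX (idn PX (fob iX l)) (far f (far WY z)))
          ((case x of (l, m) \<Rightarrow> \<lambda>h. \<sigma> m \<odot>\<^bsub>PX\<^esub> (X.act l (fob fM m) h \<odot>\<^bsub>PX\<^esub> d (tgt V z) l)) h)"
      using z h tgt d_nat[of z "idn MX l"] by (simp add: X.act_pre)
  next
    fix z h x assume z: "z \<in> Ar V" "tgt V z = src V h" and h: "h \<in> Ar V" and "x \<in> Ob (op_cat MX \<times>\<^sub>C MY)"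
      and tgt: "tgt V h = fob (Y.whom \<bullet> (?E \<times>\<^sub>f id_func)) x"
    then obtain l m where x: "x = (l, m)" "l \<in> Ob MX" "m \<in> Ob MY"
      by (cases x) auto
    let ?k = "par PX SX (idn PX (fob iX l)) (far f (far WY z))"
    \<comment> \<open>By \<open>n_nat\<close> the change of stage \<open>z\<close> moves under
      \<open>L\<close>, from where \<open>transpose_pre\<close> takes it out of the
      transpose.\<close>
    have "Y.act (fob ?E l) m (h \<odot>\<^bsub>V\<^esub> z) \<odot>\<^bsub>PY\<^esub> n (src V z) l
        = (Y.act (fob ?E l) m h \<odot>\<^bsub>PY\<^esub> n (tgt V z) l) \<odot>\<^bsub>PY\<^esub> far L ?k"
      using x z h tgt n_nat[of z "idn MX l"] by (simp add: Y.act_pre)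
    moreover have "\<phi> (?Q (src V z) l) \<dots> = \<phi> (?Q (tgt V z) l) (Y.act (fob ?E l) m h \<odot>\<^bsub>PY\<^esub> n (tgt V z) l) \<odot>\<^bsub>PX\<^esub> ?k"
      using x z h tgt \<phi>.transpose_pre[of ?k "Y.act (fob ?E l) m h \<odot>\<^bsub>PY\<^esub> n (tgt V z) l"]
      by (simp del: Y.P.cmp_assoc_simp X.P.cmp_assoc_simp)
    ultimately show "(case x of (l, m) \<Rightarrow> \<lambda>g. \<phi> (?Q (src V z) l) (Y.act (fob ?E l) m g \<odot>\<^bsub>PY\<^esub> n (src V z) l)) (h \<odot>\<^bsub>V\<^esub> z) =
        (case x of (l, m) \<Rightarrow> \<lambda>t. t \<odot>\<^bsub>PX\<^esub> par PX SX (idn PX (fob iX l)) (far f (far WY z)))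
          ((case x of (l, m) \<Rightarrow> \<lambda>g. \<phi> (?Q (tgt V z) l) (Y.act (fob ?E l) m g \<odot>\<^bsub>PY\<^esub> n (tgt V z) l)) h)"
      unfolding x(1) prod.case by (rule trans[OF arg_cong])
  next
    fix x h assume "x \<in> Ar (op_cat MX \<times>\<^sub>C MY)" and h: "h \<in> Ar V"
      and tgt: "tgt V h = fob (X.whom \<bullet> (id_func \<times>\<^sub>f fM)) (src (op_cat MX \<times>\<^sub>C MY) x)"
    then obtain u v where x: "x = (u, v)" "u \<in> Ar MX" "v \<in> Ar MY"
      by (cases x) auto
    have "\<sigma> (tgt MY v) \<odot>\<^bsub>PX\<^esub> (far iX (far fM v) \<odot>\<^bsub>PX\<^esub> k) = far f (far iY v) \<odot>\<^bsub>PX\<^esub> (\<sigma> (src MY v) \<odot>\<^bsub>PX\<^esub> k)"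
      if "k \<in> Ar PX" "tgt PX k = fob iX (fob fM (src MY v))" for k
      using x that \<sigma>_nat[of v] X.P.cmp_assoc_simp[of k "far iX (far fM v)" "\<sigma> (tgt MY v)"] by simp
    then show "(case tgt (op_cat MX \<times>\<^sub>C MY) x of (l, m) \<Rightarrow> \<lambda>h'. \<sigma> m \<odot>\<^bsub>PX\<^esub> (X.act l (fob fM m) h' \<odot>\<^bsub>PX\<^esub> d (src V h) l))
        (far (X.whom \<bullet> (id_func \<times>\<^sub>f fM)) x \<odot>\<^bsub>V\<^esub> h) =
        (case x of (u, v) \<Rightarrow> \<lambda>t. far f (far iY v) \<odot>\<^bsub>PX\<^esub> (t \<odot>\<^bsub>PX\<^esub> par PX SX (far iX u) (idn PX (fob f (fob WY (src V h))))))
          ((case src (op_cat MX \<times>\<^sub>C MY) x of (l, m) \<Rightarrow> \<lambda>h'. \<sigma> m \<odot>\<^bsub>PX\<^esub> (X.act l (fob fM m) h' \<odot>\<^bsub>PX\<^esub> d (src V h) l)) h)"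
      using x h tgt d_nat[of "idn V (src V h)" u] X.act_post[of u "far fM v" h] by simp
  next
    fix x h assume "x \<in> Ar (op_cat MX \<times>\<^sub>C MY)" and h: "h \<in> Ar V"
      and tgt: "tgt V h = fob (Y.whom \<bullet> (?E \<times>\<^sub>f id_func)) (src (op_cat MX \<times>\<^sub>C MY) x)"
    then obtain u v where x: "x = (u, v)" "u \<in> Ar MX" "v \<in> Ar MY"
      by (cases x) auto
    let ?Z = "src V h"
    let ?k = "par PX SX (far iX u) (idn PX (fob f (fob WY ?Z)))"
    let ?g = "Y.act (fob ?E (tgt MX u)) (src MY v) h \<odot>\<^bsub>PY\<^esub> n ?Z (tgt MX u)"
    have g: "?g \<in> Ar PY" "src PY ?g = fob L (?Q ?Z (tgt MX u))" "tgt PY ?g = fob iY (src MY v)"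
      using x h tgt by auto
    have "Y.act (fob ?E (src MX u)) (tgt MY v) (far Y.whom (far ?E u, v) \<odot>\<^bsub>V\<^esub> h) \<odot>\<^bsub>PY\<^esub> n ?Z (src MX u)
        = far iY v \<odot>\<^bsub>PY\<^esub> (?g \<odot>\<^bsub>PY\<^esub> far L ?k)"
      using x h tgt n_nat[of "idn V ?Z" u] Y.act_post[of "far ?E u" v h] by simp
    moreover have "\<phi> (?Q ?Z (src MX u)) \<dots> = far f (far iY v) \<odot>\<^bsub>PX\<^esub> (\<phi> (?Q ?Z (tgt MX u)) ?g \<odot>\<^bsub>PX\<^esub> ?k)"
      using x h g \<phi>.transpose_pre[of ?k ?g] \<phi>.transpose_post[of "?Q ?Z (src MX u)" "?g \<odot>\<^bsub>PY\<^esub> far L ?k" "far iY v"]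
      by (simp del: Y.P.cmp_assoc_simp X.P.cmp_assoc_simp)
    ultimately show "(case tgt (op_cat MX \<times>\<^sub>C MY) x of (l, m) \<Rightarrow> \<lambda>g. \<phi> (?Q ?Z l) (Y.act (fob ?E l) m g \<odot>\<^bsub>PY\<^esub> n ?Z l))
        (far (Y.whom \<bullet> (?E \<times>\<^sub>f id_func)) x \<odot>\<^bsub>V\<^esub> h) =
        (case x of (u, v) \<Rightarrow> \<lambda>t. far f (far iY v) \<odot>\<^bsub>PX\<^esub> (t \<odot>\<^bsub>PX\<^esub> par PX SX (far iX u) (idn PX (fob f (fob WY ?Z)))))
          ((case src (op_cat MX \<times>\<^sub>C MY) x of (l, m) \<Rightarrow> \<lambda>g. \<phi> (?Q ?Z l) (Y.act (fob ?E l) m g \<odot>\<^bsub>PY\<^esub> n ?Z l)) h)"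
      using x(1) by simp
  qed
qed

end


section \<open>Weak temporal doctrines\<close>

lemma naturally_isomorphic_of_natural_iso:
  "natural_iso C D F G \<tau> \<Longrightarrow> naturally_isomorphic C D F G"
  unfolding naturally_isomorphic_def by blast

context weak_temporal_doctrine
begin

lemma base_category: "category (base D)"
  by (rule incM.I.C.category_axioms)

abbreviation bang :: "'co \<Rightarrow> 'ca" where
  "bang X \<equiv> to_terminal (base D) (one D) X"

lemma one_Ob: "one D \<in> Ob (base D)"
  using base_terminal by (simp add: is_terminal_def)

lemma bang_hom: "X \<in> Ob (base D) \<Longrightarrow> bang X \<in> hom (base D) X (one D)"
  using category.to_terminal_simps[OF base_category base_terminal] by simp

lemma bang_cmp:
  assumes "f \<in> hom (base D) X Y"
  shows "bang Y \<odot>\<^bsub>base D\<^esub> f = bang X"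
proof -
  have "X \<in> Ob (base D)" "Y \<in> Ob (base D)"
    using assms by auto
  with assms bang_hom[of X] bang_hom[of Y] show ?thesis
    by (intro category.terminal_unique[OF base_category base_terminal]) auto
qed

lemma inM_functor: "X \<in> Ob (base D) \<Longrightarrow> is_functor (Mc D X) (Pc D X) (inM D X)"
  and inM'_functor: "X \<in> Ob (base D) \<Longrightarrow> is_functor (Mc' D X) (Pc D X) (inM' D X)"
  by (rule incM.comp_at_functor, assumption) (rule incM'.comp_at_functor, assumption)

lemma subM_functor: "f \<in> hom (base D) X Y \<Longrightarrow> is_functor (Mc D Y) (Mc D X) (subM D f)"
  and subM'_functor: "f \<in> hom (base D) X Y \<Longrightarrow> is_functor (Mc' D Y) (Mc' D X) (subM' D f)"
  and subP_functor: "f \<in> hom (base D) X Y \<Longrightarrow> is_functor (Pc D Y) (Pc D X) (subP D f)"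
  by (rule incM.I.sub_functor, assumption) (rule incM'.I.sub_functor incM.J.sub_functor, assumption)+

lemma jM_functor: "is_functor (B1 D) (Mc D (one D)) (jM D (one D))"
  and jM'_functor: "is_functor (B1 D) (Mc' D (one D)) (jM' D (one D))"
  using jM_one jM'_one by (simp_all add: is_equivalence_def)

lemma inM_sub: "f \<in> hom (base D) X Y \<Longrightarrow>
    naturally_isomorphic (Mc D Y) (Pc D X) (inM D X \<bullet> subM D f) (subP D f \<bullet> inM D Y)"
  and inM'_sub: "f \<in> hom (base D) X Y \<Longrightarrow>
    naturally_isomorphic (Mc' D Y) (Pc D X) (inM' D X \<bullet> subM' D f) (subP D f \<bullet> inM' D Y)"
  by (rule naturally_isomorphic_of_natural_iso, rule incM.comp_sub_iso incM'.comp_sub_iso, assumption)+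

section \<open>The weight and its factorisations through both inclusions\<close>

lemma jM_jM': "naturally_isomorphic (B1 D) (Pc D (one D)) (inM D (one D) \<bullet> jM D (one D))
    (inM' D (one D) \<bullet> jM' D (one D))"
\<comment> \<open>Each object of the pseudo-pullback carries its own component \<open>t\<close>, and
  the naturality squares are the condition imposed on arrows.\<close>
proof (rule naturally_isomorphicI[where \<tau> = "\<lambda>(M, N, t). t"])
  show "is_functor (B1 D) (Pc D (one D)) (inM D (one D) \<bullet> jM D (one D))"
    by (rule is_functor_comp[OF jM_functor inM_functor[OF one_Ob]])
  show "is_functor (B1 D) (Pc D (one D)) (inM' D (one D) \<bullet> jM' D (one D))"
    by (rule is_functor_comp[OF jM'_functor inM'_functor[OF one_Ob]])
qed (auto simp: Bc_def pseudo_pullback_def Let_def jM_def jM'_def)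

lemma const_b_inM:
  assumes X: "X \<in> Ob (base D)"
  shows "naturally_isomorphic (B1 D) (Pc D X) (const_b D X)
    (inM D X \<bullet> subM D (bang X) \<bullet> jM D (one D))"
  using naturally_isomorphic_whisker_right[OF naturally_isomorphic_sym[OF inM_sub[OF bang_hom[OF X]]] jM_functor]
  by (simp add: const_b_def comp_func_assoc)

text \<open>\<open>const_b\<close> is written with \<open>inM\<close> and \<open>jM\<close>. The
  passage to the other side happens over the terminal object, before substituting.\<close>

lemma const_b_inM':
  assumes X: "X \<in> Ob (base D)"
  shows "naturally_isomorphic (B1 D) (Pc D X) (const_b D X)
    (inM' D X \<bullet> subM' D (bang X) \<bullet> jM' D (one D))"
proof -
  have "naturally_isomorphic (B1 D) (Pc D X) (const_b D X)
      (subP D (bang X) \<bullet> inM' D (one D) \<bullet> jM' D (one D))"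
    using naturally_isomorphic_whisker_left[OF jM_jM' subP_functor[OF bang_hom[OF X]]]
    by (simp add: const_b_def)
  also have "naturally_isomorphic (B1 D) (Pc D X) \<dots> (inM' D X \<bullet> subM' D (bang X) \<bullet> jM' D (one D))"
    using naturally_isomorphic_whisker_right[OF naturally_isomorphic_sym[OF inM'_sub[OF bang_hom[OF X]]] jM'_functor]
    by (simp add: comp_func_assoc)
  finally show ?thesis .
qed

text \<open>As \<open>bang Y\<close> after \<open>f\<close> is \<open>bang X\<close>, this is the
  composition isomorphism of the pseudofunctor, restricted along the inclusion of
  \<open>B1 D\<close> into the fibre over the terminal object.\<close>

lemma const_b_sub:
  assumes f: "f \<in> hom (base D) X Y" and Y: "Y \<in> Ob (base D)"
  shows "naturally_isomorphic (B1 D) (Pc D X) (const_b D X) (subP D f \<bullet> const_b D Y)"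
proof -
  have "naturally_isomorphic (Pc D (one D)) (Pc D X) (subP D (bang X)) (subP D f \<bullet> subP D (bang Y))"
    using naturally_isomorphic_sym[OF naturally_isomorphic_of_natural_iso[OF
        incM.J.sub_cmp_iso[OF f bang_hom[OF Y]]]] bang_cmp[OF f] by simp
  from naturally_isomorphic_whisker_right[OF this is_functor_comp[OF jM_functor inM_functor[OF one_Ob]]]
  show ?thesis
    by (simp add: const_b_def comp_func_assoc)
qed

section \<open>Existence of coends and ends, and finite products in \<open>B1 D\<close>\<close>

lemma coend_adjoint:
  assumes X: "X \<in> Ob (base D)"
  shows "adjoint_pair (Pc D X) (B1 D) (coend D X) (const_b D X)"
proof -
  obtain G where G: "adjoint_pair (Mc D (one D)) (B1 D) G (jM D (one D))"
    using equivalence_adjoints[OF jM_one] by blast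
  obtain \<epsilon> where "adjunction (Pc D (one D)) (Mc D (one D)) (Dia D (one D)) (inM D (one D)) (Dia_unit D (one D)) \<epsilon>"
    using Dia_adjoint[OF one_Ob] by blast
  \<comment> \<open>All three factors of \<open>const_b\<close> have left adjoints:
    \<open>Sig\<close>, \<open>Dia\<close> over the terminal object, and \<open>G\<close>. This
    existence is what gives the \<open>SOME\<close> term its meaning.\<close>
  from adjoint_pair_comp[OF adjoint_pair_comp[OF adjunction.adjoint_pair[OF Sig_adjoint[OF bang_hom[OF X]]]
        adjunction.adjoint_pair[OF this]] G]
  have "\<exists>F. adjoint_pair (Pc D X) (B1 D) F (const_b D X)"
    by (auto simp: const_b_def comp_func_assoc)
  then show ?thesis
    unfolding coend_def by (rule someI_ex)
qed

lemma endf_adjoint: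
  assumes X: "X \<in> Ob (base D)"
  shows "adjoint_pair (B1 D) (Pc D X) (const_b D X) (endf D X)"
proof -
  obtain G where G: "adjoint_pair (B1 D) (Mc D (one D)) (jM D (one D)) G"
    using equivalence_adjoints[OF jM_one] by blast
  \<comment> \<open>Right adjoints are given for \<open>subM\<close> but not for
    \<open>subP\<close>, so the weight is first rewritten as \<open>inM\<close> after
    \<open>subM\<close> after \<open>jM\<close>, whose factors all have one.\<close>
  from adjoint_pair_comp[OF adjoint_pair_comp[OF G Forall_adjoint[OF bang_hom[OF X]]] Box_adjoint[OF X]]
  have "\<exists>F. adjoint_pair (B1 D) (Pc D X) (const_b D X) F"
    using adjoint_pair_left_iso[OF naturally_isomorphic_sym[OF const_b_inM[OF X]]] by blast
  then show ?thesis
    unfolding endf_def by (rule someI_ex)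
qed

text \<open>The composite of \<open>jM\<close> and \<open>inM\<close> over the terminal object is
  fully faithful with a right adjoint, so \<open>B1 D\<close> has the products of a coreflective
  subcategory.\<close>

lemma B1_finite_products:
  obtains S where "finite_products (B1 D) S"
proof -
  obtain G where G: "adjoint_pair (B1 D) (Mc D (one D)) (jM D (one D)) G"
    using equivalence_adjoints[OF jM_one] by blast
  obtain \<phi> where "hom_adjunction (B1 D) (Pc D (one D)) (inM D (one D) \<bullet> jM D (one D)) (G \<bullet> Box D (one D)) \<phi>"
    by (rule adjoint_pairE[OF adjoint_pair_comp[OF G Box_adjoint[OF one_Ob]]])
  then show thesis
    using hom_adjunction.coreflective_finite_products[OF _ fully_faithful_comp[OF jM_functor
          equivalence_fully_faithful[OF jM_one] inM_ff[OF one_Ob]] fibre_products[OF one_Ob]] that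
    by blast
qed

section \<open>Enrichment of the fibres\<close>

lemma weighted_exponentials_inM:
  assumes X: "X \<in> Ob (base D)" and adj: "adjunction (B1 D) (Pc D X) (const_b D X) (endf D X) \<eta> \<epsilon>"
  shows "weighted_exponentials (B1 D) (Pc D X) (const_b D X) (endf D X) \<eta> \<epsilon> (fprod D X)
      (Mc D X) (inM D X) (expo D X) (expo_ev D X)"
    and "weighted_exponentials (B1 D) (Pc D X) (const_b D X) (endf D X) \<eta> \<epsilon> (fprod D X)
      (Mc' D X) (inM' D X) (expo D X) (expo_ev D X)"
proof -
  show "weighted_exponentials (B1 D) (Pc D X) (const_b D X) (endf D X) \<eta> \<epsilon> (fprod D X)
      (Mc D X) (inM D X) (expo D X) (expo_ev D X)"
    by (rule weighted_exponentials.intro[OF fibre_products[OF X] adj inM_functor[OF X]], unfold_locales)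
      (rule inM_ff[OF X], rule exponentiable[OF X _ _ refl])
  show "weighted_exponentials (B1 D) (Pc D X) (const_b D X) (endf D X) \<eta> \<epsilon> (fprod D X)
      (Mc' D X) (inM' D X) (expo D X) (expo_ev D X)"
    by (rule weighted_exponentials.intro[OF fibre_products[OF X] adj inM'_functor[OF X]], unfold_locales)
      (rule inM'_ff[OF X], rule exponentiable'[OF X _ _ refl])
qed

lemma whom_nat_obj:
  assumes "weighted_exponentials (B1 D) (Pc D X) (const_b D X) (endf D X) \<eta> \<epsilon> (fprod D X)
      (Mc D X) (inM D X) (expo D X) (expo_ev D X)"
  shows "weighted_exponentials.whom (Pc D X) (endf D X) (fprod D X) (inM D X) (expo D X) (expo_ev D X) = nat_obj D X"
  by (simp add: weighted_exponentials.whom_def[OF assms] weighted_exponentials.expn_func_def[OF assms] nat_obj_def)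

lemma whom_nat_obj':
  assumes "weighted_exponentials (B1 D) (Pc D X) (const_b D X) (endf D X) \<eta> \<epsilon> (fprod D X)
      (Mc' D X) (inM' D X) (expo D X) (expo_ev D X)"
  shows "weighted_exponentials.whom (Pc D X) (endf D X) (fprod D X) (inM' D X) (expo D X) (expo_ev D X) = nat_obj' D X"
  by (simp add: weighted_exponentials.whom_def[OF assms] weighted_exponentials.expn_func_def[OF assms] nat_obj'_def)

lemma nat_obj_enriches:
  assumes X: "X \<in> Ob (base D)"
  shows "enriches (B1 D) (Mc D X) (nat_obj D X)" "enriches (B1 D) (Mc' D X) (nat_obj' D X)"
proof -
  obtain S where S: "finite_products (B1 D) S" by (rule B1_finite_products)
  obtain \<eta> \<epsilon> where "adjunction (B1 D) (Pc D X) (const_b D X) (endf D X) \<eta> \<epsilon>"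
    using endf_adjoint[OF X] unfolding adjoint_pair_def by blast
  note W = weighted_exponentials_inM[OF X this]
  \<comment> \<open>The weight preserves terminal objects because it is also a right adjoint, namely
    of \<open>coend\<close>. This identifies the underlying category of the enriched one.\<close>
  have "is_terminal (Pc D X) (fob (const_b D X) t)" if "is_terminal (B1 D) t" for t
    by (rule right_adjoint_terminal[OF coend_adjoint[OF X] that])
  with weighted_exponentials.enrichment[OF W(1) S] weighted_exponentials.enrichment[OF W(2) S]
  show "enriches (B1 D) (Mc D X) (nat_obj D X)" "enriches (B1 D) (Mc' D X) (nat_obj' D X)"
    unfolding whom_nat_obj[OF W(1)] whom_nat_obj'[OF W(2)] by auto
qed

section \<open>The laws for \<open>meets\<close> and \<open>ten\<close>\<close>

lemma frobenius_adjunction_Sig: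
  assumes f: "f \<in> hom (base D) X Y" and XY: "X \<in> Ob (base D)" "Y \<in> Ob (base D)"
  shows "frobenius_adjunction (Pc D X) (fprod D X) (Pc D Y) (fprod D Y) (Sig D f) (subP D f) (Sig_unit D f) (Sig_counit D f)"
proof (intro frobenius_adjunction.intro frobenius_adjunction_axioms.intro fibre_products XY Sig_adjoint f)
  fix P Q assume "P \<in> Ob (Pc D X)" "Q \<in> Ob (Pc D Y)"
  from frobenius_law[OF f this]
  show "is_iso (Pc D Y) (pairing (Pc D Y) (fprod D Y) (far (Sig D f) (pr1 (fprod D X) P (fob (subP D f) Q)))
      (Sig_counit D f Q \<odot>\<^bsub>Pc D Y\<^esub> far (Sig D f) (pr2 (fprod D X) P (fob (subP D f) Q))))"
    using f by (simp add: frobenius_def Let_def)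
qed

lemma meets_sub:
  assumes f: "f \<in> hom (base D) X Y" and XY: "X \<in> Ob (base D)" "Y \<in> Ob (base D)"
  shows "naturally_isomorphic (Pc D Y \<times>\<^sub>C Pc D X) (B1 D)
      (meets D X \<bullet> (subP D f \<times>\<^sub>f id_func)) (meets D Y \<bullet> (id_func \<times>\<^sub>f Sig D f))"
    and "naturally_isomorphic (Pc D X \<times>\<^sub>C Pc D Y) (B1 D)
      (meets D X \<bullet> (id_func \<times>\<^sub>f subP D f)) (meets D Y \<bullet> (Sig D f \<times>\<^sub>f id_func))"
  using frobenius_adjunction.meets_natural_iso[OF frobenius_adjunction_Sig[OF assms]
      coend_adjoint[OF XY(1)] coend_adjoint[OF XY(2)] const_b_sub[OF f XY(2)]]
  by (simp_all add: meets_def comp_func_assoc)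

lemma mixed_frobenius_law_Dia:
  assumes X: "X \<in> Ob (base D)"
    and adj: "adjunction (Pc D X) (Mc D X) (Dia D X) (inM D X) (Dia_unit D X) \<epsilon>"
  shows "mixed_frobenius_law (Pc D X) (fprod D X) (Mc D X) (Dia D X) (inM D X) (Dia_unit D X) \<epsilon> (Mc' D X) (inM' D X)"
  by (intro mixed_frobenius_law.intro mixed_frobenius_law_axioms.intro fibre_products adj inM'_functor
      mixed_frobenius X; assumption)

lemma mixed_frobenius_law_Dia':
  assumes X: "X \<in> Ob (base D)"
    and adj: "adjunction (Pc D X) (Mc' D X) (Dia' D X) (inM' D X) (Dia'_unit D X) \<epsilon>"
  shows "mixed_frobenius_law (Pc D X) (fprod D X) (Mc' D X) (Dia' D X) (inM' D X) (Dia'_unit D X) \<epsilon> (Mc D X) (inM D X)"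
  by (intro mixed_frobenius_law.intro mixed_frobenius_law_axioms.intro fibre_products adj inM_functor
      mixed_frobenius' X; assumption)

lemma const_functor:
  assumes X: "X \<in> Ob (base D)"
  shows "is_functor (B1 D) (Mc D X) (subM D (bang X) \<bullet> jM D (one D))"
    and "is_functor (B1 D) (Mc' D X) (subM' D (bang X) \<bullet> jM' D (one D))"
  by (rule is_functor_comp[OF jM_functor subM_functor[OF bang_hom[OF X]]]
      is_functor_comp[OF jM'_functor subM'_functor[OF bang_hom[OF X]]])+

lemma ten_Dia:
  assumes X: "X \<in> Ob (base D)"
  shows "naturally_isomorphic (Mc' D X \<times>\<^sub>C Pc D X) (B1 D)
    (ten D X \<bullet> (id_func \<times>\<^sub>f Dia D X)) (meets D X \<bullet> (inM' D X \<times>\<^sub>f id_func))"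
proof -
  obtain \<epsilon> where "adjunction (Pc D X) (Mc D X) (Dia D X) (inM D X) (Dia_unit D X) \<epsilon>"
    using Dia_adjoint[OF X] by blast
  from naturally_isomorphic_sym[OF mixed_frobenius_law.meets_reflection(2)[OF mixed_frobenius_law_Dia[OF X this]
        coend_adjoint[OF X] const_b_inM[OF X] const_functor(1)[OF X]]]
  show ?thesis
    by (simp add: meets_def ten_def comp_func_assoc prod_comp_func)
qed

lemma ten_Dia':
  assumes X: "X \<in> Ob (base D)"
  shows "naturally_isomorphic (Pc D X \<times>\<^sub>C Mc D X) (B1 D)
    (ten D X \<bullet> (Dia' D X \<times>\<^sub>f id_func)) (meets D X \<bullet> (id_func \<times>\<^sub>f inM D X))"
proof -
  obtain \<epsilon> where "adjunction (Pc D X) (Mc' D X) (Dia' D X) (inM' D X) (Dia'_unit D X) \<epsilon>"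
    using Dia'_adjoint[OF X] by blast
  from naturally_isomorphic_sym[OF mixed_frobenius_law.meets_reflection(1)[OF mixed_frobenius_law_Dia'[OF X this]
        coend_adjoint[OF X] const_b_inM'[OF X] const_functor(2)[OF X]]]
  show ?thesis
    by (simp add: meets_def ten_def comp_func_assoc prod_comp_func)
qed

lemma meets_functor:
  assumes X: "X \<in> Ob (base D)"
  shows "is_functor (Pc D X \<times>\<^sub>C Pc D X) (B1 D) (meets D X)"
  unfolding meets_def
  by (rule is_functor_comp[OF finite_products.product_functor[OF fibre_products[OF X]]
        adjoint_pair_functors(1)[OF coend_adjoint[OF X]]])

lemma fibre_identities:
  assumes X: "X \<in> Ob (base D)"
  shows "is_functor (Mc D X) (Mc D X) id_func" "is_functor (Mc' D X) (Mc' D X) id_func"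
  using is_functor.axioms(1)[OF inM_functor[OF X]] is_functor.axioms(1)[OF inM'_functor[OF X]]
  by (auto intro: is_functor_id)

text \<open>Substitution moves past \<open>inM'\<close>, the Frobenius law trades it for
  \<open>Sig\<close> on the other argument, and the mixed law inserts \<open>Dia\<close> there,
  which completes \<open>Exists\<close>.\<close>

lemma ten_sub:
  assumes f: "f \<in> hom (base D) X Y" and XY: "X \<in> Ob (base D)" "Y \<in> Ob (base D)"
  shows "naturally_isomorphic (Mc' D Y \<times>\<^sub>C Mc D X) (B1 D)
    (ten D X \<bullet> (subM' D f \<times>\<^sub>f id_func)) (ten D Y \<bullet> (id_func \<times>\<^sub>f Exists D f))"
proof -
  have Sig: "is_functor (Pc D X) (Pc D Y) (Sig D f)"
    using adjoint_pair_functors[OF adjunction.adjoint_pair[OF Sig_adjoint[OF f]]] by simp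
  have "naturally_isomorphic (Mc' D Y \<times>\<^sub>C Mc D X) (B1 D)
      (meets D X \<bullet> ((inM' D X \<bullet> subM' D f) \<times>\<^sub>f inM D X)) (meets D X \<bullet> ((subP D f \<bullet> inM' D Y) \<times>\<^sub>f inM D X))"
    by (rule naturally_isomorphic_whisker_left[OF naturally_isomorphic_prod[OF inM'_sub[OF f]
          naturally_isomorphic_refl[OF inM_functor[OF XY(1)]]] meets_functor[OF XY(1)]])
  also have "meets D X \<bullet> ((inM' D X \<bullet> subM' D f) \<times>\<^sub>f inM D X) = ten D X \<bullet> (subM' D f \<times>\<^sub>f id_func)"
    by (simp add: ten_def comp_func_assoc prod_comp_func)
  also have "meets D X \<bullet> ((subP D f \<bullet> inM' D Y) \<times>\<^sub>f inM D X)
      = (meets D X \<bullet> (subP D f \<times>\<^sub>f id_func)) \<bullet> (inM' D Y \<times>\<^sub>f inM D X)"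
    by (simp add: comp_func_assoc prod_comp_func)
  also have "naturally_isomorphic (Mc' D Y \<times>\<^sub>C Mc D X) (B1 D) \<dots>
      ((meets D Y \<bullet> (id_func \<times>\<^sub>f Sig D f)) \<bullet> (inM' D Y \<times>\<^sub>f inM D X))"
    by (rule naturally_isomorphic_whisker_right[OF meets_sub(1)[OF assms]
          is_functor_prod[OF inM'_functor[OF XY(2)] inM_functor[OF XY(1)]]])
  also have "\<dots> = (meets D Y \<bullet> (inM' D Y \<times>\<^sub>f id_func)) \<bullet> (id_func \<times>\<^sub>f (Sig D f \<bullet> inM D X))"
    by (simp add: comp_func_assoc prod_comp_func)
  also have "naturally_isomorphic (Mc' D Y \<times>\<^sub>C Mc D X) (B1 D) \<dots>
      ((ten D Y \<bullet> (id_func \<times>\<^sub>f Dia D Y)) \<bullet> (id_func \<times>\<^sub>f (Sig D f \<bullet> inM D X)))"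
    by (rule naturally_isomorphic_whisker_right[OF naturally_isomorphic_sym[OF ten_Dia[OF XY(2)]]
          is_functor_prod[OF fibre_identities(2)[OF XY(2)] is_functor_comp[OF inM_functor[OF XY(1)] Sig]]])
  also have "\<dots> = ten D Y \<bullet> (id_func \<times>\<^sub>f Exists D f)"
    using f by (simp add: Exists_def comp_func_assoc prod_comp_func)
  finally show ?thesis .
qed

lemma ten_sub':
  assumes f: "f \<in> hom (base D) X Y" and XY: "X \<in> Ob (base D)" "Y \<in> Ob (base D)"
  shows "naturally_isomorphic (Mc' D X \<times>\<^sub>C Mc D Y) (B1 D)
    (ten D X \<bullet> (id_func \<times>\<^sub>f subM D f)) (ten D Y \<bullet> (Exists' D f \<times>\<^sub>f id_func))"
proof -
  have Sig: "is_functor (Pc D X) (Pc D Y) (Sig D f)"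
    using adjoint_pair_functors[OF adjunction.adjoint_pair[OF Sig_adjoint[OF f]]] by simp
  have "naturally_isomorphic (Mc' D X \<times>\<^sub>C Mc D Y) (B1 D)
      (meets D X \<bullet> (inM' D X \<times>\<^sub>f (inM D X \<bullet> subM D f))) (meets D X \<bullet> (inM' D X \<times>\<^sub>f (subP D f \<bullet> inM D Y)))"
    by (rule naturally_isomorphic_whisker_left[OF naturally_isomorphic_prod[OF
          naturally_isomorphic_refl[OF inM'_functor[OF XY(1)]] inM_sub[OF f]] meets_functor[OF XY(1)]])
  also have "meets D X \<bullet> (inM' D X \<times>\<^sub>f (inM D X \<bullet> subM D f)) = ten D X \<bullet> (id_func \<times>\<^sub>f subM D f)"
    by (simp add: ten_def comp_func_assoc prod_comp_func)
  also have "meets D X \<bullet> (inM' D X \<times>\<^sub>f (subP D f \<bullet> inM D Y))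
      = (meets D X \<bullet> (id_func \<times>\<^sub>f subP D f)) \<bullet> (inM' D X \<times>\<^sub>f inM D Y)"
    by (simp add: comp_func_assoc prod_comp_func)
  also have "naturally_isomorphic (Mc' D X \<times>\<^sub>C Mc D Y) (B1 D) \<dots>
      ((meets D Y \<bullet> (Sig D f \<times>\<^sub>f id_func)) \<bullet> (inM' D X \<times>\<^sub>f inM D Y))"
    by (rule naturally_isomorphic_whisker_right[OF meets_sub(2)[OF assms]
          is_functor_prod[OF inM'_functor[OF XY(1)] inM_functor[OF XY(2)]]])
  also have "\<dots> = (meets D Y \<bullet> (id_func \<times>\<^sub>f inM D Y)) \<bullet> ((Sig D f \<bullet> inM' D X) \<times>\<^sub>f id_func)"
    by (simp add: comp_func_assoc prod_comp_func)
  also have "naturally_isomorphic (Mc' D X \<times>\<^sub>C Mc D Y) (B1 D) \<dots>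
      ((ten D Y \<bullet> (Dia' D Y \<times>\<^sub>f id_func)) \<bullet> ((Sig D f \<bullet> inM' D X) \<times>\<^sub>f id_func))"
    by (rule naturally_isomorphic_whisker_right[OF naturally_isomorphic_sym[OF ten_Dia'[OF XY(2)]]
          is_functor_prod[OF is_functor_comp[OF inM'_functor[OF XY(1)] Sig] fibre_identities(1)[OF XY(2)]]])
  also have "\<dots> = ten D Y \<bullet> (Exists' D f \<times>\<^sub>f id_func)"
    using f by (simp add: Exists'_def comp_func_assoc prod_comp_func)
  finally show ?thesis .
qed

section \<open>The laws for \<open>nat\<close>\<close>

lemma orthogonal_weight:
  assumes Y: "Y \<in> Ob (base D)" and u: "u \<in> Ar (Pc D Y)" and w: "w \<in> Ob (Pc D Y)" and Z: "Z \<in> Ob V"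
    and weight: "naturally_isomorphic V (Pc D Y) W (i \<bullet> K)"
    and orth: "orthogonal (Pc D Y) (par (Pc D Y) (fprod D Y) u (idn (Pc D Y) (fob i (fob K Z)))) w"
  shows "orthogonal (Pc D Y) (par (Pc D Y) (fprod D Y) u (idn (Pc D Y) (fob W Z))) w"
proof -
  interpret finite_products "Pc D Y" "fprod D Y" by (rule fibre_products[OF Y])
  \<comment> \<open>The mixed law concerns a factor of the form \<open>fob i (fob K Z)\<close>;
    \<open>\<theta>\<close> carries its conclusion to the isomorphic weight.\<close>
  obtain \<theta> where \<theta>: "\<And>Z. Z \<in> Ob V \<Longrightarrow> is_iso (Pc D Y) (\<theta> Z)"
    "\<And>Z. Z \<in> Ob V \<Longrightarrow> src (Pc D Y) (\<theta> Z) = fob i (fob K Z)" "\<And>Z. Z \<in> Ob V \<Longrightarrow> tgt (Pc D Y) (\<theta> Z) = fob W Z"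
    by (rule naturally_isomorphicE[OF naturally_isomorphic_sym[OF weight]]) auto
  show ?thesis
    using orthogonal_par_iso[of u "\<theta> Z" w] \<theta>[OF Z] u w orth by simp
qed

text \<open>The two laws read the same weight in different ways. The one for \<open>Forall\<close>
  factors it through \<open>inM\<close>, so that its products with objects of \<open>Mc D Y\<close>
  stay in the image. The one for \<open>Exists\<close> factors it through \<open>inM'\<close>, since
  the mixed law for \<open>Dia\<close> admits an idle factor from the opposite subcategory.\<close>

lemma nat_obj_sub:
  assumes f: "f \<in> hom (base D) X Y" and XY: "X \<in> Ob (base D)" "Y \<in> Ob (base D)"
  shows "naturally_isomorphic (op_cat (Mc D Y) \<times>\<^sub>C Mc D X) (B1 D)
      (nat_obj D X \<bullet> (subM D f \<times>\<^sub>f id_func)) (nat_obj D Y \<bullet> (id_func \<times>\<^sub>f Forall D f))"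
    and "naturally_isomorphic (op_cat (Mc D X) \<times>\<^sub>C Mc D Y) (B1 D)
      (nat_obj D X \<bullet> (id_func \<times>\<^sub>f subM D f)) (nat_obj D Y \<bullet> (Exists D f \<times>\<^sub>f id_func))"
proof -
  obtain \<eta>X \<epsilon>X \<eta>Y \<epsilon>Y where "adjunction (B1 D) (Pc D X) (const_b D X) (endf D X) \<eta>X \<epsilon>X"
    "adjunction (B1 D) (Pc D Y) (const_b D Y) (endf D Y) \<eta>Y \<epsilon>Y"
    using endf_adjoint[OF XY(1)] endf_adjoint[OF XY(2)] unfolding adjoint_pair_def by blast
  note WX = weighted_exponentials_inM(1)[OF XY(1) this(1)] and WY = weighted_exponentials_inM(1)[OF XY(2) this(2)]
  have C: "weighted_change (B1 D) (Pc D X) (Pc D Y) (Mc D X) (Mc D Y) (const_b D X) (endf D X) \<eta>X \<epsilon>X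
      (fprod D X) (inM D X) (expo D X) (expo_ev D X) (const_b D Y) (endf D Y) \<eta>Y \<epsilon>Y
      (fprod D Y) (inM D Y) (expo D Y) (expo_ev D Y) (Sig D f) (subP D f) (Sig_unit D f) (Sig_counit D f) (subM D f)"
    by (intro weighted_change.intro weighted_change_axioms.intro WX WY frobenius_adjunction_Sig f XY
        subM_functor[OF f] const_b_sub inM_sub)
  obtain \<epsilon> where Dia: "adjunction (Pc D Y) (Mc D Y) (Dia D Y) (inM D Y) (Dia_unit D Y) \<epsilon>"
    using Dia_adjoint[OF XY(2)] by blast
  interpret L: mixed_frobenius_law "Pc D Y" "fprod D Y" "Mc D Y" "Dia D Y" "inM D Y" "Dia_unit D Y" \<epsilon> "Mc' D Y" "inM' D Y"
    by (rule mixed_frobenius_law_Dia[OF XY(2) Dia])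
  interpret K: is_functor "B1 D" "Mc' D Y" "subM' D (bang Y) \<bullet> jM' D (one D)"
    by (rule const_functor(2)[OF XY(2)])
  show "naturally_isomorphic (op_cat (Mc D Y) \<times>\<^sub>C Mc D X) (B1 D)
      (nat_obj D X \<bullet> (subM D f \<times>\<^sub>f id_func)) (nat_obj D Y \<bullet> (id_func \<times>\<^sub>f Forall D f))"
    using weighted_change.whom_right_adjoint[OF C Forall_adjoint[OF f] adjunction.adjoint_pair[OF Dia]
        const_b_inM[OF XY(2)] const_functor(1)[OF XY(2)]]
    unfolding whom_nat_obj[OF WX] whom_nat_obj[OF WY] .
  have "orthogonal (Pc D Y) (par (Pc D Y) (fprod D Y) (Dia_unit D Y Q) (idn (Pc D Y) (fob (const_b D Y) Z))) (fob (inM D Y) m)"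
    if "Q \<in> Ob (Pc D Y)" "Z \<in> Ob (B1 D)" "m \<in> Ob (Mc D Y)" for Q Z m
    using that K.fob_Ob[of Z]
    by (intro orthogonal_weight[OF XY(2) _ _ _ const_b_inM'[OF XY(2)]] L.orthogonal_par_unit) auto
  from weighted_change.whom_left_adjoint[OF C Dia this]
  show "naturally_isomorphic (op_cat (Mc D X) \<times>\<^sub>C Mc D Y) (B1 D)
      (nat_obj D X \<bullet> (id_func \<times>\<^sub>f subM D f)) (nat_obj D Y \<bullet> (Exists D f \<times>\<^sub>f id_func))"
    using f unfolding whom_nat_obj[OF WX] whom_nat_obj[OF WY] by (simp add: Exists_def)
qed

text \<open>The same argument with the two subcategories exchanged: the weight is factored through
  \<open>inM'\<close> for \<open>Forall'\<close> and through \<open>inM\<close> for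
  \<open>Exists'\<close>.\<close>

lemma nat_obj'_sub:
  assumes f: "f \<in> hom (base D) X Y" and XY: "X \<in> Ob (base D)" "Y \<in> Ob (base D)"
  shows "naturally_isomorphic (op_cat (Mc' D Y) \<times>\<^sub>C Mc' D X) (B1 D)
      (nat_obj' D X \<bullet> (subM' D f \<times>\<^sub>f id_func)) (nat_obj' D Y \<bullet> (id_func \<times>\<^sub>f Forall' D f))"
    and "naturally_isomorphic (op_cat (Mc' D X) \<times>\<^sub>C Mc' D Y) (B1 D)
      (nat_obj' D X \<bullet> (id_func \<times>\<^sub>f subM' D f)) (nat_obj' D Y \<bullet> (Exists' D f \<times>\<^sub>f id_func))"
proof -
  obtain \<eta>X \<epsilon>X \<eta>Y \<epsilon>Y where "adjunction (B1 D) (Pc D X) (const_b D X) (endf D X) \<eta>X \<epsilon>X"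
    "adjunction (B1 D) (Pc D Y) (const_b D Y) (endf D Y) \<eta>Y \<epsilon>Y"
    using endf_adjoint[OF XY(1)] endf_adjoint[OF XY(2)] unfolding adjoint_pair_def by blast
  note WX = weighted_exponentials_inM(2)[OF XY(1) this(1)] and WY = weighted_exponentials_inM(2)[OF XY(2) this(2)]
  have C: "weighted_change (B1 D) (Pc D X) (Pc D Y) (Mc' D X) (Mc' D Y) (const_b D X) (endf D X) \<eta>X \<epsilon>X
      (fprod D X) (inM' D X) (expo D X) (expo_ev D X) (const_b D Y) (endf D Y) \<eta>Y \<epsilon>Y
      (fprod D Y) (inM' D Y) (expo D Y) (expo_ev D Y) (Sig D f) (subP D f) (Sig_unit D f) (Sig_counit D f) (subM' D f)"
    by (intro weighted_change.intro weighted_change_axioms.intro WX WY frobenius_adjunction_Sig f XY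
        subM'_functor[OF f] const_b_sub inM'_sub)
  obtain \<epsilon> where Dia': "adjunction (Pc D Y) (Mc' D Y) (Dia' D Y) (inM' D Y) (Dia'_unit D Y) \<epsilon>"
    using Dia'_adjoint[OF XY(2)] by blast
  interpret L: mixed_frobenius_law "Pc D Y" "fprod D Y" "Mc' D Y" "Dia' D Y" "inM' D Y" "Dia'_unit D Y" \<epsilon> "Mc D Y" "inM D Y"
    by (rule mixed_frobenius_law_Dia'[OF XY(2) Dia'])
  interpret K: is_functor "B1 D" "Mc D Y" "subM D (bang Y) \<bullet> jM D (one D)"
    by (rule const_functor(1)[OF XY(2)])
  show "naturally_isomorphic (op_cat (Mc' D Y) \<times>\<^sub>C Mc' D X) (B1 D)
      (nat_obj' D X \<bullet> (subM' D f \<times>\<^sub>f id_func)) (nat_obj' D Y \<bullet> (id_func \<times>\<^sub>f Forall' D f))"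
    using weighted_change.whom_right_adjoint[OF C Forall'_adjoint[OF f] adjunction.adjoint_pair[OF Dia']
        const_b_inM'[OF XY(2)] const_functor(2)[OF XY(2)]]
    unfolding whom_nat_obj'[OF WX] whom_nat_obj'[OF WY] .
  have "orthogonal (Pc D Y) (par (Pc D Y) (fprod D Y) (Dia'_unit D Y Q) (idn (Pc D Y) (fob (const_b D Y) Z))) (fob (inM' D Y) m)"
    if "Q \<in> Ob (Pc D Y)" "Z \<in> Ob (B1 D)" "m \<in> Ob (Mc' D Y)" for Q Z m
    using that K.fob_Ob[of Z]
    by (intro orthogonal_weight[OF XY(2) _ _ _ const_b_inM[OF XY(2)]] L.orthogonal_par_unit) auto
  from weighted_change.whom_left_adjoint[OF C Dia' this]
  show "naturally_isomorphic (op_cat (Mc' D X) \<times>\<^sub>C Mc' D Y) (B1 D)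
      (nat_obj' D X \<bullet> (id_func \<times>\<^sub>f subM' D f)) (nat_obj' D Y \<bullet> (Exists' D f \<times>\<^sub>f id_func))"
    using f unfolding whom_nat_obj'[OF WX] whom_nat_obj'[OF WY] by (simp add: Exists'_def)
qed

end

theorem proposition10p2:
  fixes D :: "('co, 'ca, 'mo, 'ma, 'po, 'pa, 'no, 'na) doctrine"
  assumes "weak_temporal_doctrine D"
  shows
    "(\<forall>X \<in> Ob (base D).
        enriches (B1 D) (Mc D X) (nat_obj D X) \<and>
        enriches (B1 D) (Mc' D X) (nat_obj' D X)) \<and>
     (\<forall>X \<in> Ob (base D). \<forall>Y \<in> Ob (base D). \<forall>f \<in> hom (base D) X Y.
        naturally_isomorphic (Pc D Y \<times>\<^sub>C Pc D X) (B1 D)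
          (meets D X \<bullet> (subP D f \<times>\<^sub>f id_func)) (meets D Y \<bullet> (id_func \<times>\<^sub>f Sig D f)) \<and>
        naturally_isomorphic (Pc D X \<times>\<^sub>C Pc D Y) (B1 D)
          (meets D X \<bullet> (id_func \<times>\<^sub>f subP D f)) (meets D Y \<bullet> (Sig D f \<times>\<^sub>f id_func))) \<and>
     (\<forall>X \<in> Ob (base D).
        naturally_isomorphic (Mc' D X \<times>\<^sub>C Pc D X) (B1 D)
          (ten D X \<bullet> (id_func \<times>\<^sub>f Dia D X)) (meets D X \<bullet> (inM' D X \<times>\<^sub>f id_func)) \<and>
        naturally_isomorphic (Pc D X \<times>\<^sub>C Mc D X) (B1 D)
          (ten D X \<bullet> (Dia' D X \<times>\<^sub>f id_func)) (meets D X \<bullet> (id_func \<times>\<^sub>f inM D X))) \<and>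
     (\<forall>X \<in> Ob (base D). \<forall>Y \<in> Ob (base D). \<forall>f \<in> hom (base D) X Y.
        naturally_isomorphic (op_cat (Mc D Y) \<times>\<^sub>C Mc D X) (B1 D)
          (nat_obj D X \<bullet> (subM D f \<times>\<^sub>f id_func)) (nat_obj D Y \<bullet> (id_func \<times>\<^sub>f Forall D f)) \<and>
        naturally_isomorphic (op_cat (Mc' D Y) \<times>\<^sub>C Mc' D X) (B1 D)
          (nat_obj' D X \<bullet> (subM' D f \<times>\<^sub>f id_func)) (nat_obj' D Y \<bullet> (id_func \<times>\<^sub>f Forall' D f)) \<and>
        naturally_isomorphic (op_cat (Mc D X) \<times>\<^sub>C Mc D Y) (B1 D)
          (nat_obj D X \<bullet> (id_func \<times>\<^sub>f subM D f)) (nat_obj D Y \<bullet> (Exists D f \<times>\<^sub>f id_func)) \<and>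
        naturally_isomorphic (op_cat (Mc' D X) \<times>\<^sub>C Mc' D Y) (B1 D)
          (nat_obj' D X \<bullet> (id_func \<times>\<^sub>f subM' D f)) (nat_obj' D Y \<bullet> (Exists' D f \<times>\<^sub>f id_func)) \<and>
        naturally_isomorphic (Mc' D Y \<times>\<^sub>C Mc D X) (B1 D)
          (ten D X \<bullet> (subM' D f \<times>\<^sub>f id_func)) (ten D Y \<bullet> (id_func \<times>\<^sub>f Exists D f)) \<and>
        naturally_isomorphic (Mc' D X \<times>\<^sub>C Mc D Y) (B1 D)
          (ten D X \<bullet> (id_func \<times>\<^sub>f subM D f)) (ten D Y \<bullet> (Exists' D f \<times>\<^sub>f id_func)))"
proof -
  interpret weak_temporal_doctrine D by fact
  show ?thesis
    by (intro conjI ballI nat_obj_enriches meets_sub ten_Dia ten_Dia' nat_obj_sub nat_obj'_sub ten_sub ten_sub')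
qed

end
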